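(* Let $\lambda$ be a regular cardinal, let $\mathcal{K}$ be a class-locally $\lambda$-presentable category and let $(\mathcal{L},\mathcal{R})$ be a cofibrantly class-$\lambda$-generated weak factorization system in $\mathcal{K}$. Then $\mathcal{R}$ (regarded as a full subcategory of $\mathcal{K}^\to$) is a class-$\lambda$-accessible category strongly $\lambda$-accessibly embedded in $\mathcal{K}^\to$.
   Context: Sets and classes are distinguished (Gödel–Bernays set theory); a category may have a proper class of objects but has hom-sets between any two objects. Limits and colimits are small. An object $K$ of a category $\mathcal{K}$ is $\lambda$-presentable if $\hom(K,-):\mathcal{K}\to\mathbf{Set}$ preserves $\lambda$-filtered colimits. $\mathcal{K}$ is class-$\lambda$-accessible if it has $\lambda$-filtered colimits and there is a class $\mathcal{A}$ of $\lambda$-presentable objects such that every object of $\mathcal{K}$ is a $\lambda$-filtered colimit of objects from $\mathcal{A}$. $\mathcal{K}$ is class-locally $\lambda$-presentable if it is complete, cocomplete and class-$\lambda$-accessible. A full subcategory $\mathcal{X}$ of $\mathcal{Y}$ is strongly $\lambda$-accessibly embedded if it is closed under $\lambda$-filtered colimits in $\mathcal{Y}$ and the inclusion $\mathcal{X}\to\mathcal{Y}$ preserves $\lambda$-presentable objects. $\mathcal{K}^\to$ is the category of morphisms of $\mathcal{K}$ (morphisms are commutative squares). A class $\mathcal{C}$ of morphisms of $\mathcal{K}$ is cone-coreflective if for each morphism $f$ of $\mathcal{K}$ there is a subset (a set, not a proper class) $\mathcal{C}_f\subseteq\mathcal{C}$ such that each morphism $g\to f$ in $\mathcal{K}^\to$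 with $g\in\mathcal{C}$ factorizes as $g\to h\to f$ in $\mathcal{K}^\to$ with $h\in\mathcal{C}_f$. A morphism is $\lambda$-presentable if its domain and codomain are $\lambda$-presentable in $\mathcal{K}$. For morphisms $f:A\to B$, $g:C\to D$, write $f\,\square\,g$ if for all $u:A\to C$, $v:B\to D$ with $gu=vf$ there is $d:B\to C$ with $df=u$ and $gd=v$. Put $\mathcal{C}^\square=\{g\mid f\,\square\,g\text{ for each }f\in\mathcal{C}\}$ and ${}^\square\mathcal{C}=\{f\mid f\,\square\,g\text{ for each }g\in\mathcal{C}\}$. $\operatorname{cof}(\mathcal{C})$ is the smallest class of morphisms of $\mathcal{K}$ containing isomorphisms and closed under transfinite compositions, pushouts of morphisms from $\mathcal{C}$, and retracts in $\mathcal{K}^\to$. A pair $(\mathcal{L},\mathcal{R})$ of classes of morphisms is a weak factorization system if $\mathcal{R}=\mathcal{L}^\square$, $\mathcal{L}={}^\square\mathcal{R}$, and every morphism $h$ of $\mathcal{K}$ has a factorization $h=gf$ with $f\in\mathcal{L}$ and $g\in\mathcal{R}$ (a weak factorization of $h$; its middle object is the codomain of $f$). A weak factorization system $(\mathcal{L},\mathcal{R})$ in a class-locally $\lambda$-presentable category is cofibrantly class-$\lambda$-generated if $\mathcal{L}=\operatorname{cof}(\mathcal{C})$ for a cone-coreflective class $\mathcal{C}$ of morphisms such that (1) morphisms from $\mathcal{C}$ are $\lambda$-presentable, and (2) any morphism between $\lambda$-presentable objects has a weak factorization with the middle object $\lambda$-presentable. *)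

theory Defs
  imports Main "HOL-Library.FuncSet"
begin

unbundle cardinal_syntax

section \<open>Sets and classes\<close>

text \<open>
  Goedel--Bernays set theory is modelled by a type \<open>'u\<close> whose cardinality is strongly
  inaccessible: classes are the subsets of \<open>'u\<close>, and sets are the classes that are smaller
  than the universe. Only cardinalities matter for smallness, so it also makes sense for
  subsets of other types, such as the squares over a class of arrows.
\<close>

definition small :: "'u itself \<Rightarrow> 'a set \<Rightarrow> bool" where
  "small U A \<longleftrightarrow> |A| <o |UNIV :: 'u set|"

definition set_universe :: "'u itself \<Rightarrow> bool" where
  "set_universe U \<longleftrightarrow>
     natLeq <o |UNIV :: 'u set| \<and>
     regularCard |UNIV :: 'u set| \<and>
     (\<forall>A :: 'u set. small U A \<longrightarrow> small U (Pow A))"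

definition small_regular_cardinal :: "'u rel \<Rightarrow> bool" where
  "small_regular_cardinal \<kappa> \<longleftrightarrow> Cinfinite \<kappa> \<and> regularCard \<kappa> \<and> \<kappa> <o |UNIV :: 'u set|"


section \<open>Categories and functors\<close>

record ('o, 'm) category =
  Obj :: "'o set"
  Arr :: "'m set"
  Dom :: "'m \<Rightarrow> 'o"
  Cod :: "'m \<Rightarrow> 'o"
  Ide :: "'o \<Rightarrow> 'm"
  Comp :: "'m \<Rightarrow> 'm \<Rightarrow> 'm"  (infixl \<open>\<cdot>\<index>\<close> 70)

definition Hom :: "('o, 'm) category \<Rightarrow> 'o \<Rightarrow> 'o \<Rightarrow> 'm set" where
  "Hom C x y = {f \<in> Arr C. Dom C f = x \<and> Cod C f = y}"

locale category =
  fixes C :: "('o, 'm) category" (structure)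
  assumes Dom_in_Obj: "f \<in> Arr C \<Longrightarrow> Dom C f \<in> Obj C"
    and Cod_in_Obj: "f \<in> Arr C \<Longrightarrow> Cod C f \<in> Obj C"
    and Ide_in_Hom: "x \<in> Obj C \<Longrightarrow> Ide C x \<in> Hom C x x"
    and Comp_in_Hom: "f \<in> Hom C x y \<Longrightarrow> g \<in> Hom C y z \<Longrightarrow> g \<cdot> f \<in> Hom C x z"
    and Comp_Ide: "f \<in> Hom C x y \<Longrightarrow> f \<cdot> Ide C x = f"
    and Ide_Comp: "f \<in> Hom C x y \<Longrightarrow> Ide C y \<cdot> f = f"
    and Comp_assoc:
      "f \<in> Hom C w x \<Longrightarrow> g \<in> Hom C x y \<Longrightarrow> h \<in> Hom C y z \<Longrightarrow> (h \<cdot> g) \<cdot> f = h \<cdot> (g \<cdot> f)"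

definition has_small_homs :: "'u itself \<Rightarrow> ('o, 'm) category \<Rightarrow> bool" where
  "has_small_homs U C \<longleftrightarrow> (\<forall>x \<in> Obj C. \<forall>y \<in> Obj C. small U (Hom C x y))"

definition small_category :: "'u itself \<Rightarrow> ('o, 'm) category \<Rightarrow> bool" where
  "small_category U J \<longleftrightarrow> category J \<and> small U (Obj J) \<and> small U (Arr J)"

record ('i, 'j, 'o, 'm) fctr =
  OMap :: "'i \<Rightarrow> 'o"
  AMap :: "'j \<Rightarrow> 'm"

definition is_functor ::
  "('i, 'j) category \<Rightarrow> ('o, 'm) category \<Rightarrow> ('i, 'j, 'o, 'm) fctr \<Rightarrow> bool" where
  "is_functor J C F \<longleftrightarrow>
     category J \<and> category C \<and>
     (\<forall>i \<in> Obj J. OMap F i \<in> Obj C) \<and>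
     (\<forall>a \<in> Arr J. AMap F a \<in> Hom C (OMap F (Dom J a)) (OMap F (Cod J a))) \<and>
     (\<forall>i \<in> Obj J. AMap F (Ide J i) = Ide C (OMap F i)) \<and>
     (\<forall>a \<in> Arr J. \<forall>b \<in> Arr J. Cod J a = Dom J b \<longrightarrow>
        AMap F (b \<cdot>\<^bsub>J\<^esub> a) = AMap F b \<cdot>\<^bsub>C\<^esub> AMap F a)"

definition fctr_comp ::
  "('o, 'm, 'p, 'n) fctr \<Rightarrow> ('i, 'j, 'o, 'm) fctr \<Rightarrow> ('i, 'j, 'p, 'n) fctr" where
  "fctr_comp G F = \<lparr>OMap = OMap G \<circ> OMap F, AMap = AMap G \<circ> AMap F\<rparr>"

definition full_subcategory :: "('o, 'm) category \<Rightarrow> 'o set \<Rightarrow> ('o, 'm) category" where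
  "full_subcategory C X =
     C\<lparr>Obj := X, Arr := {f \<in> Arr C. Dom C f \<in> X \<and> Cod C f \<in> X}\<rparr>"


section \<open>Limits and colimits\<close>

definition is_cocone ::
  "('i, 'j) category \<Rightarrow> ('o, 'm) category \<Rightarrow> ('i, 'j, 'o, 'm) fctr \<Rightarrow> 'o \<Rightarrow> ('i \<Rightarrow> 'm) \<Rightarrow> bool" where
  "is_cocone J C F x c \<longleftrightarrow>
     x \<in> Obj C \<and> (\<forall>i \<in> Obj J. c i \<in> Hom C (OMap F i) x) \<and>
     (\<forall>a \<in> Arr J. c (Cod J a) \<cdot>\<^bsub>C\<^esub> AMap F a = c (Dom J a))"

definition is_colimit ::
  "('i, 'j) category \<Rightarrow> ('o, 'm) category \<Rightarrow> ('i, 'j, 'o, 'm) fctr \<Rightarrow> 'o \<Rightarrow> ('i \<Rightarrow> 'm) \<Rightarrow> bool" where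
  "is_colimit J C F x c \<longleftrightarrow>
     is_cocone J C F x c \<and>
     (\<forall>y d. is_cocone J C F y d \<longrightarrow>
        (\<exists>!h. h \<in> Hom C x y \<and> (\<forall>i \<in> Obj J. h \<cdot>\<^bsub>C\<^esub> c i = d i)))"

definition is_cone ::
  "('i, 'j) category \<Rightarrow> ('o, 'm) category \<Rightarrow> ('i, 'j, 'o, 'm) fctr \<Rightarrow> 'o \<Rightarrow> ('i \<Rightarrow> 'm) \<Rightarrow> bool" where
  "is_cone J C F x c \<longleftrightarrow>
     x \<in> Obj C \<and> (\<forall>i \<in> Obj J. c i \<in> Hom C x (OMap F i)) \<and>
     (\<forall>a \<in> Arr J. AMap F a \<cdot>\<^bsub>C\<^esub> c (Dom J a) = c (Cod J a))"

definition is_limit ::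
  "('i, 'j) category \<Rightarrow> ('o, 'm) category \<Rightarrow> ('i, 'j, 'o, 'm) fctr \<Rightarrow> 'o \<Rightarrow> ('i \<Rightarrow> 'm) \<Rightarrow> bool" where
  "is_limit J C F x c \<longleftrightarrow>
     is_cone J C F x c \<and>
     (\<forall>y d. is_cone J C F y d \<longrightarrow>
        (\<exists>!h. h \<in> Hom C y x \<and> (\<forall>i \<in> Obj J. c i \<cdot>\<^bsub>C\<^esub> h = d i)))"

text \<open>Every small category is isomorphic to one carried by subsets of \<open>'u\<close>, so it suffices to
  let diagram shapes range over \<open>('u, 'u) category\<close>.\<close>

definition cocomplete_category :: "'u itself \<Rightarrow> ('o, 'm) category \<Rightarrow> bool" where
  "cocomplete_category U C \<longleftrightarrow>
     (\<forall>(J :: ('u, 'u) category) F. small_category U J \<and> is_functor J C F \<longrightarrow>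
        (\<exists>x c. is_colimit J C F x c))"

definition complete_category :: "'u itself \<Rightarrow> ('o, 'm) category \<Rightarrow> bool" where
  "complete_category U C \<longleftrightarrow>
     (\<forall>(J :: ('u, 'u) category) F. small_category U J \<and> is_functor J C F \<longrightarrow>
        (\<exists>x c. is_limit J C F x c))"

text \<open>The small categories in which every diagram with fewer than \<open>\<kappa>\<close> morphisms has a
  cocone. Diagrams are functors and not just subcategories: a one-object category given by a
  monoid may have too few small subcategories to see its parallel pairs.\<close>

definition filtered :: "'u rel \<Rightarrow> ('u, 'u) category \<Rightarrow> bool" where
  "filtered \<kappa> J \<longleftrightarrow>
     small_category TYPE('u) J \<and>
     (\<forall>(S :: ('u, 'u) category) D. is_functor S J D \<and> |Arr S| <o \<kappa> \<longrightarrow>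
        (\<exists>x c. is_cocone S J D x c))"

definition has_filtered_colimits :: "'u rel \<Rightarrow> ('o, 'm) category \<Rightarrow> bool" where
  "has_filtered_colimits \<kappa> C \<longleftrightarrow>
     (\<forall>J F. filtered \<kappa> J \<and> is_functor J C F \<longrightarrow> (\<exists>x c. is_colimit J C F x c))"

definition preserves_filtered_colimits ::
  "'u rel \<Rightarrow> ('o, 'm) category \<Rightarrow> ('p, 'n) category \<Rightarrow> ('o, 'm, 'p, 'n) fctr \<Rightarrow> bool" where
  "preserves_filtered_colimits \<kappa> C D G \<longleftrightarrow>
     (\<forall>J F x c. filtered \<kappa> J \<and> is_functor J C F \<and> is_colimit J C F x c \<longrightarrow>
        is_colimit J D (fctr_comp G F) (OMap G x) (\<lambda>i. AMap G (c i)))"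


section \<open>Presentable objects\<close>

datatype 'a set_map = Set_Map (sm_dom: "'a set") (sm_fun: "'a \<Rightarrow> 'a") (sm_cod: "'a set")

text \<open>The category of small subsets of a type. If \<open>'a\<close> has the cardinality of the universe
  \<open>'u\<close>, every small set is in bijection with one of these, so this is \<open>Set\<close> up to
  equivalence; it is used with the arrows of a category as elements, so that hom-sets are
  objects.\<close>

definition set_category :: "'u itself \<Rightarrow> ('a set, 'a set_map) category" where
  "set_category U =
     \<lparr>Obj = {A. small U A},
      Arr = {f. small U (sm_dom f) \<and> small U (sm_cod f) \<and> sm_fun f \<in> sm_dom f \<rightarrow>\<^sub>E sm_cod f},
      Dom = sm_dom,
      Cod = sm_cod,
      Ide = (\<lambda>A. Set_Map A (\<lambda>x\<in>A. x) A),
      Comp = (\<lambda>g f. Set_Map (sm_dom f) (compose (sm_dom f) (sm_fun g) (sm_fun f)) (sm_cod g))\<rparr>"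

definition hom_functor ::
  "('o, 'm) category \<Rightarrow> 'o \<Rightarrow> ('o, 'm, 'm set, 'm set_map) fctr" where
  "hom_functor C k =
     \<lparr>OMap = (\<lambda>x. Hom C k x),
      AMap = (\<lambda>g. Set_Map (Hom C k (Dom C g)) (\<lambda>f\<in>Hom C k (Dom C g). g \<cdot>\<^bsub>C\<^esub> f)
                    (Hom C k (Cod C g)))\<rparr>"

definition presentable :: "'u rel \<Rightarrow> ('o, 'm) category \<Rightarrow> 'o \<Rightarrow> bool" where
  "presentable \<kappa> C k \<longleftrightarrow>
     k \<in> Obj C \<and>
     preserves_filtered_colimits \<kappa> C (set_category TYPE('u)) (hom_functor C k)"

definition class_accessible :: "'u rel \<Rightarrow> ('o, 'm) category \<Rightarrow> bool" where
  "class_accessible \<kappa> C \<longleftrightarrow>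
     category C \<and> has_small_homs TYPE('u) C \<and>
     has_filtered_colimits \<kappa> C \<and>
     (\<exists>A. (\<forall>k \<in> A. presentable \<kappa> C k) \<and>
        (\<forall>x \<in> Obj C. \<exists>J F c. filtered \<kappa> J \<and> is_functor J C F \<and>
           (\<forall>i \<in> Obj J. OMap F i \<in> A) \<and> is_colimit J C F x c))"

definition class_locally_presentable :: "'u rel \<Rightarrow> ('o, 'm) category \<Rightarrow> bool" where
  "class_locally_presentable \<kappa> C \<longleftrightarrow>
     complete_category TYPE('u) C \<and> cocomplete_category TYPE('u) C \<and> class_accessible \<kappa> C"

definition strongly_accessibly_embedded ::
  "'u rel \<Rightarrow> 'o set \<Rightarrow> ('o, 'm) category \<Rightarrow> bool" where
  "strongly_accessibly_embedded \<kappa> X C \<longleftrightarrow>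
     X \<subseteq> Obj C \<and>
     (\<forall>J F x c. filtered \<kappa> J \<and> is_functor J C F \<and> (\<forall>i \<in> Obj J. OMap F i \<in> X) \<and>
        is_colimit J C F x c \<longrightarrow> x \<in> X) \<and>
     (\<forall>k. presentable \<kappa> (full_subcategory C X) k \<longrightarrow> presentable \<kappa> C k)"


section \<open>The category of morphisms\<close>

datatype 'm square = Square (sq_src: 'm) (sq_top: 'm) (sq_bot: 'm) (sq_tgt: 'm)

definition arrow_category :: "('o, 'm) category \<Rightarrow> ('m, 'm square) category" where
  "arrow_category C =
     \<lparr>Obj = Arr C,
      Arr = {s. sq_src s \<in> Arr C \<and> sq_tgt s \<in> Arr C \<and>
                sq_top s \<in> Hom C (Dom C (sq_src s)) (Dom C (sq_tgt s)) \<and>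
                sq_bot s \<in> Hom C (Cod C (sq_src s)) (Cod C (sq_tgt s)) \<and>
                sq_tgt s \<cdot>\<^bsub>C\<^esub> sq_top s = sq_bot s \<cdot>\<^bsub>C\<^esub> sq_src s},
      Dom = sq_src,
      Cod = sq_tgt,
      Ide = (\<lambda>f. Square f (Ide C (Dom C f)) (Ide C (Cod C f)) f),
      Comp = (\<lambda>t s. Square (sq_src s) (sq_top t \<cdot>\<^bsub>C\<^esub> sq_top s) (sq_bot t \<cdot>\<^bsub>C\<^esub> sq_bot s) (sq_tgt t))\<rparr>"

definition cone_coreflective :: "'u itself \<Rightarrow> ('o, 'm) category \<Rightarrow> 'm set \<Rightarrow> bool" where
  "cone_coreflective U C S \<longleftrightarrow>
     S \<subseteq> Arr C \<and>
     (\<forall>f \<in> Arr C. \<exists>S\<^sub>f. S\<^sub>f \<subseteq> S \<and> small U S\<^sub>f \<and>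
        (\<forall>g \<in> S. \<forall>s \<in> Hom (arrow_category C) g f.
           \<exists>h \<in> S\<^sub>f. \<exists>p \<in> Hom (arrow_category C) g h. \<exists>q \<in> Hom (arrow_category C) h f.
             s = q \<cdot>\<^bsub>arrow_category C\<^esub> p))"


section \<open>Weak factorization systems\<close>

definition lifts :: "('o, 'm) category \<Rightarrow> 'm \<Rightarrow> 'm \<Rightarrow> bool" where
  "lifts C f g \<longleftrightarrow>
     (\<forall>u \<in> Hom C (Dom C f) (Dom C g). \<forall>v \<in> Hom C (Cod C f) (Cod C g).
        g \<cdot>\<^bsub>C\<^esub> u = v \<cdot>\<^bsub>C\<^esub> f \<longrightarrow>
        (\<exists>d \<in> Hom C (Cod C f) (Dom C g). d \<cdot>\<^bsub>C\<^esub> f = u \<and> g \<cdot>\<^bsub>C\<^esub> d = v))"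

definition box_right :: "('o, 'm) category \<Rightarrow> 'm set \<Rightarrow> 'm set" where
  "box_right C S = {g \<in> Arr C. \<forall>f \<in> S. lifts C f g}"

definition box_left :: "('o, 'm) category \<Rightarrow> 'm set \<Rightarrow> 'm set" where
  "box_left C S = {f \<in> Arr C. \<forall>g \<in> S. lifts C f g}"

text \<open>The middle object is \<open>Cod C f\<close>.\<close>

definition weak_factorization ::
  "('o, 'm) category \<Rightarrow> 'm set \<Rightarrow> 'm set \<Rightarrow> 'm \<Rightarrow> 'm \<Rightarrow> 'm \<Rightarrow> bool" where
  "weak_factorization C L R h f g \<longleftrightarrow> f \<in> L \<and> g \<in> R \<and> Cod C f = Dom C g \<and> h = g \<cdot>\<^bsub>C\<^esub> f"

definition weak_factorization_system ::
  "('o, 'm) category \<Rightarrow> 'm set \<Rightarrow> 'm set \<Rightarrow> bool" where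
  "weak_factorization_system C L R \<longleftrightarrow>
     L \<subseteq> Arr C \<and> R \<subseteq> Arr C \<and>
     R = box_right C L \<and> L = box_left C R \<and>
     (\<forall>h \<in> Arr C. \<exists>f g. weak_factorization C L R h f g)"


section \<open>Cofibrant closure\<close>

definition isos :: "('o, 'm) category \<Rightarrow> 'm set" where
  "isos C = {f \<in> Arr C. \<exists>g \<in> Hom C (Cod C f) (Dom C f).
               g \<cdot>\<^bsub>C\<^esub> f = Ide C (Dom C f) \<and> f \<cdot>\<^bsub>C\<^esub> g = Ide C (Cod C f)}"

text \<open>\<open>f'\<close> is a pushout of \<open>f\<close> along \<open>u\<close>, with \<open>v \<cdot> f = f' \<cdot> u\<close>.\<close>

definition is_pushout :: "('o, 'm) category \<Rightarrow> 'm \<Rightarrow> 'm \<Rightarrow> 'm \<Rightarrow> 'm \<Rightarrow> bool" where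
  "is_pushout C f u f' v \<longleftrightarrow>
     f \<in> Arr C \<and> u \<in> Arr C \<and> f' \<in> Arr C \<and> v \<in> Arr C \<and>
     Dom C f = Dom C u \<and> Cod C u = Dom C f' \<and> Cod C f = Dom C v \<and> Cod C v = Cod C f' \<and>
     v \<cdot>\<^bsub>C\<^esub> f = f' \<cdot>\<^bsub>C\<^esub> u \<and>
     (\<forall>z. \<forall>a \<in> Hom C (Cod C f) z. \<forall>b \<in> Hom C (Cod C u) z. a \<cdot>\<^bsub>C\<^esub> f = b \<cdot>\<^bsub>C\<^esub> u \<longrightarrow>
        (\<exists>!h. h \<in> Hom C (Cod C f') z \<and> h \<cdot>\<^bsub>C\<^esub> v = a \<and> h \<cdot>\<^bsub>C\<^esub> f' = b))"

definition is_retract :: "('o, 'm) category \<Rightarrow> 'o \<Rightarrow> 'o \<Rightarrow> bool" where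
  "is_retract C x y \<longleftrightarrow>
     x \<in> Obj C \<and> y \<in> Obj C \<and> (\<exists>s \<in> Hom C x y. \<exists>p \<in> Hom C y x. p \<cdot>\<^bsub>C\<^esub> s = Ide C x)"

text \<open>For a preorder \<open>r\<close>: the pair \<open>(i, j)\<close> is the arrow \<open>i \<rightarrow> j\<close>.\<close>

definition order_category :: "'i rel \<Rightarrow> ('i, 'i \<times> 'i) category" where
  "order_category r =
     \<lparr>Obj = Field r, Arr = r, Dom = fst, Cod = snd, Ide = (\<lambda>i. (i, i)),
      Comp = (\<lambda>b a. (fst a, snd b))\<rparr>"

definition is_successor :: "'i rel \<Rightarrow> 'i \<Rightarrow> 'i \<Rightarrow> bool" where
  "is_successor r i j \<longleftrightarrow> i \<in> Field r \<and> j \<in> Field r \<and> underS r j = under r i"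

definition is_limit_element :: "'i rel \<Rightarrow> 'i \<Rightarrow> bool" where
  "is_limit_element r j \<longleftrightarrow>
     j \<in> Field r \<and> underS r j \<noteq> {} \<and> (\<nexists>i. is_successor r i j)"

text \<open>Smooth chains \<open>(A\<^sub>i \<rightarrow> A\<^sub>j)\<close> with \<open>i \<le> j \<le> \<alpha>\<close>, whose composition is
  \<open>A\<^sub>0 \<rightarrow> A\<^sub>\<alpha>\<close>. The ordinal \<open>\<alpha> + 1\<close> is given by a small
  well-order on a subset of \<open>'u\<close> with least element \<open>b\<close> and greatest element \<open>t\<close>.\<close>

definition transfinite_composition ::
  "'u itself \<Rightarrow> ('o, 'm) category \<Rightarrow> 'm set \<Rightarrow> 'm \<Rightarrow> bool" where
  "transfinite_composition U C S h \<longleftrightarrow>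
     (\<exists>(r :: 'u rel) F b t.
        Well_order r \<and> small U (Field r) \<and>
        is_functor (order_category r) C F \<and>
        (\<forall>i j. is_successor r i j \<longrightarrow> AMap F (i, j) \<in> S) \<and>
        (\<forall>j. is_limit_element r j \<longrightarrow>
           is_colimit (order_category (Restr r (underS r j))) C F (OMap F j) (\<lambda>i. AMap F (i, j))) \<and>
        b \<in> Field r \<and> t \<in> Field r \<and> (\<forall>i \<in> Field r. (b, i) \<in> r \<and> (i, t) \<in> r) \<and>
        h = AMap F (b, t))"

definition cof :: "'u itself \<Rightarrow> ('o, 'm) category \<Rightarrow> 'm set \<Rightarrow> 'm set" where
  "cof U C S =
     \<Inter>{T. T \<subseteq> Arr C \<and> isos C \<subseteq> T \<and>
         (\<forall>h. transfinite_composition U C T h \<longrightarrow> h \<in> T) \<and>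
         (\<forall>f \<in> S. \<forall>u f' v. is_pushout C f u f' v \<longrightarrow> f' \<in> T) \<and>
         (\<forall>f g. g \<in> T \<and> is_retract (arrow_category C) f g \<longrightarrow> f \<in> T)}"

definition cofibrantly_class_generated ::
  "'u rel \<Rightarrow> ('o, 'm) category \<Rightarrow> 'm set \<Rightarrow> 'm set \<Rightarrow> bool" where
  "cofibrantly_class_generated \<kappa> C L R \<longleftrightarrow>
     (\<exists>S. cone_coreflective TYPE('u) C S \<and> L = cof TYPE('u) C S \<and>
        (\<forall>f \<in> S. presentable \<kappa> C (Dom C f) \<and> presentable \<kappa> C (Cod C f))) \<and>
     (\<forall>h \<in> Arr C. presentable \<kappa> C (Dom C h) \<and> presentable \<kappa> C (Cod C h) \<longrightarrow>
        (\<exists>f g. weak_factorization C L R h f g \<and> presentable \<kappa> C (Cod C f)))"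

end

theory Submission
  imports Defs
begin

text \<open>
  The right class consists of the \<open>S\<close>-injective morphisms, for a class \<open>S\<close> of morphisms with
  presentable ends: the left lifting property against a fixed class survives isomorphisms, pushouts, transfinite compositions
  and retracts, so \<open>cof S\<close> has the same right lifting class as \<open>S\<close> (\<open>box_right_cof\<close>). Morphisms with
  presentable ends are presentable in the category of morphisms (\<open>presentable_arrow\<close>), so a lifting
  problem of a member of \<open>S\<close> against a filtered colimit already lives at a stage, and the right class
  \<open>R\<close> is closed under filtered colimits (\<open>box_right_filtered_closed\<close>).

  Let \<open>g\<close> be in \<open>R\<close>, and let \<open>f\<close> have presentable ends and a square to \<open>g\<close>. Factor \<open>f = r \<cdot> l\<close> through
  a presentable object, with \<open>l\<close> in the left class and \<open>r\<close> in \<open>R\<close>. Lifting \<open>l\<close> against \<open>g\<close> factors the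
  square through \<open>r\<close> (\<open>weak_factorization_over\<close>). So the members of \<open>R\<close> with presentable ends are
  cofinal among the presentable morphisms over \<open>g\<close>.

  There may be a proper class of these, and a small filtered diagram has to be extracted. The domain
  and the codomain of \<open>g\<close> are small filtered colimits of presentable objects, which yields a small
  set of morphisms between stages over \<open>g\<close>; for each of them one factorization through \<open>R\<close> is chosen.
  Fewer than \<open>\<kappa>\<close> presentable morphisms over \<open>g\<close>, with fewer than \<open>\<kappa>\<close> arrows between them, always have
  a cocone to a chosen object (\<open>graph_factors_through_refined\<close>). This one fact shows that the full
  subcategory of the slice on the chosen objects is filtered, and that presentable objects detect
  the domains and the codomains of its objects as in a colimit. Since the ends of \<open>g\<close> are filtered
  colimits of presentable objects, they are then the colimits of these domains and codomains
  (\<open>colimit_recognition\<close>), and \<open>g\<close> is the colimit of the chosen members of \<open>R\<close> (\<open>colimit_slice\<close>).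

  Hence \<open>R\<close> is accessible. A presentable object of \<open>R\<close> is a retract of one of the members with
  presentable ends, because its identity factors through a stage of such a colimit, and so it is
  presentable in the category of morphisms (\<open>accessibly_embedded_by_dense_class\<close>).

  Presentability is used throughout in its elementwise form (\<open>presentable_iff_detects\<close>), and
  filteredness in the form of cocones on graphs of arrows (\<open>graph_cocone\<close>).
\<close>


section \<open>Small sets\<close>

lemma small_regular_cardinalD:
  fixes \<kappa> :: "'u rel"
  assumes "small_regular_cardinal \<kappa>"
  shows "Cinfinite \<kappa>" "regularCard \<kappa>" "\<kappa> <o |UNIV :: 'u set|"
  using assms by (auto simp: small_regular_cardinal_def)

lemma set_universeD:
  assumes "set_universe TYPE('u)"
  shows "infinite (UNIV :: 'u set)" "regularCard |UNIV :: 'u set|" "Cinfinite |UNIV :: 'u set|"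
proof -
  have "natLeq \<le>o |UNIV :: 'u set|"
    using assms by (auto simp: set_universe_def intro: ordLess_imp_ordLeq)
  then show inf: "infinite (UNIV :: 'u set)"
    using infinite_iff_natLeq_ordLeq by blast
  then show "Cinfinite |UNIV :: 'u set|" by (simp add: cinfinite_def Field_card_of card_of_card_order_on)
  show "regularCard |UNIV :: 'u set|" using assms by (simp add: set_universe_def)
qed

lemma small_subset: "small U A \<Longrightarrow> B \<subseteq> A \<Longrightarrow> small U B"
  unfolding small_def by (meson card_of_mono1 ordLeq_ordLess_trans)

lemma small_image: "small U A \<Longrightarrow> small U (f ` A)"
  unfolding small_def by (meson card_of_image ordLeq_ordLess_trans)

lemma small_Sigma:
  assumes "set_universe TYPE('u)" "small TYPE('u) A" "\<And>a. a \<in> A \<Longrightarrow> small TYPE('u) (F a)"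
  shows "small TYPE('u) (Sigma A F)"
proof -
  have "stable |UNIV :: 'u set|"
    using set_universeD[OF assms(1)]
    by (intro regularCard_stable) (auto simp: cinfinite_def)
  then show ?thesis
    using assms(2,3) unfolding small_def by (intro stable_elim) auto
qed

lemma card_less_finite:
  assumes "Cinfinite \<kappa>" "finite A"
  shows "|A| <o \<kappa>"
  using assms
  by (intro finite_ordLess_infinite)
     (auto simp: cinfinite_def Field_card_of card_of_well_order_on card_order_on_well_order_on)

lemma small_finite:
  assumes "set_universe TYPE('u)" "finite A"
  shows "small TYPE('u) A"
  using card_less_finite[OF set_universeD(3)[OF assms(1)] assms(2)] by (simp add: small_def)

lemma card_less_Plus:
  assumes "Cinfinite \<kappa>" "|A| <o \<kappa>" "|B| <o \<kappa>"
  shows "|A <+> B| <o \<kappa>"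
  using assms card_of_Plus_ordLess_infinite_Field cinfinite_def by blast

lemma card_less_image: "|A| <o \<kappa> \<Longrightarrow> |f ` A| <o \<kappa>"
  by (meson card_of_image ordLeq_ordLess_trans)

lemma card_less_subset: "|A| <o \<kappa> \<Longrightarrow> B \<subseteq> A \<Longrightarrow> |B| <o \<kappa>"
  by (meson card_of_mono1 ordLeq_ordLess_trans)


section \<open>Categories, functors and cocones\<close>

lemma in_Hom_iff: "f \<in> Hom C x y \<longleftrightarrow> f \<in> Arr C \<and> Dom C f = x \<and> Cod C f = y"
  by (auto simp: Hom_def)

lemma HomI: "f \<in> Arr C \<Longrightarrow> f \<in> Hom C (Dom C f) (Cod C f)"
  by (auto simp: Hom_def)

lemma (in category) Hom_Obj: "f \<in> Hom C x y \<Longrightarrow> x \<in> Obj C" "f \<in> Hom C x y \<Longrightarrow> y \<in> Obj C"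
  using Dom_in_Obj Cod_in_Obj by (auto simp: Hom_def)

lemma is_functorD:
  assumes "is_functor J C F"
  shows "category J" "category C"
    and "i \<in> Obj J \<Longrightarrow> OMap F i \<in> Obj C"
    and "a \<in> Hom J i j \<Longrightarrow> AMap F a \<in> Hom C (OMap F i) (OMap F j)"
    and "i \<in> Obj J \<Longrightarrow> AMap F (Ide J i) = Ide C (OMap F i)"
    and "a \<in> Hom J i j \<Longrightarrow> b \<in> Hom J j k \<Longrightarrow> AMap F (b \<cdot>\<^bsub>J\<^esub> a) = AMap F b \<cdot>\<^bsub>C\<^esub> AMap F a"
  using assms by (auto simp: is_functor_def Hom_def)

lemma is_functorI:
  assumes "category J" "category C"
    and "\<And>i. i \<in> Obj J \<Longrightarrow> OMap F i \<in> Obj C"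
    and "\<And>a i j. a \<in> Hom J i j \<Longrightarrow> AMap F a \<in> Hom C (OMap F i) (OMap F j)"
    and "\<And>i. i \<in> Obj J \<Longrightarrow> AMap F (Ide J i) = Ide C (OMap F i)"
    and "\<And>a b i j k. a \<in> Hom J i j \<Longrightarrow> b \<in> Hom J j k \<Longrightarrow> AMap F (b \<cdot>\<^bsub>J\<^esub> a) = AMap F b \<cdot>\<^bsub>C\<^esub> AMap F a"
  shows "is_functor J C F"
  unfolding is_functor_def using assms by (auto simp: Hom_def)

lemma is_functor_comp:
  assumes "is_functor I J G" "is_functor J C F"
  shows "is_functor I C (fctr_comp F G)"
proof (rule is_functorI)
  show "category I" "category C" using assms by (auto simp: is_functorD)
qed (auto simp: fctr_comp_def is_functorD[OF assms(1)] is_functorD[OF assms(2)]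
      intro!: is_functorD(4)[OF assms(2)] is_functorD(4)[OF assms(1)]
      intro: is_functorD(6)[OF assms(2) is_functorD(4)[OF assms(1)] is_functorD(4)[OF assms(1)]])

lemma is_coconeD:
  assumes "is_cocone J C F x c"
  shows "x \<in> Obj C"
    and "i \<in> Obj J \<Longrightarrow> c i \<in> Hom C (OMap F i) x"
    and "a \<in> Hom J i j \<Longrightarrow> c j \<cdot>\<^bsub>C\<^esub> AMap F a = c i"
  using assms by (auto simp: is_cocone_def Hom_def)

lemma is_coconeI:
  assumes "x \<in> Obj C"
    and "\<And>i. i \<in> Obj J \<Longrightarrow> c i \<in> Hom C (OMap F i) x"
    and "\<And>a i j. a \<in> Hom J i j \<Longrightarrow> c j \<cdot>\<^bsub>C\<^esub> AMap F a = c i"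
  shows "is_cocone J C F x c"
  using assms by (auto simp: is_cocone_def Hom_def)

lemma is_colimitD:
  assumes "is_colimit J C F x c"
  shows "is_cocone J C F x c"
    and "is_cocone J C F y d \<Longrightarrow> \<exists>h \<in> Hom C x y. \<forall>i \<in> Obj J. h \<cdot>\<^bsub>C\<^esub> c i = d i"
    and "is_cocone J C F y d \<Longrightarrow> \<exists>!h. h \<in> Hom C x y \<and> (\<forall>i \<in> Obj J. h \<cdot>\<^bsub>C\<^esub> c i = d i)"
proof -
  show "is_cocone J C F x c" using assms by (simp add: is_colimit_def)
  assume "is_cocone J C F y d"
  then show "\<exists>!h. h \<in> Hom C x y \<and> (\<forall>i \<in> Obj J. h \<cdot>\<^bsub>C\<^esub> c i = d i)"
    using assms unfolding is_colimit_def by (elim conjE allE impE) assumption+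
  then show "\<exists>h \<in> Hom C x y. \<forall>i \<in> Obj J. h \<cdot>\<^bsub>C\<^esub> c i = d i" by blast
qed

lemma cocone_postcomp:
  fixes C (structure)
  assumes F: "is_functor J C F" and c: "is_cocone J C F x c" and h: "h \<in> Hom C x y"
  shows "is_cocone J C F y (\<lambda>i. h \<cdot> c i)"
proof (rule is_coconeI)
  interpret category C using F by (rule is_functorD)
  interpret J: category J using F by (rule is_functorD)
  show "y \<in> Obj C" using h by (rule Hom_Obj)
  show "h \<cdot> c i \<in> Hom C (OMap F i) y" if "i \<in> Obj J" for i
    using is_coconeD(2)[OF c that] h by (rule Comp_in_Hom)
  fix a i j assume a: "a \<in> Hom J i j"
  then have "(h \<cdot> c j) \<cdot> AMap F a = h \<cdot> (c j \<cdot> AMap F a)"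
    by (intro Comp_assoc[OF is_functorD(4)[OF F a] is_coconeD(2)[OF c] h] J.Hom_Obj)
  then show "(h \<cdot> c j) \<cdot> AMap F a = h \<cdot> c i"
    using is_coconeD(3)[OF c a] by simp
qed

lemma colimit_eqI:
  fixes C (structure)
  assumes F: "is_functor J C F" and x: "is_colimit J C F x c"
    and h: "h \<in> Hom C x y" "h' \<in> Hom C x y"
    and eq: "\<And>i. i \<in> Obj J \<Longrightarrow> h \<cdot> c i = h' \<cdot> c i"
  shows "h = h'"
proof -
  have "is_cocone J C F y (\<lambda>i. h' \<cdot> c i)"
    using cocone_postcomp[OF F is_colimitD(1)[OF x] h(2)] .
  then have "\<exists>!k. k \<in> Hom C x y \<and> (\<forall>i \<in> Obj J. k \<cdot> c i = h' \<cdot> c i)"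
    by (rule is_colimitD(3)[OF x])
  then show ?thesis using h eq by blast
qed

lemma is_colimitI:
  assumes "is_cocone J C F x c"
    and "\<And>y d. is_cocone J C F y d \<Longrightarrow> \<exists>h \<in> Hom C x y. \<forall>i \<in> Obj J. h \<cdot>\<^bsub>C\<^esub> c i = d i"
    and "\<And>y h h'. h \<in> Hom C x y \<Longrightarrow> h' \<in> Hom C x y \<Longrightarrow>
           \<forall>i \<in> Obj J. h \<cdot>\<^bsub>C\<^esub> c i = h' \<cdot>\<^bsub>C\<^esub> c i \<Longrightarrow> h = h'"
  shows "is_colimit J C F x c"
  unfolding is_colimit_def
proof (intro conjI allI impI)
  fix y d assume "is_cocone J C F y d"
  then obtain h where h: "h \<in> Hom C x y" "\<forall>i \<in> Obj J. h \<cdot>\<^bsub>C\<^esub> c i = d i"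
    using assms(2) by blast
  then show "\<exists>!h. h \<in> Hom C x y \<and> (\<forall>i \<in> Obj J. h \<cdot>\<^bsub>C\<^esub> c i = d i)"
    using assms(3) by (metis (no_types, lifting))
qed fact

lemma colimit_iso_transport:
  fixes C (structure)
  assumes F: "is_functor J C F" and c: "is_colimit J C F x c" and d: "is_cocone J C F y d"
    and p: "p \<in> Hom C x y" "\<And>i. i \<in> Obj J \<Longrightarrow> p \<cdot> c i = d i"
    and q: "q \<in> Hom C y x" "q \<cdot> p = Ide C x" "p \<cdot> q = Ide C y"
  shows "is_colimit J C F y d"
proof (rule is_colimitI[OF d])
  interpret category C using F by (rule is_functorD)
  have ci: "c i \<in> Hom C (OMap F i) x" if "i \<in> Obj J" for i
    using is_coconeD(2)[OF is_colimitD(1)[OF c] that] .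
  have di: "d i \<in> Hom C (OMap F i) y" if "i \<in> Obj J" for i
    using is_coconeD(2)[OF d that] .
  have qd: "q \<cdot> d i = c i" if "i \<in> Obj J" for i
    using that p q ci Comp_assoc[OF ci[OF that] p(1) q(1)] Ide_Comp[OF ci[OF that]] by simp
  fix z e assume "is_cocone J C F z e"
  then obtain h where h: "h \<in> Hom C x z" "\<forall>i \<in> Obj J. h \<cdot> c i = e i"
    using is_colimitD(2)[OF c] by blast
  show "\<exists>h \<in> Hom C y z. \<forall>i \<in> Obj J. h \<cdot> d i = e i"
  proof (intro bexI ballI)
    show "h \<cdot> q \<in> Hom C y z" using q h by (intro Comp_in_Hom)
    show "h \<cdot> q \<cdot> d i = e i" if "i \<in> Obj J" for i
      using Comp_assoc[OF di[OF that] q(1) h(1)] qd[OF that] h(2) that by simp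
  qed
next
  interpret category C using F by (rule is_functorD)
  have ci: "c i \<in> Hom C (OMap F i) x" if "i \<in> Obj J" for i
    using is_coconeD(2)[OF is_colimitD(1)[OF c] that] .
  fix z h h' assume h: "h \<in> Hom C y z" "h' \<in> Hom C y z"
    and eq: "\<forall>i \<in> Obj J. h \<cdot> d i = h' \<cdot> d i"
  have "h \<cdot> p = h' \<cdot> p"
  proof (rule colimit_eqI[OF F c])
    show "h \<cdot> p \<in> Hom C x z" "h' \<cdot> p \<in> Hom C x z"
      using p(1) h by (auto intro: Comp_in_Hom)
    show "h \<cdot> p \<cdot> c i = h' \<cdot> p \<cdot> c i" if "i \<in> Obj J" for i
      using Comp_assoc[OF ci[OF that] p(1) h(1)] Comp_assoc[OF ci[OF that] p(1) h(2)]
        p(2)[OF that] eq that by simp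
  qed
  then show "h = h'"
    using Comp_assoc[OF q(1) p(1) h(1)] Comp_assoc[OF q(1) p(1) h(2)] q(3) Comp_Ide h by metis
qed

lemma colimits_isomorphic:
  fixes C (structure)
  assumes F: "is_functor J C F" and c: "is_colimit J C F x c" and d: "is_colimit J C F y d"
  obtains p q where "p \<in> Hom C x y" "q \<in> Hom C y x"
    "q \<cdot> p = Ide C x" "p \<cdot> q = Ide C y" "\<And>i. i \<in> Obj J \<Longrightarrow> p \<cdot> c i = d i"
proof -
  interpret category C using F by (rule is_functorD)
  have ci: "c i \<in> Hom C (OMap F i) x" if "i \<in> Obj J" for i
    using is_coconeD(2)[OF is_colimitD(1)[OF c] that] .
  have di: "d i \<in> Hom C (OMap F i) y" if "i \<in> Obj J" for i
    using is_coconeD(2)[OF is_colimitD(1)[OF d] that] .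
  obtain p where p: "p \<in> Hom C x y" "\<forall>i \<in> Obj J. p \<cdot> c i = d i"
    using is_colimitD(2)[OF c is_colimitD(1)[OF d]] by blast
  obtain q where q: "q \<in> Hom C y x" "\<forall>i \<in> Obj J. q \<cdot> d i = c i"
    using is_colimitD(2)[OF d is_colimitD(1)[OF c]] by blast
  have "q \<cdot> p = Ide C x"
  proof (rule colimit_eqI[OF F c])
    show "q \<cdot> p \<in> Hom C x x" "Ide C x \<in> Hom C x x"
      using p q by (auto intro: Comp_in_Hom Ide_in_Hom Hom_Obj)
    show "q \<cdot> p \<cdot> c i = Ide C x \<cdot> c i" if "i \<in> Obj J" for i
      using Comp_assoc[OF ci[OF that] p(1) q(1)] Ide_Comp[OF ci[OF that]] p(2) q(2) that by simp
  qed
  moreover have "p \<cdot> q = Ide C y"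
  proof (rule colimit_eqI[OF F d])
    show "p \<cdot> q \<in> Hom C y y" "Ide C y \<in> Hom C y y"
      using p q by (auto intro: Comp_in_Hom Ide_in_Hom Hom_Obj)
    show "p \<cdot> q \<cdot> d i = Ide C y \<cdot> d i" if "i \<in> Obj J" for i
      using Comp_assoc[OF di[OF that] q(1) p(1)] Ide_Comp[OF di[OF that]] p(2) q(2) that by simp
  qed
  ultimately show thesis using that p q by blast
qed


section \<open>Renaming the objects and arrows of a category\<close>

text \<open>The shapes that arise below have sums, squares or triples of squares as objects and arrows,
  whereas the shapes of filtered colimits live on \<open>'u\<close>. Only smallness matters, so a small
  category can be moved to \<open>'u\<close> along injections of its objects and of its arrows.\<close>

definition rename_category ::
  "('i \<Rightarrow> 'a) \<Rightarrow> ('j \<Rightarrow> 'b) \<Rightarrow> ('i, 'j) category \<Rightarrow> ('a, 'b) category" where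
  "rename_category p q J =
     (let p' = inv_into (Obj J) p; q' = inv_into (Arr J) q in
      \<lparr>Obj = p ` Obj J, Arr = q ` Arr J, Dom = p \<circ> Dom J \<circ> q', Cod = p \<circ> Cod J \<circ> q',
       Ide = q \<circ> Ide J \<circ> p', Comp = (\<lambda>b a. q (q' b \<cdot>\<^bsub>J\<^esub> q' a))\<rparr>)"

definition renaming_back ::
  "('i \<Rightarrow> 'a) \<Rightarrow> ('j \<Rightarrow> 'b) \<Rightarrow> ('i, 'j) category \<Rightarrow> ('a, 'b, 'i, 'j) fctr" where
  "renaming_back p q J = \<lparr>OMap = inv_into (Obj J) p, AMap = inv_into (Arr J) q\<rparr>"

locale category_renaming = J: category J for J :: "('i, 'j) category" +
  fixes p :: "'i \<Rightarrow> 'a" and q :: "'j \<Rightarrow> 'b"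
  assumes inj_p: "inj_on p (Obj J)" and inj_q: "inj_on q (Arr J)"
begin

abbreviation "J' \<equiv> rename_category p q J"

lemma Obj_rename: "Obj J' = p ` Obj J"
  and Arr_rename: "Arr J' = q ` Arr J"
  by (auto simp: rename_category_def Let_def)

lemma rename_simps:
  "a \<in> Arr J \<Longrightarrow> Dom J' (q a) = p (Dom J a)"
  "a \<in> Arr J \<Longrightarrow> Cod J' (q a) = p (Cod J a)"
  "i \<in> Obj J \<Longrightarrow> Ide J' (p i) = q (Ide J i)"
  "a \<in> Arr J \<Longrightarrow> b \<in> Arr J \<Longrightarrow> q b \<cdot>\<^bsub>J'\<^esub> q a = q (b \<cdot>\<^bsub>J\<^esub> a)"
  by (auto simp: rename_category_def Let_def inv_into_f_f[OF inj_p] inv_into_f_f[OF inj_q])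

lemma Hom_rename:
  assumes "i \<in> Obj J" "j \<in> Obj J"
  shows "Hom J' (p i) (p j) = q ` Hom J i j"
  using assms J.Dom_in_Obj J.Cod_in_Obj
  by (auto simp: Hom_def Arr_rename rename_simps inj_on_eq_iff[OF inj_p])

lemma Hom_renameE:
  assumes "b \<in> Hom J' x y"
  obtains a i j where "a \<in> Hom J i j" "i \<in> Obj J" "j \<in> Obj J" "b = q a" "x = p i" "y = p j"
  using assms J.Dom_in_Obj J.Cod_in_Obj
  by (auto simp: Hom_def Arr_rename rename_simps)

lemma in_Hom_rename: "a \<in> Hom J i j \<Longrightarrow> q a \<in> Hom J' (p i) (p j)"
  by (auto simp: Hom_def Arr_rename rename_simps)

lemma category_rename: "category J'"
proof
  show "f \<in> Arr J' \<Longrightarrow> Dom J' f \<in> Obj J'" "f \<in> Arr J' \<Longrightarrow> Cod J' f \<in> Obj J'" for f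
    using J.Dom_in_Obj J.Cod_in_Obj by (auto simp: Obj_rename Arr_rename rename_simps)
  show "x \<in> Obj J' \<Longrightarrow> Ide J' x \<in> Hom J' x x" for x
    by (auto simp: Obj_rename rename_simps intro!: in_Hom_rename J.Ide_in_Hom)
  show "f \<in> Hom J' x y \<Longrightarrow> g \<in> Hom J' y z \<Longrightarrow> g \<cdot>\<^bsub>J'\<^esub> f \<in> Hom J' x z" for f g x y z
    using J.Comp_in_Hom
    by (elim Hom_renameE)
       (auto simp: inj_on_eq_iff[OF inj_p] Hom_rename rename_simps in_Hom_iff)
  show "f \<in> Hom J' x y \<Longrightarrow> f \<cdot>\<^bsub>J'\<^esub> Ide J' x = f" for f x y
    using J.Ide_in_Hom J.Comp_Ide
    by (elim Hom_renameE) (simp add: rename_simps in_Hom_iff)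
  show "f \<in> Hom J' x y \<Longrightarrow> Ide J' y \<cdot>\<^bsub>J'\<^esub> f = f" for f x y
    using J.Ide_in_Hom J.Ide_Comp
    by (elim Hom_renameE) (simp add: rename_simps in_Hom_iff)
  show "f \<in> Hom J' w x \<Longrightarrow> g \<in> Hom J' x y \<Longrightarrow> h \<in> Hom J' y z \<Longrightarrow>
      h \<cdot>\<^bsub>J'\<^esub> g \<cdot>\<^bsub>J'\<^esub> f = h \<cdot>\<^bsub>J'\<^esub> (g \<cdot>\<^bsub>J'\<^esub> f)" for f g h w x y z
    using J.Comp_in_Hom J.Comp_assoc
    by (elim Hom_renameE)
       (auto simp: rename_simps in_Hom_iff inj_on_eq_iff[OF inj_p])
qed

lemma functor_renaming_back: "is_functor J' J (renaming_back p q J)"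
  by (rule is_functorI[OF category_rename J.category_axioms])
     (auto simp: renaming_back_def Obj_rename inv_into_f_f[OF inj_p] inv_into_f_f[OF inj_q]
        in_Hom_iff rename_simps inj_on_eq_iff[OF inj_p] J.Comp_in_Hom Arr_rename
        J.Dom_in_Obj J.Cod_in_Obj J.Ide_in_Hom[unfolded in_Hom_iff]
        J.Comp_in_Hom[unfolded in_Hom_iff])

lemma cocone_along_renaming:
  assumes "is_cocone J' C (fctr_comp F (renaming_back p q J)) x c"
  shows "is_cocone J C F x (c \<circ> p)"
proof (rule is_coconeI)
  show "x \<in> Obj C" using is_coconeD(1)[OF assms] .
  show "(c \<circ> p) i \<in> Hom C (OMap F i) x" if "i \<in> Obj J" for i
    using is_coconeD(2)[OF assms, of "p i"] that
    by (simp add: fctr_comp_def renaming_back_def Obj_rename inv_into_f_f[OF inj_p])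
  show "(c \<circ> p) j \<cdot>\<^bsub>C\<^esub> AMap F a = (c \<circ> p) i" if "a \<in> Hom J i j" for a i j
    using is_coconeD(3)[OF assms in_Hom_rename[OF that]] that
    by (simp add: fctr_comp_def renaming_back_def inv_into_f_f[OF inj_q] in_Hom_iff)
qed

lemma cocone_against_renaming:
  assumes "is_cocone J C F x c"
  shows "is_cocone J' C (fctr_comp F (renaming_back p q J)) x (c \<circ> inv_into (Obj J) p)"
proof (rule is_coconeI)
  show "x \<in> Obj C" using is_coconeD(1)[OF assms] .
  show "(c \<circ> inv_into (Obj J) p) i \<in> Hom C (OMap (fctr_comp F (renaming_back p q J)) i) x"
    if "i \<in> Obj J'" for i
    using is_coconeD(2)[OF assms] that
    by (auto simp: fctr_comp_def renaming_back_def Obj_rename inv_into_f_f[OF inj_p])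
  show "(c \<circ> inv_into (Obj J) p) j \<cdot>\<^bsub>C\<^esub> AMap (fctr_comp F (renaming_back p q J)) b
      = (c \<circ> inv_into (Obj J) p) i" if "b \<in> Hom J' i j" for b i j
    using that
  proof (rule Hom_renameE)
    fix a k l assume "a \<in> Hom J k l" "k \<in> Obj J" "l \<in> Obj J" "b = q a" "i = p k" "j = p l"
    then show ?thesis using is_coconeD(3)[OF assms, of a k l]
      by (simp add: fctr_comp_def renaming_back_def inv_into_f_f[OF inj_q]
          inv_into_f_f[OF inj_p] in_Hom_iff)
  qed
qed

lemma colimit_against_renaming:
  assumes "is_colimit J C F x c"
  shows "is_colimit J' C (fctr_comp F (renaming_back p q J)) x (c \<circ> inv_into (Obj J) p)"
  unfolding is_colimit_def
proof (intro conjI allI impI)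
  show "is_cocone J' C (fctr_comp F (renaming_back p q J)) x (c \<circ> inv_into (Obj J) p)"
    using cocone_against_renaming[OF is_colimitD(1)[OF assms]] .
  fix y d assume "is_cocone J' C (fctr_comp F (renaming_back p q J)) y d"
  from cocone_along_renaming[OF this]
  have "\<exists>!h. h \<in> Hom C x y \<and> (\<forall>i\<in>Obj J. h \<cdot>\<^bsub>C\<^esub> c i = d (p i))"
    using is_colimitD(3)[OF assms, of y "d \<circ> p"] by (simp only: o_apply)
  then show "\<exists>!h. h \<in> Hom C x y \<and>
      (\<forall>i\<in>Obj J'. h \<cdot>\<^bsub>C\<^esub> (c \<circ> inv_into (Obj J) p) i = d i)"
    by (simp add: Obj_rename inv_into_f_f[OF inj_p])
qed

end

lemma obtain_small_renaming:
  fixes J :: "('i, 'j) category"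
  assumes "category J" "|Obj J| \<le>o |UNIV :: 'u set|" "|Arr J| \<le>o |UNIV :: 'u set|"
  obtains p :: "'i \<Rightarrow> 'u" and q :: "'j \<Rightarrow> 'u" where "category_renaming J p q"
proof -
  obtain p :: "'i \<Rightarrow> 'u" where "inj_on p (Obj J)"
    using assms(2) card_of_ordLeq[of "Obj J" "UNIV :: 'u set"] by blast
  moreover obtain q :: "'j \<Rightarrow> 'u" where "inj_on q (Arr J)"
    using assms(3) card_of_ordLeq[of "Arr J" "UNIV :: 'u set"] by blast
  ultimately show thesis
    using that assms(1) by (simp add: category_renaming_def category_renaming_axioms_def)
qed


section \<open>Cocones in filtered categories\<close>

text \<open>The barycentric subdivision of a directed graph: each edge becomes an object with one leg to its
  source and one to its target. No two arrows other than identities are composable, so functors on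
  this category are given by arbitrary graphs of arrows, with no composition law to respect, and a
  cocone on it is a cocone on the graph.\<close>

definition barycentric_category ::
  "'v set \<Rightarrow> 'e set \<Rightarrow> ('e \<Rightarrow> 'v) \<Rightarrow> ('e \<Rightarrow> 'v) \<Rightarrow> ('v + 'e, ('v + 'e) + ('e + 'e)) category" where
  "barycentric_category V E src tgt =
     \<lparr>Obj = V <+> E, Arr = (V <+> E) <+> (E <+> E),
      Dom = (\<lambda>a. case a of Inl x \<Rightarrow> x | Inr (Inl e) \<Rightarrow> Inr e | Inr (Inr e) \<Rightarrow> Inr e),
      Cod = (\<lambda>a. case a of Inl x \<Rightarrow> x | Inr (Inl e) \<Rightarrow> Inl (src e) | Inr (Inr e) \<Rightarrow> Inl (tgt e)),
      Ide = Inl,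
      Comp = (\<lambda>b a. case b of Inl x \<Rightarrow> a | Inr y \<Rightarrow> b)\<rparr>"

lemma category_barycentric:
  assumes "\<And>e. e \<in> E \<Longrightarrow> src e \<in> V" "\<And>e. e \<in> E \<Longrightarrow> tgt e \<in> V"
  shows "category (barycentric_category V E src tgt)"
  by standard (use assms in \<open>auto simp: barycentric_category_def Hom_def split: sum.splits\<close>)

locale filtered_category = J: category J
  for \<kappa> :: "'u rel" and J :: "('i, 'j) category" +
  assumes cardinal: "small_regular_cardinal \<kappa>"
    and diagram_cocone: "\<And>(S :: ('u, 'u) category) D. is_functor S J D \<Longrightarrow> |Arr S| <o \<kappa> \<Longrightarrow>
      \<exists>x c. is_cocone S J D x c"
begin

text \<open>Filteredness speaks of functors, but the diagrams met below are graphs of arrows. The subdivision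
  of a graph with fewer than \<open>\<kappa>\<close> vertices and edges has fewer than \<open>\<kappa>\<close> arrows, because \<open>\<kappa>\<close> is an
  infinite cardinal, so it has a cocone.\<close>

lemma graph_cocone:
  fixes V :: "'v set" and E :: "'e set"
  assumes V: "|V| <o \<kappa>" and E: "|E| <o \<kappa>"
    and src: "\<And>e. e \<in> E \<Longrightarrow> src e \<in> V" and tgt: "\<And>e. e \<in> E \<Longrightarrow> tgt e \<in> V"
    and ob: "\<And>v. v \<in> V \<Longrightarrow> ob v \<in> Obj J"
    and ar: "\<And>e. e \<in> E \<Longrightarrow> ar e \<in> Hom J (ob (src e)) (ob (tgt e))"
  obtains x m where "x \<in> Obj J" "\<And>v. v \<in> V \<Longrightarrow> m v \<in> Hom J (ob v) x"
    "\<And>e. e \<in> E \<Longrightarrow> m (tgt e) \<cdot>\<^bsub>J\<^esub> ar e = m (src e)"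
proof -
  let ?S = "barycentric_category V E src tgt"
  note cinf = small_regular_cardinalD(1)[OF cardinal]
  have small_Obj: "|Obj ?S| <o \<kappa>" and small_Arr: "|Arr ?S| <o \<kappa>"
    using V E by (auto simp: barycentric_category_def intro!: card_less_Plus[OF cinf])
  have S: "category ?S" using src tgt by (rule category_barycentric)
  note \<kappa>_less = ordLess_imp_ordLeq[OF small_regular_cardinalD(3)[OF cardinal]]
  obtain p :: "_ \<Rightarrow> 'u" and q :: "_ \<Rightarrow> 'u" where "category_renaming ?S p q"
    using obtain_small_renaming[OF S]
      ordLeq_transitive[OF ordLess_imp_ordLeq[OF small_Obj] \<kappa>_less]
      ordLeq_transitive[OF ordLess_imp_ordLeq[OF small_Arr] \<kappa>_less] by blast
  then interpret R: category_renaming ?S p q .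
  define D where "D = \<lparr>OMap = (\<lambda>x. case x of Inl v \<Rightarrow> ob v | Inr e \<Rightarrow> ob (src e)),
    AMap = (\<lambda>a. case a of Inl (Inl v) \<Rightarrow> Ide J (ob v) | Inl (Inr e) \<Rightarrow> Ide J (ob (src e))
              | Inr (Inl e) \<Rightarrow> Ide J (ob (src e)) | Inr (Inr e) \<Rightarrow> ar e)\<rparr>"
  have D: "is_functor ?S J D"
  proof (rule is_functorI[OF S J.category_axioms])
    fix i assume i: "i \<in> Obj ?S"
    show "OMap D i \<in> Obj J" "AMap D (Ide ?S i) = Ide J (OMap D i)"
      using i ob src by (auto simp: D_def barycentric_category_def)
  next
    show D_Hom: "AMap D a \<in> Hom J (OMap D i) (OMap D j)" if "a \<in> Hom ?S i j" for a i j
      using that ob src ar J.Ide_in_Hom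
      by (auto simp: D_def barycentric_category_def Hom_def split: sum.splits)
    fix a i j assume a: "a \<in> Hom ?S i j"
    fix b k assume b: "b \<in> Hom ?S j k"
    note Fa = D_Hom[OF a] and Fb = D_Hom[OF b]
    \<comment> \<open>One of two composable arrows is an identity.\<close>
    have "(\<exists>y. b = Inl y \<and> y = j) \<or> (\<exists>y. a = Inl y \<and> y = i \<and> i = j \<and> (\<exists>z. b = Inr z))"
      using a b by (auto simp: barycentric_category_def Hom_def split: sum.splits)
    then show "AMap D (b \<cdot>\<^bsub>?S\<^esub> a) = AMap D b \<cdot>\<^bsub>J\<^esub> AMap D a"
    proof (elim disjE exE conjE)
      fix y assume y: "b = Inl y" "y = j"
      then have "AMap D b = Ide J (OMap D j)" by (cases j) (auto simp: D_def)
      then show ?thesis using J.Ide_Comp[OF Fa] y by (simp add: barycentric_category_def)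
    next
      fix y z assume y: "a = Inl y" "y = i" "i = j" "b = Inr z"
      then have "AMap D a = Ide J (OMap D j)" by (cases j) (auto simp: D_def)
      then show ?thesis using J.Comp_Ide[OF Fb] y by (simp add: barycentric_category_def)
    qed
  qed
  have "is_functor R.J' J (fctr_comp D (renaming_back p q ?S))"
    using R.functor_renaming_back D by (rule is_functor_comp)
  moreover have "|Arr R.J'| <o \<kappa>"
    using small_Arr by (simp add: R.Arr_rename card_less_image)
  ultimately obtain x c where "is_cocone R.J' J (fctr_comp D (renaming_back p q ?S)) x c"
    using diagram_cocone by blast
  then have c: "is_cocone ?S J D x (c \<circ> p)" by (rule R.cocone_along_renaming)
  define m where "m v = (c \<circ> p) (Inl v)" for v
  show thesis
  proof
    show "x \<in> Obj J" using c by (rule is_coconeD)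
    show "m v \<in> Hom J (ob v) x" if "v \<in> V" for v
      using is_coconeD(2)[OF c, of "Inl v"] that
      by (auto simp: m_def barycentric_category_def D_def)
    fix e assume e: "e \<in> E"
    \<comment> \<open>Both legs of \<open>e\<close> compute the component of the cocone at \<open>e\<close>.\<close>
    have "Inr (Inl e) \<in> Hom ?S (Inr e) (Inl (src e))" "Inr (Inr e) \<in> Hom ?S (Inr e) (Inl (tgt e))"
      using e by (auto simp: barycentric_category_def Hom_def)
    from this[THEN is_coconeD(3)[OF c]]
    have "(c \<circ> p) (Inl (src e)) \<cdot>\<^bsub>J\<^esub> AMap D (Inr (Inl e)) = (c \<circ> p) (Inr e)"
         "(c \<circ> p) (Inl (tgt e)) \<cdot>\<^bsub>J\<^esub> AMap D (Inr (Inr e)) = (c \<circ> p) (Inr e)" .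
    moreover have "m (src e) \<in> Hom J (ob (src e)) x"
      using is_coconeD(2)[OF c, of "Inl (src e)"] src[OF e]
      by (auto simp: m_def barycentric_category_def D_def)
    ultimately show "m (tgt e) \<cdot>\<^bsub>J\<^esub> ar e = m (src e)"
      using J.Comp_Ide by (simp add: m_def D_def)
  qed
qed

lemma upper_bound:
  assumes "|I| <o \<kappa>" "\<And>v. v \<in> I \<Longrightarrow> ob v \<in> Obj J"
  obtains x m where "x \<in> Obj J" "\<And>v. v \<in> I \<Longrightarrow> m v \<in> Hom J (ob v) x"
proof -
  have "|{} :: unit set| <o \<kappa>"
    by (rule card_less_finite[OF small_regular_cardinalD(1)[OF cardinal]]) simp
  from graph_cocone[OF assms(1) this, of "\<lambda>_. undefined"
      "\<lambda>_. undefined" ob] that assms(2)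
  show thesis by auto
qed

lemma upper_bound2:
  assumes "i \<in> Obj J" "j \<in> Obj J"
  obtains x a b where "x \<in> Obj J" "a \<in> Hom J i x" "b \<in> Hom J j x"
proof -
  have card: "|UNIV :: bool set| <o \<kappa>"
    by (rule card_less_finite[OF small_regular_cardinalD(1)[OF cardinal]]) simp
  show thesis
  proof (rule upper_bound[OF card, where ob = "\<lambda>v. if v then i else j"])
    fix x m assume "x \<in> Obj J"
      and "\<And>v. v \<in> (UNIV :: bool set) \<Longrightarrow> m v \<in> Hom J (if v then i else j) x"
    from this(1) this(2)[of True] this(2)[of False] show thesis by (simp add: that)
  qed (use assms in simp)
qed

lemma nonempty: obtains i where "i \<in> Obj J"
  using upper_bound[of "{} :: unit set"]
    card_less_finite[of \<kappa> "{} :: unit set"] small_regular_cardinalD(1)[OF cardinal] by auto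

lemma wide_span_cocone:
  assumes "|I| <o \<kappa>" "i \<in> Obj J" "\<And>e. e \<in> I \<Longrightarrow> ar e \<in> Hom J i (ob e)"
  obtains x a m where "x \<in> Obj J" "a \<in> Hom J i x" "\<And>e. e \<in> I \<Longrightarrow> m e \<in> Hom J (ob e) x"
    "\<And>e. e \<in> I \<Longrightarrow> m e \<cdot>\<^bsub>J\<^esub> ar e = a"
proof -
  let ?V = "{None} \<union> Some ` I" and ?ob = "\<lambda>v. case v of None \<Rightarrow> i | Some e \<Rightarrow> ob e"
  have cinf: "Cinfinite \<kappa>" using cardinal by (rule small_regular_cardinalD)
  have "?V = case_sum (\<lambda>_. None) Some ` ({()} <+> I)"
    by (simp add: Plus_def image_Un image_image)
  then have "|?V| \<le>o |{()} <+> I|" by (simp only: card_of_image)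
  moreover have "|{()} <+> I| <o \<kappa>"
    by (intro card_less_Plus[OF cinf] card_less_finite[OF cinf] assms(1)) simp
  ultimately have V: "|?V| <o \<kappa>" by (rule ordLeq_ordLess_trans)
  show thesis
  proof (rule graph_cocone[OF V assms(1), where
        src = "\<lambda>_. None" and tgt = Some and ob = ?ob and ar = ar])
    show "?ob v \<in> Obj J" if "v \<in> ?V" for v
      using that assms(2) J.Hom_Obj(2)[OF assms(3)] by auto
    show "ar e \<in> Hom J (?ob None) (?ob (Some e))" if "e \<in> I" for e
      using that assms(3) by simp
    fix x m assume x: "x \<in> Obj J" "\<And>v. v \<in> ?V \<Longrightarrow> m v \<in> Hom J (?ob v) x"
      "\<And>e. e \<in> I \<Longrightarrow> m (Some e) \<cdot>\<^bsub>J\<^esub> ar e = m None"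
    show thesis
    proof (rule that[OF x(1)])
      show "m None \<in> Hom J i x" using x(2)[of None] by simp
      show "m (Some e) \<in> Hom J (ob e) x" if "e \<in> I" for e using x(2)[of "Some e"] that by simp
      show "m (Some e) \<cdot>\<^bsub>J\<^esub> ar e = m None" if "e \<in> I" for e using x(3)[OF that] .
    qed
  qed simp_all
qed

lemma parallel_coequalized:
  assumes "a \<in> Hom J i j" "b \<in> Hom J i j"
  obtains x m where "m \<in> Hom J j x" "m \<cdot>\<^bsub>J\<^esub> a = m \<cdot>\<^bsub>J\<^esub> b"
proof -
  have card: "|UNIV :: bool set| <o \<kappa>"
    by (rule card_less_finite[OF small_regular_cardinalD(1)[OF cardinal]]) simp
  show thesis
  proof (rule graph_cocone[OF card card, where src = "\<lambda>_. True"
        and tgt = "\<lambda>_. False" and ob = "\<lambda>v. if v then i else j" and ar = "\<lambda>e. if e then a else b"])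
    fix x m assume "\<And>v. v \<in> (UNIV :: bool set) \<Longrightarrow> m v \<in> Hom J (if v then i else j) x"
      and "\<And>e. e \<in> (UNIV :: bool set) \<Longrightarrow> m False \<cdot>\<^bsub>J\<^esub> (if e then a else b) = m True"
    from this(1)[of False] this(2)[of True] this(2)[of False] show thesis by (simp add: that)
  qed (use assms J.Hom_Obj[OF assms(1)] in auto)
qed

lemma span_cocone:
  assumes "a \<in> Hom J i j" "b \<in> Hom J i k"
  obtains x m n where "m \<in> Hom J j x" "n \<in> Hom J k x" "m \<cdot>\<^bsub>J\<^esub> a = n \<cdot>\<^bsub>J\<^esub> b"
proof -
  have card: "|UNIV :: bool set| <o \<kappa>"
    by (rule card_less_finite[OF small_regular_cardinalD(1)[OF cardinal]]) simp
  show thesis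
  proof (rule wide_span_cocone[OF card, where i = i and ob = "\<lambda>e. if e then j else k"
          and ar = "\<lambda>e. if e then a else b"])
    fix x c m assume "\<And>e. e \<in> (UNIV :: bool set) \<Longrightarrow> m e \<in> Hom J (if e then j else k) x"
      and "\<And>e. e \<in> (UNIV :: bool set) \<Longrightarrow> m e \<cdot>\<^bsub>J\<^esub> (if e then a else b) = c"
    from this(1)[of True] this(1)[of False] this(2)[of True] this(2)[of False]
    show thesis by (intro that[of "m True" x "m False"]) simp_all
  qed (use assms J.Hom_Obj[OF assms(1)] in auto)
qed

end

lemma filtered_categoryI:
  assumes "small_regular_cardinal \<kappa>" "filtered \<kappa> J"
  shows "filtered_category \<kappa> J"
  using assms unfolding filtered_def small_category_def filtered_category_def
    filtered_category_axioms_def by blast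


section \<open>Presentable objects by elements\<close>

text \<open>The canonical map from the colimit of the sets \<open>hom(k, F i)\<close> to \<open>hom(k, x)\<close> is surjective, by the
  first conjunct, and injective, by the second. For a filtered shape, elements that become equal
  in the colimit are already identified by an arrow of the shape, which is why the second conjunct
  compares arrows at a single stage.\<close>

definition hom_detects ::
  "('i, 'j) category \<Rightarrow> ('o, 'm) category \<Rightarrow> ('i, 'j, 'o, 'm) fctr \<Rightarrow> 'o \<Rightarrow> ('i \<Rightarrow> 'm) \<Rightarrow> 'o \<Rightarrow> bool" where
  "hom_detects J C F x c k \<longleftrightarrow>
     (\<forall>f \<in> Hom C k x. \<exists>i \<in> Obj J. \<exists>f' \<in> Hom C k (OMap F i). c i \<cdot>\<^bsub>C\<^esub> f' = f) \<and>
     (\<forall>i \<in> Obj J. \<forall>f \<in> Hom C k (OMap F i). \<forall>f' \<in> Hom C k (OMap F i).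
        c i \<cdot>\<^bsub>C\<^esub> f = c i \<cdot>\<^bsub>C\<^esub> f' \<longrightarrow>
        (\<exists>j. \<exists>a \<in> Hom J i j. AMap F a \<cdot>\<^bsub>C\<^esub> f = AMap F a \<cdot>\<^bsub>C\<^esub> f'))"

lemma hom_detectsD:
  assumes "hom_detects J C F x c k"
  shows "f \<in> Hom C k x \<Longrightarrow> \<exists>i \<in> Obj J. \<exists>f' \<in> Hom C k (OMap F i). c i \<cdot>\<^bsub>C\<^esub> f' = f"
    and "i \<in> Obj J \<Longrightarrow> f \<in> Hom C k (OMap F i) \<Longrightarrow> f' \<in> Hom C k (OMap F i) \<Longrightarrow>
        c i \<cdot>\<^bsub>C\<^esub> f = c i \<cdot>\<^bsub>C\<^esub> f' \<Longrightarrow>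
        \<exists>j. \<exists>a \<in> Hom J i j. AMap F a \<cdot>\<^bsub>C\<^esub> f = AMap F a \<cdot>\<^bsub>C\<^esub> f'"
  using assms unfolding hom_detects_def by auto

lemma hom_detectsI:
  assumes "\<And>f. f \<in> Hom C k x \<Longrightarrow> \<exists>i \<in> Obj J. \<exists>f' \<in> Hom C k (OMap F i). c i \<cdot>\<^bsub>C\<^esub> f' = f"
    and "\<And>i f f'. i \<in> Obj J \<Longrightarrow> f \<in> Hom C k (OMap F i) \<Longrightarrow> f' \<in> Hom C k (OMap F i) \<Longrightarrow>
        c i \<cdot>\<^bsub>C\<^esub> f = c i \<cdot>\<^bsub>C\<^esub> f' \<Longrightarrow>
        \<exists>j. \<exists>a \<in> Hom J i j. AMap F a \<cdot>\<^bsub>C\<^esub> f = AMap F a \<cdot>\<^bsub>C\<^esub> f'"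
  shows "hom_detects J C F x c k"
  using assms unfolding hom_detects_def by auto

lemma Hom_set_category:
  "f \<in> Hom (set_category U) A B \<longleftrightarrow>
     small U A \<and> small U B \<and> (\<exists>h \<in> A \<rightarrow>\<^sub>E B. f = Set_Map A h B)"
  by (cases f) (auto simp: Hom_def set_category_def)

lemma Comp_set_category:
  "Set_Map B h D \<cdot>\<^bsub>set_category U\<^esub> Set_Map A g B' = Set_Map A (compose A h g) D"
  by (simp add: set_category_def)

lemma Obj_set_category: "Obj (set_category U) = {A. small U A}"
  by (simp add: set_category_def)

lemma hom_functor_simps:
  "OMap (hom_functor C k) x = Hom C k x"
  "g \<in> Hom C x y \<Longrightarrow>
     AMap (hom_functor C k) g = Set_Map (Hom C k x) (\<lambda>f\<in>Hom C k x. g \<cdot>\<^bsub>C\<^esub> f) (Hom C k y)"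
  by (auto simp: hom_functor_def Hom_def)

locale cocone_of_functor =
  fixes J :: "('i, 'j) category" and C :: "('o, 'm) category" (structure) and F x c
  assumes F: "is_functor J C F" and c: "is_cocone J C F x c"
begin

sublocale C: category C using F by (rule is_functorD)
sublocale J: category J using F by (rule is_functorD)

lemmas F_Obj = is_functorD(3)[OF F] and F_Hom = is_functorD(4)[OF F]
  and F_Ide = is_functorD(5)[OF F] and F_Comp = is_functorD(6)[OF F]
  and c_Hom = is_coconeD(2)[OF c] and c_nat = is_coconeD(3)[OF c]

lemma vertex: "x \<in> Obj C" using c by (rule is_coconeD)

lemma push:
  assumes "a \<in> Hom J i j" "f \<in> Hom C k (OMap F i)"
  shows "AMap F a \<cdot> f \<in> Hom C k (OMap F j)" "c j \<cdot> (AMap F a \<cdot> f) = c i \<cdot> f"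
proof -
  show "AMap F a \<cdot> f \<in> Hom C k (OMap F j)"
    using C.Comp_in_Hom[OF assms(2) F_Hom[OF assms(1)]] .
  have "j \<in> Obj J" using assms(1) by (rule J.Hom_Obj)
  then show "c j \<cdot> (AMap F a \<cdot> f) = c i \<cdot> f"
    using C.Comp_assoc[OF assms(2) F_Hom[OF assms(1)] c_Hom] c_nat[OF assms(1)] by simp
qed

lemma push_push:
  assumes "a \<in> Hom J i j" "b \<in> Hom J j l" "f \<in> Hom C k (OMap F i)"
  shows "AMap F b \<cdot> (AMap F a \<cdot> f) = AMap F (b \<cdot>\<^bsub>J\<^esub> a) \<cdot> f"
  using C.Comp_assoc[OF assms(3) F_Hom[OF assms(1)] F_Hom[OF assms(2)]] F_Comp[OF assms(1,2)]
  by simp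

end

locale filtered_cocone = filtered_category \<kappa> J + cocone_of_functor J C F x c
  for \<kappa> :: "'u rel" and J :: "('i, 'j) category" and C :: "('o, 'm) category" (structure) and F x c
begin

lemma set_cocone_apply:
  assumes d: "is_cocone J (set_category TYPE('u)) (fctr_comp (hom_functor C k) F) Y d"
    and i: "i \<in> Obj J"
  shows "d i = Set_Map (Hom C k (OMap F i)) (sm_fun (d i)) Y"
    and "f \<in> Hom C k (OMap F i) \<Longrightarrow> sm_fun (d i) f \<in> Y"
    and "sm_fun (d i) \<in> Hom C k (OMap F i) \<rightarrow>\<^sub>E Y"
  using is_coconeD(2)[OF d i] by (auto simp: fctr_comp_def hom_functor_simps Hom_set_category)

lemma set_cocone_natural:
  assumes d: "is_cocone J (set_category TYPE('u)) (fctr_comp (hom_functor C k) F) Y d"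
    and a: "a \<in> Hom J i j" and f: "f \<in> Hom C k (OMap F i)"
  shows "sm_fun (d j) (AMap F a \<cdot> f) = sm_fun (d i) f"
proof -
  have ij: "i \<in> Obj J" "j \<in> Obj J" using a J.Hom_Obj by auto
  have "Set_Map (Hom C k (OMap F j)) (sm_fun (d j)) Y
      \<cdot>\<^bsub>set_category TYPE('u)\<^esub> AMap (fctr_comp (hom_functor C k) F) a = d i"
    using is_coconeD(3)[OF d a] by (simp only: set_cocone_apply(1)[OF d ij(2), symmetric])
  then have "Set_Map (Hom C k (OMap F i)) (compose (Hom C k (OMap F i)) (sm_fun (d j))
      (\<lambda>f\<in>Hom C k (OMap F i). AMap F a \<cdot> f)) Y = d i"
    by (simp add: Comp_set_category fctr_comp_def hom_functor_simps(2)[OF F_Hom[OF a]])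
  from arg_cong[OF this, of sm_fun] f show ?thesis
    by (auto simp: compose_def fun_eq_iff split: if_splits)
qed

lemma set_coconeI:
  assumes hs: "has_small_homs TYPE('u) C" and k: "k \<in> Obj C" and Y: "small TYPE('u) Y"
    and e: "\<And>i f. i \<in> Obj J \<Longrightarrow> f \<in> Hom C k (OMap F i) \<Longrightarrow> e i f \<in> Y"
    and nat: "\<And>a i j f. a \<in> Hom J i j \<Longrightarrow> f \<in> Hom C k (OMap F i) \<Longrightarrow> e j (AMap F a \<cdot> f) = e i f"
  shows "is_cocone J (set_category TYPE('u)) (fctr_comp (hom_functor C k) F) Y
    (\<lambda>i. Set_Map (Hom C k (OMap F i)) (\<lambda>f\<in>Hom C k (OMap F i). e i f) Y)"
proof (rule is_coconeI)
  show "Y \<in> Obj (set_category TYPE('u))" using Y by (simp add: Obj_set_category)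
  show "Set_Map (Hom C k (OMap F i)) (\<lambda>f\<in>Hom C k (OMap F i). e i f) Y
      \<in> Hom (set_category TYPE('u)) (OMap (fctr_comp (hom_functor C k) F) i) Y"
    if "i \<in> Obj J" for i
    using Y e[OF that] hs k F_Obj[OF that]
    by (auto simp: Hom_set_category fctr_comp_def hom_functor_simps has_small_homs_def)
  show "Set_Map (Hom C k (OMap F j)) (\<lambda>f\<in>Hom C k (OMap F j). e j f) Y
      \<cdot>\<^bsub>set_category TYPE('u)\<^esub> AMap (fctr_comp (hom_functor C k) F) a =
      Set_Map (Hom C k (OMap F i)) (\<lambda>f\<in>Hom C k (OMap F i). e i f) Y"
    if "a \<in> Hom J i j" for a i j
    using push(1)[OF that] nat[OF that]
    by (simp add: fctr_comp_def hom_functor_simps(2)[OF F_Hom[OF that]] Comp_set_category)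
       (auto simp: compose_def fun_eq_iff)
qed

lemma hom_cocone:
  assumes hs: "has_small_homs TYPE('u) C" and k: "k \<in> Obj C"
  shows "is_cocone J (set_category TYPE('u)) (fctr_comp (hom_functor C k) F)
    (Hom C k x) (\<lambda>i. AMap (hom_functor C k) (c i))"
proof -
  have "is_cocone J (set_category TYPE('u)) (fctr_comp (hom_functor C k) F) (Hom C k x)
    (\<lambda>i. Set_Map (Hom C k (OMap F i)) (\<lambda>f\<in>Hom C k (OMap F i). c i \<cdot> f) (Hom C k x))"
  proof (rule set_coconeI[OF hs k])
    show "small TYPE('u) (Hom C k x)" using hs k vertex by (auto simp: has_small_homs_def)
  qed (auto simp: push(2) intro: C.Comp_in_Hom c_Hom)
  then show ?thesis
    by (auto simp: is_cocone_def hom_functor_simps(2)[OF c_Hom] J.Dom_in_Obj J.Cod_in_Obj)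
qed

text \<open>A colimit of sets detects elements because maps to a two-element set already do: the arrows that
  factor through the cocone, and the arrows that are eventually identified with a given one, both
  define such maps. Conversely, a map out of \<open>hom(k, x)\<close> can be defined on representatives; two
  representatives move to a common stage, and from there to a stage where they coincide.\<close>

lemma hom_colimit_iff_detects:
  fixes t t' :: 'm
  assumes hs: "has_small_homs TYPE('u) C" and k: "k \<in> Obj C"
    and U: "set_universe TYPE('u)" and two: "t \<noteq> t'"
  shows "is_colimit J (set_category TYPE('u)) (fctr_comp (hom_functor C k) F)
    (Hom C k x) (\<lambda>i. AMap (hom_functor C k) (c i)) \<longleftrightarrow> hom_detects J C F x c k" (is "?colim \<longleftrightarrow> _")
proof
  let ?Set = "set_category TYPE('u) :: ('m set, 'm set_map) category"
  let ?H = "fctr_comp (hom_functor C k) F"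
  assume ?colim
  have unique: "h f = h' f" if Y: "small TYPE('u) Y"
    and h: "h \<in> Hom C k x \<rightarrow> Y" "h' \<in> Hom C k x \<rightarrow> Y" and f: "f \<in> Hom C k x"
    and eq: "\<And>i g. i \<in> Obj J \<Longrightarrow> g \<in> Hom C k (OMap F i) \<Longrightarrow> h (c i \<cdot> g) = h' (c i \<cdot> g)"
    for h h' :: "'m \<Rightarrow> 'm" and Y f
  proof -
    have d: "is_cocone J ?Set ?H Y
       (\<lambda>i. Set_Map (Hom C k (OMap F i)) (\<lambda>g\<in>Hom C k (OMap F i). h (c i \<cdot> g)) Y)"
    proof (rule set_coconeI[OF hs k Y])
      show "h (c i \<cdot> g) \<in> Y" if "i \<in> Obj J" "g \<in> Hom C k (OMap F i)" for i g
        using h(1) C.Comp_in_Hom[OF that(2) c_Hom[OF that(1)]] by auto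
    qed (simp add: push)
    have m: "Set_Map (Hom C k x) (restrict l (Hom C k x)) Y \<in> Hom ?Set (Hom C k x) Y"
      if "l \<in> Hom C k x \<rightarrow> Y" for l
      using Y hs k vertex that by (auto simp: Hom_set_category has_small_homs_def)
    have "Set_Map (Hom C k x) (restrict l (Hom C k x)) Y \<cdot>\<^bsub>?Set\<^esub> AMap (hom_functor C k) (c i)
      = Set_Map (Hom C k (OMap F i)) (\<lambda>g\<in>Hom C k (OMap F i). h (c i \<cdot> g)) Y"
      if "i \<in> Obj J" "\<And>g. g \<in> Hom C k (OMap F i) \<Longrightarrow> l (c i \<cdot> g) = h (c i \<cdot> g)" for l i
      using that(2) C.Comp_in_Hom[OF _ c_Hom[OF that(1)]]
      by (auto simp: hom_functor_simps(2)[OF c_Hom[OF that(1)]] Comp_set_category compose_def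
          fun_eq_iff)
    with is_colimitD(3)[OF \<open>?colim\<close> d] m[OF h(1)] m[OF h(2)] eq
    have "Set_Map (Hom C k x) (restrict h (Hom C k x)) Y =
      Set_Map (Hom C k x) (restrict h' (Hom C k x)) Y" by metis
    then show ?thesis using f by (auto simp: restrict_def fun_eq_iff split: if_splits)
  qed
  show "hom_detects J C F x c k"
  proof (rule hom_detectsI)
    fix f assume f: "f \<in> Hom C k x"
    \<comment> \<open>A constant map and the characteristic map of the arrows that factor through the cocone
      agree on the cocone.\<close>
    let ?h = "\<lambda>f. if \<exists>i \<in> Obj J. \<exists>f' \<in> Hom C k (OMap F i). c i \<cdot> f' = f then t else t'"
    have "?h f = t"
      by (rule unique[where Y = "{t, t'}" and h' = "\<lambda>_. t"])
         (use f in \<open>auto intro: small_finite[OF U]\<close>)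
    then show "\<exists>i \<in> Obj J. \<exists>f' \<in> Hom C k (OMap F i). c i \<cdot> f' = f"
      using two by (auto split: if_splits)
  next
    fix i f f' assume i: "i \<in> Obj J" and f: "f \<in> Hom C k (OMap F i)"
      and f': "f' \<in> Hom C k (OMap F i)" and eq: "c i \<cdot> f = c i \<cdot> f'"
    \<comment> \<open>Whether \<open>g\<close> is eventually identified with \<open>f\<close> is a cocone with values in a
      two-element set.\<close>
    define P where "P j g \<longleftrightarrow> (\<exists>l. \<exists>a \<in> Hom J i l. \<exists>b \<in> Hom J j l. AMap F a \<cdot> f = AMap F b \<cdot> g)"
      for j g
    have P: "P j' (AMap F e \<cdot> g) = P j g"
      if e: "e \<in> Hom J j j'" and g: "g \<in> Hom C k (OMap F j)" for e j j' g
    proof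
      assume "P j' (AMap F e \<cdot> g)"
      then obtain l a b where ab: "a \<in> Hom J i l" "b \<in> Hom J j' l"
        and fg: "AMap F a \<cdot> f = AMap F b \<cdot> (AMap F e \<cdot> g)"
        unfolding P_def by blast
      then show "P j g"
        unfolding P_def using ab(1) J.Comp_in_Hom[OF e ab(2)] push_push[OF e ab(2) g]
        by (intro exI[of _ l] bexI[of _ a] bexI[of _ "b \<cdot>\<^bsub>J\<^esub> e"]) simp_all
    next
      assume "P j g"
      then obtain l a b where ab: "a \<in> Hom J i l" "b \<in> Hom J j l"
        and fg: "AMap F a \<cdot> f = AMap F b \<cdot> g"
        unfolding P_def by blast
      obtain l' m n where mn: "m \<in> Hom J l l'" "n \<in> Hom J j' l'" "m \<cdot>\<^bsub>J\<^esub> b = n \<cdot>\<^bsub>J\<^esub> e"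
        using span_cocone[OF ab(2) e] by blast
      have "AMap F (m \<cdot>\<^bsub>J\<^esub> a) \<cdot> f = AMap F m \<cdot> (AMap F b \<cdot> g)"
        using push_push[OF ab(1) mn(1) f] fg by simp
      also have "\<dots> = AMap F n \<cdot> (AMap F e \<cdot> g)"
        using push_push[OF ab(2) mn(1) g] push_push[OF e mn(2) g] mn(3) by simp
      finally show "P j' (AMap F e \<cdot> g)"
        unfolding P_def using mn ab J.Comp_in_Hom by blast
    qed
    have d: "is_cocone J ?Set ?H {t, t'}
       (\<lambda>j. Set_Map (Hom C k (OMap F j)) (\<lambda>g\<in>Hom C k (OMap F j). if P j g then t else t') {t, t'})"
      (is "is_cocone _ _ _ _ ?d")
      by (rule set_coconeI[OF hs k]) (auto simp: P intro: small_finite[OF U])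
    obtain h where h: "h \<in> Hom ?Set (Hom C k x) {t, t'}"
      and hd: "h \<cdot>\<^bsub>?Set\<^esub> AMap (hom_functor C k) (c i) = ?d i"
      using is_colimitD(2)[OF \<open>?colim\<close> d] i by blast
    have "sm_fun h (c i \<cdot> g) = (if P i g then t else t')" if "g \<in> Hom C k (OMap F i)" for g
    proof -
      obtain h' where "h = Set_Map (Hom C k x) h' {t, t'}" using h by (auto simp: Hom_set_category)
      with hd that show ?thesis
        by (auto simp: hom_functor_simps(2)[OF c_Hom[OF i]] Comp_set_category compose_def fun_eq_iff
            split: if_splits)
    qed
    then have "P i f = P i f'" using eq two f f' by (metis (full_types))
    moreover have "P i f" unfolding P_def using J.Ide_in_Hom[OF i] by blast
    ultimately obtain l a b where ab: "a \<in> Hom J i l" "b \<in> Hom J i l"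
      and ff': "AMap F a \<cdot> f = AMap F b \<cdot> f'"
      unfolding P_def by blast
    obtain l' m where m: "m \<in> Hom J l l'" "m \<cdot>\<^bsub>J\<^esub> a = m \<cdot>\<^bsub>J\<^esub> b"
      using parallel_coequalized[OF ab] by blast
    have "AMap F (m \<cdot>\<^bsub>J\<^esub> a) \<cdot> f = AMap F (m \<cdot>\<^bsub>J\<^esub> a) \<cdot> f'"
      using push_push[OF ab(1) m(1) f] push_push[OF ab(2) m(1) f'] ff' m(2) by simp
    then show "\<exists>j. \<exists>a \<in> Hom J i j. AMap F a \<cdot> f = AMap F a \<cdot> f'"
      using J.Comp_in_Hom[OF ab(1) m(1)] by blast
  qed
next
  let ?Set = "set_category TYPE('u) :: ('m set, 'm set_map) category"
  let ?H = "fctr_comp (hom_functor C k) F"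
  assume det: "hom_detects J C F x c k"
  show ?colim
  proof (rule is_colimitI[OF hom_cocone[OF hs k]])
    fix Y d assume d: "is_cocone J ?Set ?H Y d"
    have wd: "sm_fun (d i) f = sm_fun (d j) g"
      if "i \<in> Obj J" "j \<in> Obj J" "f \<in> Hom C k (OMap F i)" "g \<in> Hom C k (OMap F j)"
        "c i \<cdot> f = c j \<cdot> g" for i j f g
    proof -
      note f = that(3) and g = that(4) and eq = that(5)
      have ij: "i \<in> Obj J" "j \<in> Obj J" using that by auto
      obtain l a b where a: "a \<in> Hom J i l" and b: "b \<in> Hom J j l"
        using upper_bound2[OF ij] by blast
      note fg = push(1)[OF a f] push(1)[OF b g]
      have "c l \<cdot> (AMap F a \<cdot> f) = c l \<cdot> (AMap F b \<cdot> g)"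
        using push(2)[OF a f] push(2)[OF b g] eq by simp
      then obtain l' m where m: "m \<in> Hom J l l'"
        and eq: "AMap F m \<cdot> (AMap F a \<cdot> f) = AMap F m \<cdot> (AMap F b \<cdot> g)"
        using hom_detectsD(2)[OF det J.Hom_Obj(2)[OF a] fg] by blast
      have "sm_fun (d i) f = sm_fun (d l') (AMap F m \<cdot> (AMap F a \<cdot> f))"
        using set_cocone_natural[OF d m fg(1)] set_cocone_natural[OF d a f] by simp
      also have "\<dots> = sm_fun (d j) g"
        using set_cocone_natural[OF d m fg(2)] set_cocone_natural[OF d b g] eq by simp
      finally show ?thesis .
    qed
    define h where "h f = (SOME y. \<exists>i \<in> Obj J. \<exists>f' \<in> Hom C k (OMap F i).
      c i \<cdot> f' = f \<and> y = sm_fun (d i) f')" for f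
    have h: "h (c i \<cdot> f) = sm_fun (d i) f" if "i \<in> Obj J" "f \<in> Hom C k (OMap F i)" for i f
      unfolding h_def by (rule some_equality) (use that wd in blast)+
    have hY: "h f \<in> Y" if "f \<in> Hom C k x" for f
    proof -
      obtain i f' where i: "i \<in> Obj J" and f': "f' \<in> Hom C k (OMap F i)" "c i \<cdot> f' = f"
        using hom_detectsD(1)[OF det \<open>f \<in> Hom C k x\<close>] by blast
      show ?thesis using h[OF i f'(1)] set_cocone_apply(2)[OF d i f'(1)] f'(2) by simp
    qed
    have Y: "small TYPE('u) Y" using is_coconeD(1)[OF d] by (simp add: Obj_set_category)
    show "\<exists>h \<in> Hom ?Set (Hom C k x) Y. \<forall>i \<in> Obj J. h \<cdot>\<^bsub>?Set\<^esub> AMap (hom_functor C k) (c i) = d i"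
    proof (intro bexI ballI)
      show "Set_Map (Hom C k x) (restrict h (Hom C k x)) Y \<in> Hom ?Set (Hom C k x) Y"
        using Y hY hs k vertex by (auto simp: Hom_set_category has_small_homs_def)
      fix i assume i: "i \<in> Obj J"
      show "Set_Map (Hom C k x) (restrict h (Hom C k x)) Y \<cdot>\<^bsub>?Set\<^esub> AMap (hom_functor C k) (c i) = d i"
        using set_cocone_apply(3)[OF d i] h[OF i] C.Comp_in_Hom[OF _ c_Hom[OF i]]
        by (subst set_cocone_apply(1)[OF d i])
           (auto simp: hom_functor_simps(2)[OF c_Hom[OF i]] Comp_set_category compose_def
             fun_eq_iff PiE_def extensional_def)
    qed
  next
    fix Y h h' assume h: "h \<in> Hom ?Set (Hom C k x) Y" "h' \<in> Hom ?Set (Hom C k x) Y"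
      and eq: "\<forall>i \<in> Obj J. h \<cdot>\<^bsub>?Set\<^esub> AMap (hom_functor C k) (c i)
        = h' \<cdot>\<^bsub>?Set\<^esub> AMap (hom_functor C k) (c i)"
    obtain g g' where g: "h = Set_Map (Hom C k x) g Y" "g \<in> Hom C k x \<rightarrow>\<^sub>E Y"
      and g': "h' = Set_Map (Hom C k x) g' Y" "g' \<in> Hom C k x \<rightarrow>\<^sub>E Y"
      using h by (auto simp: Hom_set_category)
    have "g f = g' f" if f: "f \<in> Hom C k x" for f
    proof -
      obtain i f' where i: "i \<in> Obj J" and f': "f' \<in> Hom C k (OMap F i)" "c i \<cdot> f' = f"
        using hom_detectsD(1)[OF det f] by blast
      from eq i have "compose (Hom C k (OMap F i)) g (\<lambda>f\<in>Hom C k (OMap F i). c i \<cdot> f) f'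
         = compose (Hom C k (OMap F i)) g' (\<lambda>f\<in>Hom C k (OMap F i). c i \<cdot> f) f'"
        by (auto simp: g g' hom_functor_simps(2)[OF c_Hom[OF i]] Comp_set_category)
      with f' show ?thesis by (simp add: compose_def)
    qed
    with g(2) g'(2) have "g = g'" by (intro PiE_ext) auto
    then show "h = h'" by (simp add: g g')
  qed
qed

end

lemma presentable_iff_detects:
  fixes \<kappa> :: "'u rel" and C :: "('o, 'm) category" and t t' :: 'm
  assumes "small_regular_cardinal \<kappa>" "set_universe TYPE('u)" "has_small_homs TYPE('u) C" "t \<noteq> t'"
  shows "presentable \<kappa> C k \<longleftrightarrow> k \<in> Obj C \<and>
    (\<forall>J F x c. filtered \<kappa> J \<and> is_functor J C F \<and> is_colimit J C F x c \<longrightarrow> hom_detects J C F x c k)"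
proof (cases "k \<in> Obj C")
  case True
  have "is_colimit J (set_category TYPE('u)) (fctr_comp (hom_functor C k) F)
      (OMap (hom_functor C k) x) (\<lambda>i. AMap (hom_functor C k) (c i)) \<longleftrightarrow> hom_detects J C F x c k"
    if "filtered \<kappa> J" "is_functor J C F" "is_colimit J C F x c" for J F x c
  proof -
    interpret filtered_cocone \<kappa> J C F x c
      using filtered_categoryI[OF assms(1) that(1)] cocone_of_functor.intro[OF that(2) is_colimitD(1)[OF that(3)]]
      by (rule filtered_cocone.intro)
    show ?thesis
      using hom_colimit_iff_detects[OF assms(3) True assms(2,4)] by (simp add: hom_functor_simps)
  qed
  then show ?thesis
    using True unfolding presentable_def preserves_filtered_colimits_def by blast
qed (simp add: presentable_def)


section \<open>Diagrams over a filtered colimit\<close>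

context filtered_cocone
begin

text \<open>Each of the coincidences is witnessed by its own arrow out of \<open>i\<close>. These arrows form a wide span
  with fewer than \<open>\<kappa>\<close> legs, which has a cocone.\<close>

lemma identify_simultaneously:
  assumes I: "|I| <o \<kappa>" and i: "i \<in> Obj J"
    and det: "\<And>v. v \<in> I \<Longrightarrow> hom_detects J C F x c (k v)"
    and f: "\<And>v. v \<in> I \<Longrightarrow> f v \<in> Hom C (k v) (OMap F i)"
    and f': "\<And>v. v \<in> I \<Longrightarrow> f' v \<in> Hom C (k v) (OMap F i)"
    and eq: "\<And>v. v \<in> I \<Longrightarrow> c i \<cdot> f v = c i \<cdot> f' v"
  obtains j b where "b \<in> Hom J i j"
    "\<And>v. v \<in> I \<Longrightarrow> AMap F b \<cdot> f v = AMap F b \<cdot> f' v"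
proof -
  have "\<forall>v. \<exists>j a. v \<in> I \<longrightarrow> a \<in> Hom J i j \<and> AMap F a \<cdot> f v = AMap F a \<cdot> f' v"
    using hom_detectsD(2)[OF det i f f' eq] by blast
  then obtain j a where a: "\<And>v. v \<in> I \<Longrightarrow> a v \<in> Hom J i (j v)"
    and eq: "\<And>v. v \<in> I \<Longrightarrow> AMap F (a v) \<cdot> f v = AMap F (a v) \<cdot> f' v" by metis
  obtain y b m where b: "b \<in> Hom J i y" and m: "\<And>v. v \<in> I \<Longrightarrow> m v \<in> Hom J (j v) y"
    and mb: "\<And>v. v \<in> I \<Longrightarrow> m v \<cdot>\<^bsub>J\<^esub> a v = b"
    by (rule wide_span_cocone[OF I i, of a j]) (simp add: a, blast)
  show thesis
  proof (rule that[OF b])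
    fix v assume v: "v \<in> I"
    show "AMap F b \<cdot> f v = AMap F b \<cdot> f' v"
      using push_push[OF a[OF v] m[OF v] f[OF v]] push_push[OF a[OF v] m[OF v] f'[OF v]]
      by (simp add: mb[OF v] eq[OF v])
  qed
qed

text \<open>The vertices are factored one by one and moved to a common stage. The resulting triangle over an
  edge commutes after composition with the colimit cocone, hence at a later stage, and one later
  stage serves all edges.\<close>

lemma graph_factors_through_stage:
  assumes V: "|V| <o \<kappa>" and E: "|E| <o \<kappa>"
    and src: "\<And>e. e \<in> E \<Longrightarrow> src e \<in> V" and tgt: "\<And>e. e \<in> E \<Longrightarrow> tgt e \<in> V"
    and det: "\<And>v. v \<in> V \<Longrightarrow> hom_detects J C F x c (ob v)"
    and ar: "\<And>e. e \<in> E \<Longrightarrow> ar e \<in> Hom C (ob (src e)) (ob (tgt e))"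
    and u: "\<And>v. v \<in> V \<Longrightarrow> u v \<in> Hom C (ob v) x"
    and nat: "\<And>e. e \<in> E \<Longrightarrow> u (tgt e) \<cdot> ar e = u (src e)"
  obtains i w where "i \<in> Obj J" "\<And>v. v \<in> V \<Longrightarrow> w v \<in> Hom C (ob v) (OMap F i)"
    "\<And>v. v \<in> V \<Longrightarrow> c i \<cdot> w v = u v" "\<And>e. e \<in> E \<Longrightarrow> w (tgt e) \<cdot> ar e = w (src e)"
proof -
  have "\<forall>v. \<exists>j w. v \<in> V \<longrightarrow> j \<in> Obj J \<and> w \<in> Hom C (ob v) (OMap F j) \<and> c j \<cdot> w = u v"
    using hom_detectsD(1)[OF det u] by blast
  then obtain j w where j: "\<And>v. v \<in> V \<Longrightarrow> j v \<in> Obj J"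
    and w: "\<And>v. v \<in> V \<Longrightarrow> w v \<in> Hom C (ob v) (OMap F (j v))"
    and cw: "\<And>v. v \<in> V \<Longrightarrow> c (j v) \<cdot> w v = u v" by metis
  obtain i m where i: "i \<in> Obj J" and m: "\<And>v. v \<in> V \<Longrightarrow> m v \<in> Hom J (j v) i"
    by (rule upper_bound[OF V, of j]) (simp add: j, blast)
  define w' where "w' v = AMap F (m v) \<cdot> w v" for v
  have w': "w' v \<in> Hom C (ob v) (OMap F i)" and cw': "c i \<cdot> w' v = u v" if "v \<in> V" for v
    using push[OF m[OF that] w[OF that]] cw[OF that] by (simp_all add: w'_def)
  have wa: "w' (tgt e) \<cdot> ar e \<in> Hom C (ob (src e)) (OMap F i)" if "e \<in> E" for e
    using C.Comp_in_Hom[OF ar[OF that] w'[OF tgt[OF that]]] .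
  have cwa: "c i \<cdot> (w' (tgt e) \<cdot> ar e) = c i \<cdot> w' (src e)" if e: "e \<in> E" for e
    using C.Comp_assoc[OF ar[OF e] w'[OF tgt[OF e]] c_Hom[OF i]]
    by (simp add: cw' nat src tgt e)
  obtain l b where b: "b \<in> Hom J i l"
    and bw: "\<And>e. e \<in> E \<Longrightarrow> AMap F b \<cdot> (w' (tgt e) \<cdot> ar e) = AMap F b \<cdot> w' (src e)"
  proof (rule identify_simultaneously[OF E i, where k = "\<lambda>e. ob (src e)"
        and f = "\<lambda>e. w' (tgt e) \<cdot> ar e" and f' = "\<lambda>e. w' (src e)"])
    show "hom_detects J C F x c (ob (src e))" "w' (src e) \<in> Hom C (ob (src e)) (OMap F i)"
      if "e \<in> E" for e
      using det[OF src[OF that]] w'[OF src[OF that]] .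
  qed (use wa cwa that in blast)+
  show thesis
  proof (rule that)
    show "l \<in> Obj J" using b by (rule J.Hom_Obj)
    show "AMap F b \<cdot> w' v \<in> Hom C (ob v) (OMap F l)" if "v \<in> V" for v
      using push(1)[OF b w'[OF that]] .
    show "c l \<cdot> (AMap F b \<cdot> w' v) = u v" if "v \<in> V" for v
      using push(2)[OF b w'[OF that]] cw'[OF that] by simp
    show "AMap F b \<cdot> w' (tgt e) \<cdot> ar e = AMap F b \<cdot> w' (src e)" if e: "e \<in> E" for e
      using C.Comp_assoc[OF ar[OF e] w'[OF tgt[OF e]] F_Hom[OF b]] bw[OF e] by simp
  qed
qed

text \<open>This makes maps out of \<open>k\<close> that are defined by factoring through a stage independent of the
  factorization, even though \<open>x\<close> need not be a colimit of \<open>F\<close> yet.\<close>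

lemma cocone_agrees_over_vertex:
  assumes t: "is_cocone J C F y t" and det: "hom_detects J C F x c k"
    and i: "i \<in> Obj J" and j: "j \<in> Obj J"
    and f: "f \<in> Hom C k (OMap F i)" and g: "g \<in> Hom C k (OMap F j)"
    and eq: "c i \<cdot> f = c j \<cdot> g"
  shows "t i \<cdot> f = t j \<cdot> g"
proof -
  interpret t: cocone_of_functor J C F y t using F t by (rule cocone_of_functor.intro)
  obtain l a b where ab: "a \<in> Hom J i l" "b \<in> Hom J j l" using upper_bound2[OF i j] by blast
  let ?f = "AMap F a \<cdot> f" and ?g = "AMap F b \<cdot> g"
  have fg: "?f \<in> Hom C k (OMap F l)" "?g \<in> Hom C k (OMap F l)"
    using push(1)[OF ab(1) f] push(1)[OF ab(2) g] .
  have "c l \<cdot> ?f = c l \<cdot> ?g"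
    using push(2)[OF ab(1) f] push(2)[OF ab(2) g] eq by simp
  then obtain l' m where m: "m \<in> Hom J l l'" "AMap F m \<cdot> ?f = AMap F m \<cdot> ?g"
    using hom_detectsD(2)[OF det J.Hom_Obj(2)[OF ab(1)] fg] by blast
  have "t i \<cdot> f = t l' \<cdot> (AMap F m \<cdot> ?f)"
    using t.push(2)[OF ab(1) f] t.push(2)[OF m(1) fg(1)] by simp
  also have "\<dots> = t j \<cdot> g"
    using t.push(2)[OF ab(2) g] t.push(2)[OF m(1) fg(2)] m(2) by simp
  finally show ?thesis .
qed

text \<open>A cocone on \<open>F\<close> with vertex \<open>y\<close> restricts to one on \<open>G\<close>, by factoring each \<open>\<gamma> i\<close> through some stage
  of \<open>F\<close>, and thus induces a map from \<open>x\<close>. To see that this map restricts to the original cocone,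
  \<open>c j\<close> is factored through some \<open>\<gamma> i\<close> and then through another stage of \<open>F\<close>: the composite
  agrees with the identity of \<open>F j\<close> over \<open>x\<close>, and \<open>F j\<close> itself detects this.\<close>

lemma colimit_recognition:
  assumes G: "is_functor I C G" and x: "is_colimit I C G x \<gamma>"
    and det: "\<And>i. i \<in> Obj I \<Longrightarrow> hom_detects J C F x c (OMap G i)"
      "\<And>j. j \<in> Obj J \<Longrightarrow> hom_detects J C F x c (OMap F j)"
    and stages: "\<And>j. j \<in> Obj J \<Longrightarrow> \<exists>i \<in> Obj I. \<exists>f \<in> Hom C (OMap F j) (OMap G i). \<gamma> i \<cdot> f = c j"
  shows "is_colimit J C F x c"
proof -
  interpret G: cocone_of_functor I C G x \<gamma>
    using G is_colimitD(1)[OF x] by (rule cocone_of_functor.intro)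
  have "\<forall>i. \<exists>j e. i \<in> Obj I \<longrightarrow> j \<in> Obj J \<and> e \<in> Hom C (OMap G i) (OMap F j) \<and> c j \<cdot> e = \<gamma> i"
    using hom_detectsD(1)[OF det(1) G.c_Hom] by blast
  then obtain j e where j: "\<And>i. i \<in> Obj I \<Longrightarrow> j i \<in> Obj J"
    and e: "\<And>i. i \<in> Obj I \<Longrightarrow> e i \<in> Hom C (OMap G i) (OMap F (j i))"
    and ce: "\<And>i. i \<in> Obj I \<Longrightarrow> c (j i) \<cdot> e i = \<gamma> i" by metis
  show ?thesis
  proof (rule is_colimitI[OF c])
    fix y t assume t: "is_cocone J C F y t"
    interpret t: cocone_of_functor J C F y t using F t by (rule cocone_of_functor.intro)
    have "is_cocone I C G y (\<lambda>i. t (j i) \<cdot> e i)"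
    proof (rule is_coconeI[OF t.vertex])
      show "t (j i) \<cdot> e i \<in> Hom C (OMap G i) y" if "i \<in> Obj I" for i
        using C.Comp_in_Hom[OF e[OF that] t.c_Hom[OF j[OF that]]] .
      fix a i i' assume a: "a \<in> Hom I i i'"
      have ii': "i \<in> Obj I" "i' \<in> Obj I" using a G.J.Hom_Obj by auto
      have ea: "e i' \<cdot> AMap G a \<in> Hom C (OMap G i) (OMap F (j i'))"
        using C.Comp_in_Hom[OF G.F_Hom[OF a] e[OF ii'(2)]] .
      have "c (j i') \<cdot> (e i' \<cdot> AMap G a) = \<gamma> i"
        using C.Comp_assoc[OF G.F_Hom[OF a] e[OF ii'(2)] c_Hom[OF j[OF ii'(2)]]]
          G.c_nat[OF a] ce[OF ii'(2)] by simp
      then have "t (j i') \<cdot> (e i' \<cdot> AMap G a) = t (j i) \<cdot> e i"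
        using cocone_agrees_over_vertex[OF t det(1)[OF ii'(1)] j[OF ii'(2)] j[OF ii'(1)] ea e[OF ii'(1)]]
          ce[OF ii'(1)] by simp
      then show "t (j i') \<cdot> e i' \<cdot> AMap G a = t (j i) \<cdot> e i"
        using C.Comp_assoc[OF G.F_Hom[OF a] e[OF ii'(2)] t.c_Hom[OF j[OF ii'(2)]]] by simp
    qed
    then obtain h where h: "h \<in> Hom C x y"
      and he: "\<And>i. i \<in> Obj I \<Longrightarrow> h \<cdot> \<gamma> i = t (j i) \<cdot> e i"
      using is_colimitD(2)[OF x] by blast
    have "h \<cdot> c l = t l" if l: "l \<in> Obj J" for l
    proof -
      obtain i f where i: "i \<in> Obj I" and f: "f \<in> Hom C (OMap F l) (OMap G i)" and cl: "\<gamma> i \<cdot> f = c l"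
        using stages[OF l] by blast
      note ef = C.Comp_in_Hom[OF f e[OF i]]
      have "h \<cdot> c l = t (j i) \<cdot> (e i \<cdot> f)"
        using C.Comp_assoc[OF f G.c_Hom[OF i] h] C.Comp_assoc[OF f e[OF i] t.c_Hom[OF j[OF i]]]
        by (simp add: cl he[OF i])
      also have "\<dots> = t l \<cdot> Ide C (OMap F l)"
      proof (rule cocone_agrees_over_vertex[OF t det(2)[OF l] j[OF i] l ef C.Ide_in_Hom[OF F_Obj[OF l]]])
        show "c (j i) \<cdot> (e i \<cdot> f) = c l \<cdot> Ide C (OMap F l)"
          using C.Comp_assoc[OF f e[OF i] c_Hom[OF j[OF i]]] C.Comp_Ide[OF c_Hom[OF l]]
          by (simp add: cl ce[OF i])
      qed
      also have "\<dots> = t l" using C.Comp_Ide[OF t.c_Hom[OF l]] .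
      finally show ?thesis .
    qed
    with h show "\<exists>h \<in> Hom C x y. \<forall>i \<in> Obj J. h \<cdot> c i = t i" by blast
  next
    fix y h h' assume h: "h \<in> Hom C x y" and h': "h' \<in> Hom C x y"
      and eq: "\<forall>i \<in> Obj J. h \<cdot> c i = h' \<cdot> c i"
    show "h = h'"
    proof (rule colimit_eqI[OF G x h h'])
      fix i assume i: "i \<in> Obj I"
      show "h \<cdot> \<gamma> i = h' \<cdot> \<gamma> i"
        using C.Comp_assoc[OF e[OF i] c_Hom[OF j[OF i]] h]
          C.Comp_assoc[OF e[OF i] c_Hom[OF j[OF i]] h'] eq j[OF i] ce[OF i] by simp
    qed
  qed
qed

end


section \<open>Closure properties of presentable objects\<close>

locale presentability_setting = category C
  for \<kappa> :: "'u rel" and C :: "('o, 'm) category" (structure) +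
  assumes cardinal: "small_regular_cardinal \<kappa>" and universe: "set_universe TYPE('u)"
    and small_homs: "has_small_homs TYPE('u) C"
    and two_arrows: "\<exists>t t' :: 'm. t \<noteq> t'"
begin

lemma presentable_iff:
  "presentable \<kappa> C k \<longleftrightarrow> k \<in> Obj C \<and>
    (\<forall>J F x c. filtered \<kappa> J \<and> is_functor J C F \<and> is_colimit J C F x c \<longrightarrow> hom_detects J C F x c k)"
  using presentable_iff_detects[OF cardinal universe small_homs] two_arrows by blast

lemma presentable_detects:
  assumes "presentable \<kappa> C k" "filtered \<kappa> J" "is_functor J C F" "is_colimit J C F x c"
  shows "hom_detects J C F x c k"
  using assms presentable_iff by blast

lemma presentableI:
  assumes "k \<in> Obj C"
    and "\<And>J F x c. filtered \<kappa> J \<Longrightarrow> is_functor J C F \<Longrightarrow> is_colimit J C F x c \<Longrightarrow> hom_detects J C F x c k"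
  shows "presentable \<kappa> C k"
  using assms presentable_iff by blast

lemma filtered_cocone:
  assumes "filtered \<kappa> J" "is_functor J C F" "is_cocone J C F x c"
  shows "filtered_cocone \<kappa> J C F x c"
  using filtered_categoryI[OF cardinal assms(1)] cocone_of_functor.intro[OF assms(2,3)]
  by (rule filtered_cocone.intro)

text \<open>Arrows out of \<open>k\<close> extend to \<open>p\<close> along the retraction, and are recovered by restricting along the
  section.\<close>

lemma presentable_retract:
  assumes "is_retract C k p" "presentable \<kappa> C p"
  shows "presentable \<kappa> C k"
proof -
  obtain s q where k: "k \<in> Obj C" and s: "s \<in> Hom C k p" and q: "q \<in> Hom C p k" and qs: "q \<cdot> s = Ide C k"
    using assms(1) unfolding is_retract_def by blast
  have cancel: "f \<cdot> q \<cdot> s = f" if "f \<in> Hom C k y" for f y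
    using Comp_assoc[OF s q that] Comp_Ide[OF that] qs by simp
  show ?thesis
  proof (rule presentableI[OF k])
    fix J F x c assume J: "filtered \<kappa> J" and F: "is_functor J C F" and x: "is_colimit J C F x c"
    interpret filtered_cocone \<kappa> J C F x c using filtered_cocone[OF J F is_colimitD(1)[OF x]] .
    have det: "hom_detects J C F x c p" using presentable_detects[OF assms(2) J F x] .
    show "hom_detects J C F x c k"
    proof (rule hom_detectsI)
      fix f assume f: "f \<in> Hom C k x"
      obtain i g where i: "i \<in> Obj J" and g: "g \<in> Hom C p (OMap F i)" and cg: "c i \<cdot> g = f \<cdot> q"
        using hom_detectsD(1)[OF det Comp_in_Hom[OF q f]] by blast
      have "c i \<cdot> (g \<cdot> s) = f"
        using Comp_assoc[OF s g c_Hom[OF i]] cancel[OF f] cg by simp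
      then show "\<exists>i \<in> Obj J. \<exists>f' \<in> Hom C k (OMap F i). c i \<cdot> f' = f"
        using i Comp_in_Hom[OF s g] by blast
    next
      fix i f f' assume i: "i \<in> Obj J" and f: "f \<in> Hom C k (OMap F i)"
        and f': "f' \<in> Hom C k (OMap F i)" and eq: "c i \<cdot> f = c i \<cdot> f'"
      have "c i \<cdot> (f \<cdot> q) = c i \<cdot> (f' \<cdot> q)"
        using Comp_assoc[OF q f c_Hom[OF i]] Comp_assoc[OF q f' c_Hom[OF i]] eq by simp
      then obtain j a where a: "a \<in> Hom J i j"
        and fa: "AMap F a \<cdot> (f \<cdot> q) = AMap F a \<cdot> (f' \<cdot> q)"
        using hom_detectsD(2)[OF det i Comp_in_Hom[OF q f] Comp_in_Hom[OF q f']] by blast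
      have split: "AMap F a \<cdot> f = AMap F a \<cdot> (f \<cdot> q) \<cdot> s"
        if f: "f \<in> Hom C k (OMap F i)" for f
        using Comp_assoc[OF s Comp_in_Hom[OF q f] F_Hom[OF a]] cancel[OF f] by simp
      have "AMap F a \<cdot> f = AMap F a \<cdot> f'"
        using split[OF f] split[OF f'] fa by simp
      then show "\<exists>j. \<exists>a \<in> Hom J i j. AMap F a \<cdot> f = AMap F a \<cdot> f'" using a by blast
    qed
  qed
qed

lemma presentable_initial:
  assumes z: "z \<in> Obj C" and initial: "\<And>y. y \<in> Obj C \<Longrightarrow> \<exists>!h. h \<in> Hom C z y"
  shows "presentable \<kappa> C z"
proof (rule presentableI[OF z])
  fix J F x c assume J: "filtered \<kappa> J" and F: "is_functor J C F" and x: "is_colimit J C F x c"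
  interpret filtered_cocone \<kappa> J C F x c using filtered_cocone[OF J F is_colimitD(1)[OF x]] .
  have eq: "f = f'" if "f \<in> Hom C z y" "f' \<in> Hom C z y" for f f' y
    using initial[OF Hom_Obj(2)[OF that(1)]] that by blast
  show "hom_detects J C F x c z"
  proof (rule hom_detectsI)
    fix f assume f: "f \<in> Hom C z x"
    obtain i where i: "i \<in> Obj J" by (rule nonempty)
    then obtain h where h: "h \<in> Hom C z (OMap F i)" using initial F_Obj by blast
    have "c i \<cdot> h = f" using eq[OF Comp_in_Hom[OF h c_Hom[OF i]] f] .
    then show "\<exists>i \<in> Obj J. \<exists>f' \<in> Hom C z (OMap F i). c i \<cdot> f' = f" using i h by blast
  next
    fix i f f' assume i: "i \<in> Obj J" and f: "f \<in> Hom C z (OMap F i)" "f' \<in> Hom C z (OMap F i)"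
    show "\<exists>j. \<exists>a \<in> Hom J i j. AMap F a \<cdot> f = AMap F a \<cdot> f'"
      using eq[OF f] J.Ide_in_Hom[OF i] by blast
  qed
qed

end


section \<open>The category of morphisms\<close>

lemma arrow_simps:
  "Obj (arrow_category C) = Arr C"
  "Dom (arrow_category C) = sq_src" "Cod (arrow_category C) = sq_tgt"
  "Ide (arrow_category C) f = Square f (Ide C (Dom C f)) (Ide C (Cod C f)) f"
  by (auto simp: arrow_category_def)

lemma sq_Comp:
  "sq_top (t \<cdot>\<^bsub>arrow_category C\<^esub> s) = sq_top t \<cdot>\<^bsub>C\<^esub> sq_top s"
  "sq_bot (t \<cdot>\<^bsub>arrow_category C\<^esub> s) = sq_bot t \<cdot>\<^bsub>C\<^esub> sq_bot s"
  "sq_src (t \<cdot>\<^bsub>arrow_category C\<^esub> s) = sq_src s"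
  "sq_tgt (t \<cdot>\<^bsub>arrow_category C\<^esub> s) = sq_tgt t"
  by (simp_all add: arrow_category_def)

lemma square_in_Hom_iff:
  "s \<in> Hom (arrow_category C) f g \<longleftrightarrow>
     f \<in> Arr C \<and> g \<in> Arr C \<and> sq_src s = f \<and> sq_tgt s = g \<and>
     sq_top s \<in> Hom C (Dom C f) (Dom C g) \<and> sq_bot s \<in> Hom C (Cod C f) (Cod C g) \<and>
     g \<cdot>\<^bsub>C\<^esub> sq_top s = sq_bot s \<cdot>\<^bsub>C\<^esub> f"
  by (auto simp: arrow_category_def Hom_def)

lemma square_HomD:
  assumes "s \<in> Hom (arrow_category C) f g"
  shows "f \<in> Arr C" "g \<in> Arr C" "sq_src s = f" "sq_tgt s = g"
    "sq_top s \<in> Hom C (Dom C f) (Dom C g)" "sq_bot s \<in> Hom C (Cod C f) (Cod C g)"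
    "g \<cdot>\<^bsub>C\<^esub> sq_top s = sq_bot s \<cdot>\<^bsub>C\<^esub> f"
  using assms by (auto simp: square_in_Hom_iff)

lemma square_eqI:
  assumes "s \<in> Hom (arrow_category C) f g" "t \<in> Hom (arrow_category C) f g"
    and "sq_top s = sq_top t" "sq_bot s = sq_bot t"
  shows "s = t"
  using assms by (cases s; cases t) (auto simp: square_in_Hom_iff)

context category
begin

lemma category_arrow: "category (arrow_category C)"
proof
  let ?M = "arrow_category C"
  show "f \<in> Arr ?M \<Longrightarrow> Dom ?M f \<in> Obj ?M" "f \<in> Arr ?M \<Longrightarrow> Cod ?M f \<in> Obj ?M" for f
    by (auto simp: arrow_category_def)
  show "f \<in> Obj ?M \<Longrightarrow> Ide ?M f \<in> Hom ?M f f" for f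
    using Comp_Ide[OF HomI] Ide_Comp[OF HomI]
    by (auto simp: square_in_Hom_iff arrow_simps intro: Ide_in_Hom Dom_in_Obj Cod_in_Obj)
  show Comp: "t \<cdot>\<^bsub>?M\<^esub> s \<in> Hom ?M f h" if s: "s \<in> Hom ?M f g" and t: "t \<in> Hom ?M g h" for s t f g h
  proof -
    note s = square_HomD[OF s] and t = square_HomD[OF t]
    have "h \<cdot> (sq_top t \<cdot> sq_top s) = sq_bot t \<cdot> (g \<cdot> sq_top s)"
      using Comp_assoc[OF s(5) t(5) HomI[OF t(2)]] Comp_assoc[OF s(5) HomI[OF t(1)] t(6)] t(7) by simp
    also have "\<dots> = sq_bot t \<cdot> sq_bot s \<cdot> f"
      using Comp_assoc[OF HomI[OF s(1)] s(6) t(6)] s(7) by simp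
    finally show ?thesis
      using s t by (auto simp: square_in_Hom_iff sq_Comp intro: Comp_in_Hom)
  qed
  show "s \<cdot>\<^bsub>?M\<^esub> Ide ?M f = s" "Ide ?M g \<cdot>\<^bsub>?M\<^esub> s = s" if s: "s \<in> Hom ?M f g" for s f g
    using square_HomD[OF s] Comp_Ide Ide_Comp
    by (auto intro!: square.expand simp: sq_Comp arrow_simps)
  show "u \<cdot>\<^bsub>?M\<^esub> t \<cdot>\<^bsub>?M\<^esub> s = u \<cdot>\<^bsub>?M\<^esub> (t \<cdot>\<^bsub>?M\<^esub> s)"
    if s: "s \<in> Hom ?M f g" and t: "t \<in> Hom ?M g h" and u: "u \<in> Hom ?M h k" for s t u f g h k
    using Comp_assoc[OF square_HomD(5)[OF s] square_HomD(5)[OF t] square_HomD(5)[OF u]]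
      Comp_assoc[OF square_HomD(6)[OF s] square_HomD(6)[OF t] square_HomD(6)[OF u]]
    by (auto intro!: square.expand simp: sq_Comp)
qed

lemma small_homs_arrow:
  assumes U: "set_universe TYPE('u)" and "has_small_homs TYPE('u) C"
  shows "has_small_homs TYPE('u) (arrow_category C)"
  unfolding has_small_homs_def
proof (intro ballI)
  fix f g assume fg: "f \<in> Obj (arrow_category C)" "g \<in> Obj (arrow_category C)"
  have "small TYPE('u) (Hom C (Dom C f) (Dom C g) \<times> Hom C (Cod C f) (Cod C g))"
    using assms(2) fg Dom_in_Obj Cod_in_Obj
    by (intro small_Sigma[OF U]) (auto simp: has_small_homs_def arrow_simps)
  moreover have "Hom (arrow_category C) f g \<subseteq>
      (\<lambda>(u, v). Square f u v g) ` (Hom C (Dom C f) (Dom C g) \<times> Hom C (Cod C f) (Cod C g))"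
  proof
    fix s assume "s \<in> Hom (arrow_category C) f g"
    from square_HomD[OF this] show "s \<in> (\<lambda>(u, v). Square f u v g) `
        (Hom C (Dom C f) (Dom C g) \<times> Hom C (Cod C f) (Cod C g))"
      by (intro image_eqI[of _ _ "(sq_top s, sq_bot s)"]) (auto intro: square.expand)
  qed
  ultimately show "small TYPE('u) (Hom (arrow_category C) f g)"
    using small_subset small_image by blast
qed

end

definition dom_fctr ::
  "('o, 'm) category \<Rightarrow> ('i, 'j, 'm, 'm square) fctr \<Rightarrow> ('i, 'j, 'o, 'm) fctr" where
  "dom_fctr C F = \<lparr>OMap = Dom C \<circ> OMap F, AMap = sq_top \<circ> AMap F\<rparr>"

definition cod_fctr ::
  "('o, 'm) category \<Rightarrow> ('i, 'j, 'm, 'm square) fctr \<Rightarrow> ('i, 'j, 'o, 'm) fctr" where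
  "cod_fctr C F = \<lparr>OMap = Cod C \<circ> OMap F, AMap = sq_bot \<circ> AMap F\<rparr>"

lemma dom_cod_fctr_simps [simp]:
  "OMap (dom_fctr C F) i = Dom C (OMap F i)" "AMap (dom_fctr C F) a = sq_top (AMap F a)"
  "OMap (cod_fctr C F) i = Cod C (OMap F i)" "AMap (cod_fctr C F) a = sq_bot (AMap F a)"
  by (simp_all add: dom_fctr_def cod_fctr_def)

lemma (in category) functor_dom_cod:
  assumes F: "is_functor J (arrow_category C) F"
  shows "is_functor J C (dom_fctr C F)" "is_functor J C (cod_fctr C F)"
proof -
  note J = is_functorD(1)[OF F]
  show "is_functor J C (dom_fctr C F)"
    by (rule is_functorI[OF J category_axioms])
       (use is_functorD(3)[OF F] square_HomD(5)[OF is_functorD(4)[OF F]] in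
         \<open>auto simp: is_functorD(5,6)[OF F] arrow_simps sq_Comp intro: Dom_in_Obj\<close>)
  show "is_functor J C (cod_fctr C F)"
    by (rule is_functorI[OF J category_axioms])
       (use is_functorD(3)[OF F] square_HomD(6)[OF is_functorD(4)[OF F]] in
         \<open>auto simp: is_functorD(5,6)[OF F] arrow_simps sq_Comp intro: Cod_in_Obj\<close>)
qed

lemma (in category) cocone_dom_cod:
  assumes c: "is_cocone J (arrow_category C) F g c"
  shows "is_cocone J C (dom_fctr C F) (Dom C g) (sq_top \<circ> c)"
    "is_cocone J C (cod_fctr C F) (Cod C g) (sq_bot \<circ> c)"
proof -
  have g: "g \<in> Arr C" using is_coconeD(1)[OF c] by (simp add: arrow_simps)
  have nat: "sq_top (c j) \<cdot> sq_top (AMap F a) = sq_top (c i)"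
    "sq_bot (c j) \<cdot> sq_bot (AMap F a) = sq_bot (c i)" if "a \<in> Hom J i j" for a i j
    using is_coconeD(3)[OF c that, symmetric] by (simp_all add: sq_Comp)
  show "is_cocone J C (dom_fctr C F) (Dom C g) (sq_top \<circ> c)"
    using Dom_in_Obj[OF g] square_HomD(5)[OF is_coconeD(2)[OF c]] nat
    by (intro is_coconeI) simp_all
  show "is_cocone J C (cod_fctr C F) (Cod C g) (sq_bot \<circ> c)"
    using Cod_in_Obj[OF g] square_HomD(6)[OF is_coconeD(2)[OF c]] nat
    by (intro is_coconeI) simp_all
qed

lemma (in category) colimit_of_pointwise:
  assumes F: "is_functor J (arrow_category C) F" and c: "is_cocone J (arrow_category C) F g c"
    and dom: "is_colimit J C (dom_fctr C F) (Dom C g) (sq_top \<circ> c)"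
    and cod: "is_colimit J C (cod_fctr C F) (Cod C g) (sq_bot \<circ> c)"
  shows "is_colimit J (arrow_category C) F g c"
proof (rule is_colimitI[OF c])
  note functors = functor_dom_cod[OF F]
  have g: "g \<in> Arr C" using is_coconeD(1)[OF c] by (simp add: arrow_simps)
  note ci = square_HomD[OF is_coconeD(2)[OF c]]
  fix y d assume d: "is_cocone J (arrow_category C) F y d"
  have y: "y \<in> Arr C" using is_coconeD(1)[OF d] by (simp add: arrow_simps)
  note di = square_HomD[OF is_coconeD(2)[OF d]]
  obtain u where u: "u \<in> Hom C (Dom C g) (Dom C y)"
    and ud: "\<And>i. i \<in> Obj J \<Longrightarrow> u \<cdot> sq_top (c i) = sq_top (d i)"
    using is_colimitD(2)[OF dom cocone_dom_cod(1)[OF d]] by auto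
  obtain v where v: "v \<in> Hom C (Cod C g) (Cod C y)"
    and vd: "\<And>i. i \<in> Obj J \<Longrightarrow> v \<cdot> sq_bot (c i) = sq_bot (d i)"
    using is_colimitD(2)[OF cod cocone_dom_cod(2)[OF d]] by auto
  have "y \<cdot> u = v \<cdot> g"
  proof (rule colimit_eqI[OF functors(1) dom])
    show "y \<cdot> u \<in> Hom C (Dom C g) (Cod C y)" "v \<cdot> g \<in> Hom C (Dom C g) (Cod C y)"
      using Comp_in_Hom[OF u HomI[OF y]] Comp_in_Hom[OF HomI[OF g] v] .
    fix i assume i: "i \<in> Obj J"
    have Fi: "OMap F i \<in> Arr C" using is_functorD(3)[OF F i] by (simp add: arrow_simps)
    have "(y \<cdot> u) \<cdot> sq_top (c i) = y \<cdot> sq_top (d i)"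
      using Comp_assoc[OF ci(5)[OF i] u HomI[OF y]] ud[OF i] by simp
    also have "\<dots> = v \<cdot> (sq_bot (c i) \<cdot> OMap F i)"
      using di(7)[OF i] vd[OF i] Comp_assoc[OF HomI[OF Fi] ci(6)[OF i] v] by simp
    also have "\<dots> = v \<cdot> g \<cdot> sq_top (c i)"
      using ci(7)[OF i] Comp_assoc[OF ci(5)[OF i] HomI[OF g] v] by simp
    finally show "y \<cdot> u \<cdot> (sq_top \<circ> c) i = v \<cdot> g \<cdot> (sq_top \<circ> c) i" by simp
  qed
  with u v y g have uv: "Square g u v y \<in> Hom (arrow_category C) g y"
    by (simp add: square_in_Hom_iff)
  moreover have "Square g u v y \<cdot>\<^bsub>arrow_category C\<^esub> c i = d i" if i: "i \<in> Obj J" for i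
    using ci[OF i] di[OF i] ud[OF i] vd[OF i] by (intro square.expand) (simp add: sq_Comp)
  ultimately show "\<exists>h \<in> Hom (arrow_category C) g y. \<forall>i \<in> Obj J. h \<cdot>\<^bsub>arrow_category C\<^esub> c i = d i"
    by blast
next
  note functors = functor_dom_cod[OF F]
  fix y h h' assume h: "h \<in> Hom (arrow_category C) g y" "h' \<in> Hom (arrow_category C) g y"
    and eq: "\<forall>i \<in> Obj J. h \<cdot>\<^bsub>arrow_category C\<^esub> c i = h' \<cdot>\<^bsub>arrow_category C\<^esub> c i"
  have top: "sq_top h \<cdot> (sq_top \<circ> c) i = sq_top h' \<cdot> (sq_top \<circ> c) i"
    and bot: "sq_bot h \<cdot> (sq_bot \<circ> c) i = sq_bot h' \<cdot> (sq_bot \<circ> c) i" if "i \<in> Obj J" for i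
    using arg_cong[OF bspec[OF eq that], of sq_top] arg_cong[OF bspec[OF eq that], of sq_bot]
    by (simp_all add: sq_Comp)
  have "sq_top h = sq_top h'"
    by (rule colimit_eqI[OF functors(1) dom square_HomD(5)[OF h(1)] square_HomD(5)[OF h(2)] top])
  moreover have "sq_bot h = sq_bot h'"
    by (rule colimit_eqI[OF functors(2) cod square_HomD(6)[OF h(1)] square_HomD(6)[OF h(2)] bot])
  ultimately show "h = h'" using square_eqI[OF h] by blast
qed

text \<open>The morphism between the two colimits is induced by the cocone of the composites
  \<open>d i \<cdot> F i\<close>.\<close>

lemma (in category) colimit_arrow_exists:
  assumes F: "is_functor J (arrow_category C) F"
    and x: "is_colimit J C (dom_fctr C F) x c" and y: "is_colimit J C (cod_fctr C F) y d"
  obtains g s where "is_colimit J (arrow_category C) F g s"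
    "is_colimit J C (dom_fctr C F) (Dom C g) (sq_top \<circ> s)"
    "is_colimit J C (cod_fctr C F) (Cod C g) (sq_bot \<circ> s)"
proof -
  let ?M = "arrow_category C"
  interpret c: cocone_of_functor J C "dom_fctr C F" x c
    using functor_dom_cod(1)[OF F] is_colimitD(1)[OF x] by (rule cocone_of_functor.intro)
  interpret d: cocone_of_functor J C "cod_fctr C F" y d
    using functor_dom_cod(2)[OF F] is_colimitD(1)[OF y] by (rule cocone_of_functor.intro)
  have Fi: "OMap F i \<in> Hom C (Dom C (OMap F i)) (Cod C (OMap F i))" if "i \<in> Obj J" for i
    using is_functorD(3)[OF F that] by (simp add: arrow_simps HomI)
  note Fa = square_HomD[OF is_functorD(4)[OF F]]
  have "is_cocone J C (dom_fctr C F) y (\<lambda>i. d i \<cdot> OMap F i)"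
  proof (rule is_coconeI[OF d.vertex])
    show "d i \<cdot> OMap F i \<in> Hom C (OMap (dom_fctr C F) i) y" if "i \<in> Obj J" for i
      using Comp_in_Hom[OF Fi[OF that]] d.c_Hom[OF that] by simp
    fix a i j assume a: "a \<in> Hom J i j"
    have ij: "i \<in> Obj J" "j \<in> Obj J" using a c.J.Hom_Obj by auto
    have dj: "d j \<in> Hom C (Cod C (OMap F j)) y" using d.c_Hom[OF ij(2)] by simp
    have "d j \<cdot> OMap F j \<cdot> sq_top (AMap F a) = d j \<cdot> (sq_bot (AMap F a) \<cdot> OMap F i)"
      using Comp_assoc[OF Fa(5)[OF a] Fi[OF ij(2)] dj] Fa(7)[OF a] by simp
    also have "\<dots> = d i \<cdot> OMap F i"
      using Comp_assoc[OF Fi[OF ij(1)] Fa(6)[OF a] dj] d.c_nat[OF a] by simp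
    finally show "d j \<cdot> OMap F j \<cdot> AMap (dom_fctr C F) a = d i \<cdot> OMap F i" by simp
  qed
  then obtain g where g: "g \<in> Hom C x y" and gc: "\<And>i. i \<in> Obj J \<Longrightarrow> g \<cdot> c i = d i \<cdot> OMap F i"
    using is_colimitD(2)[OF x] by blast
  define s where "s i = Square (OMap F i) (c i) (d i) g" for i
  have g': "g \<in> Arr C" "Dom C g = x" "Cod C g = y" using g by (auto simp: in_Hom_iff)
  have s: "sq_top \<circ> s = c" "sq_bot \<circ> s = d" by (auto simp: s_def)
  have "is_cocone J ?M F g s"
  proof (rule is_coconeI)
    show "g \<in> Obj ?M" using g' by (simp add: arrow_simps)
    show "s i \<in> Hom ?M (OMap F i) g" if "i \<in> Obj J" for i
      using g' gc[OF that] c.c_Hom[OF that] d.c_Hom[OF that] Fi[OF that]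
      unfolding s_def square_in_Hom_iff by (simp add: in_Hom_iff)
    show "s j \<cdot>\<^bsub>?M\<^esub> AMap F a = s i" if a: "a \<in> Hom J i j" for a i j
      using c.c_nat[OF a] d.c_nat[OF a] Fa(3)[OF a]
      by (intro square.expand) (simp add: s_def sq_Comp)
  qed
  from colimit_of_pointwise[OF F this] that[of g s] show thesis
    using x y by (simp add: g' s)
qed

text \<open>A given colimit is isomorphic to the one constructed from colimits of domains and codomains, and
  the property of being pointwise a colimit is carried along this isomorphism.\<close>

lemma (in category) pointwise_of_colimit:
  assumes F: "is_functor J (arrow_category C) F" and c: "is_colimit J (arrow_category C) F g c"
    and dom: "is_colimit J C (dom_fctr C F) x d" and cod: "is_colimit J C (cod_fctr C F) y e"
  shows "is_colimit J C (dom_fctr C F) (Dom C g) (sq_top \<circ> c)"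
    "is_colimit J C (cod_fctr C F) (Cod C g) (sq_bot \<circ> c)"
proof -
  let ?M = "arrow_category C"
  obtain g' s where s: "is_colimit J ?M F g' s"
    and dom': "is_colimit J C (dom_fctr C F) (Dom C g') (sq_top \<circ> s)"
    and cod': "is_colimit J C (cod_fctr C F) (Cod C g') (sq_bot \<circ> s)"
    by (rule colimit_arrow_exists[OF F dom cod])
  obtain p q where p: "p \<in> Hom ?M g' g" and q: "q \<in> Hom ?M g g'"
    and qp: "q \<cdot>\<^bsub>?M\<^esub> p = Ide ?M g'"
    and pq: "p \<cdot>\<^bsub>?M\<^esub> q = Ide ?M g"
    and ps: "\<And>i. i \<in> Obj J \<Longrightarrow> p \<cdot>\<^bsub>?M\<^esub> s i = c i"
    by (rule colimits_isomorphic[OF F s c]) blast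
  note cocones = cocone_dom_cod[OF is_colimitD(1)[OF c]]
  show "is_colimit J C (dom_fctr C F) (Dom C g) (sq_top \<circ> c)"
    using arg_cong[OF qp, of sq_top] arg_cong[OF pq, of sq_top] arg_cong[OF ps, of _ sq_top]
    by (intro colimit_iso_transport[OF functor_dom_cod(1)[OF F] dom' cocones(1) square_HomD(5)[OF p]
          _ square_HomD(5)[OF q]]) (simp_all add: sq_Comp arrow_simps)
  show "is_colimit J C (cod_fctr C F) (Cod C g) (sq_bot \<circ> c)"
    using arg_cong[OF qp, of sq_bot] arg_cong[OF pq, of sq_bot] arg_cong[OF ps, of _ sq_bot]
    by (intro colimit_iso_transport[OF functor_dom_cod(2)[OF F] cod' cocones(2) square_HomD(6)[OF p]
          _ square_HomD(6)[OF q]]) (simp_all add: sq_Comp arrow_simps)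
qed

lemma (in category) filtered_colimits_arrow:
  assumes "has_filtered_colimits \<kappa> C"
  shows "has_filtered_colimits \<kappa> (arrow_category C)"
  unfolding has_filtered_colimits_def
proof (intro allI impI, elim conjE)
  fix J F assume J: "filtered \<kappa> J" and F: "is_functor J (arrow_category C) F"
  note functors = functor_dom_cod[OF F]
  obtain x c y d where "is_colimit J C (dom_fctr C F) x c" "is_colimit J C (cod_fctr C F) y d"
    using assms J functors unfolding has_filtered_colimits_def by meson
  then show "\<exists>x c. is_colimit J (arrow_category C) F x c"
    by (rule colimit_arrow_exists[OF F]) blast
qed

lemma (in category) filtered_colimit_pointwise:
  assumes fc: "has_filtered_colimits \<kappa> C" and J: "filtered \<kappa> J"
    and F: "is_functor J (arrow_category C) F" and c: "is_colimit J (arrow_category C) F g c"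
  shows "is_colimit J C (dom_fctr C F) (Dom C g) (sq_top \<circ> c)"
    "is_colimit J C (cod_fctr C F) (Cod C g) (sq_bot \<circ> c)"
proof -
  obtain x d y e where "is_colimit J C (dom_fctr C F) x d" "is_colimit J C (cod_fctr C F) y e"
    using fc J functor_dom_cod[OF F] unfolding has_filtered_colimits_def by meson
  from pointwise_of_colimit[OF F c this]
  show "is_colimit J C (dom_fctr C F) (Dom C g) (sq_top \<circ> c)"
    "is_colimit J C (cod_fctr C F) (Cod C g) (sq_bot \<circ> c)" .
qed


section \<open>Presentable morphisms\<close>

lemma (in presentability_setting) arrow_setting: "presentability_setting \<kappa> (arrow_category C)"
proof -
  obtain t t' :: 'm where "t \<noteq> t'" using two_arrows by blast
  then have "Square t t t t \<noteq> Square t' t t t" by simp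
  then have "\<exists>s s' :: 'm square. s \<noteq> s'" by blast
  then show ?thesis
    using category_arrow cardinal universe small_homs_arrow[OF universe small_homs]
    by (simp add: presentability_setting_def presentability_setting_axioms_def)
qed

text \<open>The two sides of a square are factored separately. The square that they bound commutes only over
  the colimit, and to make it commute at a stage, arrows from the domain of \<open>p\<close> into the diagram of
  codomains have to be identified: this is the mixed hypothesis.\<close>

lemma (in filtered_category) hom_detects_arrow:
  fixes C :: "('o, 'm) category" (structure)
  assumes C: "category C" and F: "is_functor J (arrow_category C) F"
    and c: "is_cocone J (arrow_category C) F g c" and p: "p \<in> Arr C"
    and dom: "hom_detects J C (dom_fctr C F) (Dom C g) (sq_top \<circ> c) (Dom C p)"
    and cod: "hom_detects J C (cod_fctr C F) (Cod C g) (sq_bot \<circ> c) (Cod C p)"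
    and mixed: "hom_detects J C (cod_fctr C F) (Cod C g) (sq_bot \<circ> c) (Dom C p)"
  shows "hom_detects J (arrow_category C) F g c p"
proof -
  let ?M = "arrow_category C"
  interpret C: category C by fact
  interpret M: category ?M by (rule C.category_arrow)
  interpret sq: filtered_cocone \<kappa> J ?M F g c
    using filtered_category_axioms cocone_of_functor.intro[OF F c] by (rule filtered_cocone.intro)
  interpret dom: filtered_cocone \<kappa> J C "dom_fctr C F" "Dom C g" "sq_top \<circ> c"
    using filtered_category_axioms
      cocone_of_functor.intro[OF C.functor_dom_cod(1)[OF F] C.cocone_dom_cod(1)[OF c]]
    by (rule filtered_cocone.intro)
  interpret cod: filtered_cocone \<kappa> J C "cod_fctr C F" "Cod C g" "sq_bot \<circ> c"
    using filtered_category_axioms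
      cocone_of_functor.intro[OF C.functor_dom_cod(2)[OF F] C.cocone_dom_cod(2)[OF c]]
    by (rule filtered_cocone.intro)
  have g: "g \<in> Hom C (Dom C g) (Cod C g)" using sq.vertex by (simp add: arrow_simps HomI)
  have p': "p \<in> Hom C (Dom C p) (Cod C p)" using p by (rule HomI)
  have Fi: "OMap F i \<in> Hom C (Dom C (OMap F i)) (Cod C (OMap F i))" if "i \<in> Obj J" for i
    using sq.F_Obj[OF that] by (simp add: arrow_simps HomI)
  show ?thesis
  proof (rule hom_detectsI)
    fix s assume s: "s \<in> Hom ?M p g"
    note s' = square_HomD[OF s]
    obtain i u where i: "i \<in> Obj J" and u: "u \<in> Hom C (Dom C p) (OMap (dom_fctr C F) i)"
      and cu: "(sq_top \<circ> c) i \<cdot> u = sq_top s"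
      using hom_detectsD(1)[OF dom s'(5)] by blast
    obtain j v where j: "j \<in> Obj J" and v: "v \<in> Hom C (Cod C p) (OMap (cod_fctr C F) j)"
      and cv: "(sq_bot \<circ> c) j \<cdot> v = sq_bot s"
      using hom_detectsD(1)[OF cod s'(6)] by blast
    obtain l a b where l: "l \<in> Obj J" and a: "a \<in> Hom J i l" and b: "b \<in> Hom J j l"
      using upper_bound2[OF i j] by blast
    define u' where "u' = AMap (dom_fctr C F) a \<cdot> u"
    define v' where "v' = AMap (cod_fctr C F) b \<cdot> v"
    have u': "u' \<in> Hom C (Dom C p) (OMap (dom_fctr C F) l)" "sq_top (c l) \<cdot> u' = sq_top s"
      using dom.push[OF a u] cu by (simp_all add: u'_def)
    have v': "v' \<in> Hom C (Cod C p) (OMap (cod_fctr C F) l)" "sq_bot (c l) \<cdot> v' = sq_bot s"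
      using cod.push[OF b v] cv by (simp_all add: v'_def)
    note cl = square_HomD[OF sq.c_Hom[OF l]]
    \<comment> \<open>The square with sides \<open>u'\<close> and \<open>v'\<close> commutes only after composing with the cocone, hence
      at a later stage.\<close>
    have Fu: "OMap F l \<cdot> u' \<in> Hom C (Dom C p) (OMap (cod_fctr C F) l)"
      using C.Comp_in_Hom[OF _ Fi[OF l]] u'(1) by simp
    have vp: "v' \<cdot> p \<in> Hom C (Dom C p) (OMap (cod_fctr C F) l)"
      using C.Comp_in_Hom[OF p' v'(1)] .
    have "(sq_bot \<circ> c) l \<cdot> (OMap F l \<cdot> u') = g \<cdot> (sq_top (c l) \<cdot> u')"
      using C.Comp_assoc[OF _ Fi[OF l] cl(6), of u'] C.Comp_assoc[OF _ cl(5) g, of u'] u'(1) cl(7)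
      by simp
    also have "\<dots> = (sq_bot \<circ> c) l \<cdot> (v' \<cdot> p)"
      using C.Comp_assoc[OF p' _ cl(6), of v'] v' s'(7) u'(2) by simp
    finally obtain l' m where m: "m \<in> Hom J l l'"
      and eq: "AMap (cod_fctr C F) m \<cdot> (OMap F l \<cdot> u') = AMap (cod_fctr C F) m \<cdot> (v' \<cdot> p)"
      using hom_detectsD(2)[OF mixed l Fu vp] by blast
    have l': "l' \<in> Obj J" using m by (rule J.Hom_Obj)
    note Fm = square_HomD[OF sq.F_Hom[OF m]]
    define t where "t = Square p (sq_top (AMap F m) \<cdot> u') (sq_bot (AMap F m) \<cdot> v') (OMap F l')"
    have "OMap F l' \<cdot> (sq_top (AMap F m) \<cdot> u') = sq_bot (AMap F m) \<cdot> (OMap F l \<cdot> u')"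
      using C.Comp_assoc[OF _ Fm(5) Fi[OF l'], of u'] C.Comp_assoc[OF _ Fi[OF l] Fm(6), of u']
        u'(1) Fm(7) by simp
    also have "\<dots> = sq_bot (AMap F m) \<cdot> v' \<cdot> p"
      using eq C.Comp_assoc[OF p' _ Fm(6), of v'] v'(1) by simp
    finally have "t \<in> Hom ?M p (OMap F l')"
      using dom.push(1)[OF m u'(1)] cod.push(1)[OF m v'(1)] p Fm(2)
      by (simp add: t_def square_in_Hom_iff)
    moreover have "c l' \<cdot>\<^bsub>?M\<^esub> t = s"
      using dom.push(2)[OF m u'(1)] cod.push(2)[OF m v'(1)] u'(2) v'(2) s'
        square_HomD[OF sq.c_Hom[OF l']]
      by (intro square.expand) (simp add: t_def sq_Comp)
    ultimately show "\<exists>i \<in> Obj J. \<exists>f' \<in> Hom ?M p (OMap F i). c i \<cdot>\<^bsub>?M\<^esub> f' = s"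
      using l' by blast
  next
    fix i s t assume i: "i \<in> Obj J" and s: "s \<in> Hom ?M p (OMap F i)"
      and t: "t \<in> Hom ?M p (OMap F i)"
      and eq: "c i \<cdot>\<^bsub>?M\<^esub> s = c i \<cdot>\<^bsub>?M\<^esub> t"
    note s' = square_HomD[OF s] and t' = square_HomD[OF t]
    have "\<exists>j. \<exists>a \<in> Hom J i j. AMap (dom_fctr C F) a \<cdot> sq_top s = AMap (dom_fctr C F) a \<cdot> sq_top t"
      using s'(5) t'(5) arg_cong[OF eq, of sq_top]
      by (intro hom_detectsD(2)[OF dom i]) (simp_all add: sq_Comp)
    then obtain j a where a: "a \<in> Hom J i j"
      and top: "sq_top (AMap F a) \<cdot> sq_top s = sq_top (AMap F a) \<cdot> sq_top t" by auto
    have "\<exists>j. \<exists>a \<in> Hom J i j. AMap (cod_fctr C F) a \<cdot> sq_bot s = AMap (cod_fctr C F) a \<cdot> sq_bot t"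
      using s'(6) t'(6) arg_cong[OF eq, of sq_bot]
      by (intro hom_detectsD(2)[OF cod i]) (simp_all add: sq_Comp)
    then obtain k b where b: "b \<in> Hom J i k"
      and bot: "sq_bot (AMap F b) \<cdot> sq_bot s = sq_bot (AMap F b) \<cdot> sq_bot t" by auto
    obtain l m n where m: "m \<in> Hom J j l" and n: "n \<in> Hom J k l" and mn: "m \<cdot>\<^bsub>J\<^esub> a = n \<cdot>\<^bsub>J\<^esub> b"
      using span_cocone[OF a b] by blast
    have ma: "m \<cdot>\<^bsub>J\<^esub> a \<in> Hom J i l" using J.Comp_in_Hom[OF a m] .
    have top_push: "sq_top (AMap F (m \<cdot>\<^bsub>J\<^esub> a)) \<cdot> u = sq_top (AMap F m) \<cdot> (sq_top (AMap F a) \<cdot> u)"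
      if "u \<in> Hom C (Dom C p) (Dom C (OMap F i))" for u
      using dom.push_push[OF a m, of u "Dom C p"] that by simp
    have bot_push: "sq_bot (AMap F (n \<cdot>\<^bsub>J\<^esub> b)) \<cdot> v = sq_bot (AMap F n) \<cdot> (sq_bot (AMap F b) \<cdot> v)"
      if "v \<in> Hom C (Cod C p) (Cod C (OMap F i))" for v
      using cod.push_push[OF b n, of v "Cod C p"] that by simp
    have "AMap F (m \<cdot>\<^bsub>J\<^esub> a) \<cdot>\<^bsub>?M\<^esub> s = AMap F (m \<cdot>\<^bsub>J\<^esub> a) \<cdot>\<^bsub>?M\<^esub> t"
    proof (rule square_eqI[OF sq.push(1)[OF ma s] sq.push(1)[OF ma t]])
      show "sq_top (AMap F (m \<cdot>\<^bsub>J\<^esub> a) \<cdot>\<^bsub>?M\<^esub> s) = sq_top (AMap F (m \<cdot>\<^bsub>J\<^esub> a) \<cdot>\<^bsub>?M\<^esub> t)"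
        using top_push[OF s'(5)] top_push[OF t'(5)] top by (simp add: sq_Comp)
      show "sq_bot (AMap F (m \<cdot>\<^bsub>J\<^esub> a) \<cdot>\<^bsub>?M\<^esub> s) = sq_bot (AMap F (m \<cdot>\<^bsub>J\<^esub> a) \<cdot>\<^bsub>?M\<^esub> t)"
        using bot_push[OF s'(6)] bot_push[OF t'(6)] bot by (simp add: sq_Comp mn)
    qed
    then show "\<exists>j. \<exists>a \<in> Hom J i j. AMap F a \<cdot>\<^bsub>?M\<^esub> s = AMap F a \<cdot>\<^bsub>?M\<^esub> t"
      using ma by blast
  qed
qed

lemma (in presentability_setting) presentable_arrow:
  assumes fc: "has_filtered_colimits \<kappa> C" and p: "p \<in> Arr C"
    and "presentable \<kappa> C (Dom C p)" "presentable \<kappa> C (Cod C p)"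
  shows "presentable \<kappa> (arrow_category C) p"
proof -
  interpret M: presentability_setting \<kappa> "arrow_category C" by (rule arrow_setting)
  show ?thesis
  proof (rule M.presentableI)
    show "p \<in> Obj (arrow_category C)" using p by (simp add: arrow_simps)
    fix J F x c assume J: "filtered \<kappa> J" and F: "is_functor J (arrow_category C) F"
      and c: "is_colimit J (arrow_category C) F x c"
    interpret filtered_category \<kappa> J using filtered_categoryI[OF cardinal J] .
    note ptw = filtered_colimit_pointwise[OF fc J F c] and comps = functor_dom_cod[OF F]
    show "hom_detects J (arrow_category C) F x c p"
      by (rule hom_detects_arrow[OF category_axioms F is_colimitD(1)[OF c] p
            presentable_detects[OF assms(3) J comps(1) ptw(1)]
            presentable_detects[OF assms(4) J comps(2) ptw(2)]
            presentable_detects[OF assms(3) J comps(2) ptw(2)]])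
  qed
qed


section \<open>Morphisms as filtered colimits of presentable morphisms\<close>

text \<open>A morphism whose domain and codomain are presented as filtered colimits of presentable objects.
  The shapes of the two presentations are unrelated.\<close>

locale presented_arrow = presentability_setting \<kappa> C
  for \<kappa> :: "'u rel" and C :: "('o, 'm) category" (structure) +
  fixes I :: "('u, 'u) category" and G \<gamma> and J :: "('u, 'u) category" and H \<eta> and g
  assumes g: "g \<in> Arr C"
    and I: "filtered \<kappa> I" "is_functor I C G" "is_colimit I C G (Dom C g) \<gamma>"
      "\<And>i. i \<in> Obj I \<Longrightarrow> presentable \<kappa> C (OMap G i)"
    and J: "filtered \<kappa> J" "is_functor J C H" "is_colimit J C H (Cod C g) \<eta>"
      "\<And>j. j \<in> Obj J \<Longrightarrow> presentable \<kappa> C (OMap H j)"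
begin

sublocale dom: filtered_cocone \<kappa> I C G "Dom C g" \<gamma>
  using filtered_cocone[OF I(1,2) is_colimitD(1)[OF I(3)]] .

sublocale cod: filtered_cocone \<kappa> J C H "Cod C g" \<eta>
  using filtered_cocone[OF J(1,2) is_colimitD(1)[OF J(3)]] .

abbreviation "M \<equiv> arrow_category C"

text \<open>The objects of the comma category of the two presentations that lie over \<open>g\<close>, as squares into
  \<open>g\<close>.\<close>

definition stages :: "'m square set" where
  "stages = {Square f (\<gamma> i) (\<eta> j) g | f i j.
     i \<in> Obj I \<and> j \<in> Obj J \<and> f \<in> Hom C (OMap G i) (OMap H j) \<and> g \<cdot> \<gamma> i = \<eta> j \<cdot> f}"

lemma small_stages: "small TYPE('u) stages"
proof -
  have "small TYPE('u) (SIGMA i:Obj I. SIGMA j:Obj J. Hom C (OMap G i) (OMap H j))"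
    using I(1) J(1) small_homs dom.F_Obj cod.F_Obj
    by (intro small_Sigma[OF universe])
       (auto simp: filtered_def small_category_def has_small_homs_def)
  moreover have "stages \<subseteq> (\<lambda>(i, j, f). Square f (\<gamma> i) (\<eta> j) g) `
      (SIGMA i:Obj I. SIGMA j:Obj J. Hom C (OMap G i) (OMap H j))"
    unfolding stages_def by (force simp: image_iff)
  ultimately show ?thesis using small_subset small_image by blast
qed

lemma stage_presentable:
  assumes "s \<in> stages"
  shows "s \<in> Hom M (sq_src s) g" "sq_src s \<in> Arr C"
    "presentable \<kappa> C (Dom C (sq_src s))" "presentable \<kappa> C (Cod C (sq_src s))"
proof -
  obtain f i j where s: "s = Square f (\<gamma> i) (\<eta> j) g" and i: "i \<in> Obj I" and j: "j \<in> Obj J"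
    and f: "f \<in> Hom C (OMap G i) (OMap H j)" and eq: "g \<cdot> \<gamma> i = \<eta> j \<cdot> f"
    using assms unfolding stages_def by blast
  have f': "f \<in> Arr C" "Dom C f = OMap G i" "Cod C f = OMap H j" using f by (auto simp: in_Hom_iff)
  then show "sq_src s \<in> Arr C"
    "presentable \<kappa> C (Dom C (sq_src s))" "presentable \<kappa> C (Cod C (sq_src s))"
    using I(4)[OF i] J(4)[OF j] by (simp_all add: s)
  show "s \<in> Hom M (sq_src s) g"
    using f' g dom.c_Hom[OF i] cod.c_Hom[OF j] eq by (simp add: s square_in_Hom_iff)
qed

text \<open>The domains of the graph factor through some \<open>G i\<close> and its codomains through some \<open>H j\<close>. The
  presentable object \<open>G i\<close> maps to the codomain of \<open>g\<close> through some stage of \<open>H\<close>, which gives a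
  candidate for the morphism of the stage. The squares from the graph to this candidate commute over
  the codomain of \<open>g\<close>, hence after passing to a later stage of \<open>H\<close>, one for all vertices.\<close>

lemma graph_factors_through_stages:
  assumes V: "|V| <o \<kappa>" and E: "|E| <o \<kappa>"
    and src: "\<And>e. e \<in> E \<Longrightarrow> src e \<in> V" and tgt: "\<And>e. e \<in> E \<Longrightarrow> tgt e \<in> V"
    and pres: "\<And>v. v \<in> V \<Longrightarrow> presentable \<kappa> C (Dom C (ob v))"
      "\<And>v. v \<in> V \<Longrightarrow> presentable \<kappa> C (Cod C (ob v))"
    and ar: "\<And>e. e \<in> E \<Longrightarrow> ar e \<in> Hom M (ob (src e)) (ob (tgt e))"
    and \<sigma>: "\<And>v. v \<in> V \<Longrightarrow> \<sigma> v \<in> Hom M (ob v) g"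
    and nat: "\<And>e. e \<in> E \<Longrightarrow> \<sigma> (tgt e) \<cdot>\<^bsub>M\<^esub> ar e = \<sigma> (src e)"
  obtains s m where "s \<in> stages" "\<And>v. v \<in> V \<Longrightarrow> m v \<in> Hom M (ob v) (sq_src s)"
    "\<And>v. v \<in> V \<Longrightarrow> s \<cdot>\<^bsub>M\<^esub> m v = \<sigma> v" "\<And>e. e \<in> E \<Longrightarrow> m (tgt e) \<cdot>\<^bsub>M\<^esub> ar e = m (src e)"
proof -
  note \<sigma>' = square_HomD[OF \<sigma>] and ar' = square_HomD[OF ar]
  have g': "g \<in> Hom C (Dom C g) (Cod C g)" using g by (rule HomI)
  obtain i u where i: "i \<in> Obj I" and u: "\<And>v. v \<in> V \<Longrightarrow> u v \<in> Hom C (Dom C (ob v)) (OMap G i)"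
    and \<gamma>u: "\<And>v. v \<in> V \<Longrightarrow> \<gamma> i \<cdot> u v = sq_top (\<sigma> v)"
    and u_nat: "\<And>e. e \<in> E \<Longrightarrow> u (tgt e) \<cdot> sq_top (ar e) = u (src e)"
  proof (rule dom.graph_factors_through_stage[OF V E src tgt, where ob = "\<lambda>v. Dom C (ob v)"
        and ar = "\<lambda>e. sq_top (ar e)" and u = "\<lambda>v. sq_top (\<sigma> v)"])
    show "hom_detects I C G (Dom C g) \<gamma> (Dom C (ob v))" if "v \<in> V" for v
      using presentable_detects[OF pres(1)[OF that] I(1-3)] .
    show "sq_top (\<sigma> (tgt e)) \<cdot> sq_top (ar e) = sq_top (\<sigma> (src e))" if "e \<in> E" for e
      using arg_cong[OF nat[OF that], of sq_top] by (simp add: sq_Comp)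
  qed (use ar'(5) \<sigma>'(5) that in blast)+
  obtain j v where j: "j \<in> Obj J" and v: "\<And>x. x \<in> V \<Longrightarrow> v x \<in> Hom C (Cod C (ob x)) (OMap H j)"
    and \<eta>v: "\<And>x. x \<in> V \<Longrightarrow> \<eta> j \<cdot> v x = sq_bot (\<sigma> x)"
    and v_nat: "\<And>e. e \<in> E \<Longrightarrow> v (tgt e) \<cdot> sq_bot (ar e) = v (src e)"
  proof (rule cod.graph_factors_through_stage[OF V E src tgt, where ob = "\<lambda>v. Cod C (ob v)"
        and ar = "\<lambda>e. sq_bot (ar e)" and u = "\<lambda>v. sq_bot (\<sigma> v)"])
    show "hom_detects J C H (Cod C g) \<eta> (Cod C (ob v))" if "v \<in> V" for v
      using presentable_detects[OF pres(2)[OF that] J(1-3)] .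
    show "sq_bot (\<sigma> (tgt e)) \<cdot> sq_bot (ar e) = sq_bot (\<sigma> (src e))" if "e \<in> E" for e
      using arg_cong[OF nat[OF that], of sq_bot] by (simp add: sq_Comp)
  qed (use ar'(6) \<sigma>'(6) that in blast)+
  have g\<gamma>: "g \<cdot> \<gamma> i \<in> Hom C (OMap G i) (Cod C g)" using Comp_in_Hom[OF dom.c_Hom[OF i] g'] .
  obtain j' f0 where j': "j' \<in> Obj J" and f0: "f0 \<in> Hom C (OMap G i) (OMap H j')"
    and \<eta>f0: "\<eta> j' \<cdot> f0 = g \<cdot> \<gamma> i"
    using hom_detectsD(1)[OF presentable_detects[OF I(4)[OF i] J(1-3)] g\<gamma>] by blast
  obtain l a b where l: "l \<in> Obj J" and a: "a \<in> Hom J j l" and b: "b \<in> Hom J j' l"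
    using cod.upper_bound2[OF j j'] by blast
  define v' where "v' x = AMap H a \<cdot> v x" for x
  define f where "f = AMap H b \<cdot> f0"
  have f: "f \<in> Hom C (OMap G i) (OMap H l)" "\<eta> l \<cdot> f = g \<cdot> \<gamma> i"
    using cod.push[OF b f0] \<eta>f0 by (simp_all add: f_def)
  have v': "v' x \<in> Hom C (Cod C (ob x)) (OMap H l)" "\<eta> l \<cdot> v' x = sq_bot (\<sigma> x)" if "x \<in> V" for x
    using cod.push[OF a v[OF that]] \<eta>v[OF that] by (simp_all add: v'_def)
  have obx: "ob x \<in> Hom C (Dom C (ob x)) (Cod C (ob x))" if "x \<in> V" for x
    using HomI[OF \<sigma>'(1)[OF that]] .
  have fu: "f \<cdot> u x \<in> Hom C (Dom C (ob x)) (OMap H l)" if "x \<in> V" for x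
    using Comp_in_Hom[OF u[OF that] f(1)] .
  have vo: "v' x \<cdot> ob x \<in> Hom C (Dom C (ob x)) (OMap H l)" if "x \<in> V" for x
    using Comp_in_Hom[OF obx[OF that] v'(1)[OF that]] .
  have eq: "\<eta> l \<cdot> (f \<cdot> u x) = \<eta> l \<cdot> (v' x \<cdot> ob x)" if x: "x \<in> V" for x
  proof -
    have "\<eta> l \<cdot> (f \<cdot> u x) = g \<cdot> (\<gamma> i \<cdot> u x)"
      using Comp_assoc[OF u[OF x] f(1) cod.c_Hom[OF l]] Comp_assoc[OF u[OF x] dom.c_Hom[OF i] g'] f(2)
      by simp
    also have "\<dots> = \<eta> l \<cdot> (v' x \<cdot> ob x)"
      using \<gamma>u[OF x] \<sigma>'(7)[OF x] v'(2)[OF x] Comp_assoc[OF obx[OF x] v'(1)[OF x] cod.c_Hom[OF l]]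
      by simp
    finally show ?thesis .
  qed
  obtain n d where d: "d \<in> Hom J l n"
    and deq: "\<And>x. x \<in> V \<Longrightarrow> AMap H d \<cdot> (f \<cdot> u x) = AMap H d \<cdot> (v' x \<cdot> ob x)"
  proof (rule cod.identify_simultaneously[OF V l, where k = "\<lambda>x. Dom C (ob x)"
        and f = "\<lambda>x. f \<cdot> u x" and f' = "\<lambda>x. v' x \<cdot> ob x"])
    show "hom_detects J C H (Cod C g) \<eta> (Dom C (ob v))" if "v \<in> V" for v
      using presentable_detects[OF pres(1)[OF that] J(1-3)] .
  qed (use fu vo eq that in blast)+
  have n: "n \<in> Obj J" using d by (rule cod.J.Hom_Obj)
  note Hd = cod.F_Hom[OF d]
  define f' where "f' = AMap H d \<cdot> f"
  define w where "w x = AMap H d \<cdot> v' x" for x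
  have f': "f' \<in> Hom C (OMap G i) (OMap H n)" "\<eta> n \<cdot> f' = g \<cdot> \<gamma> i"
    using cod.push[OF d f(1)] f(2) by (simp_all add: f'_def)
  have w: "w x \<in> Hom C (Cod C (ob x)) (OMap H n)" "\<eta> n \<cdot> w x = sq_bot (\<sigma> x)" if "x \<in> V" for x
    using cod.push[OF d v'(1)[OF that]] v'(2)[OF that] by (simp_all add: w_def)
  have comm: "f' \<cdot> u x = w x \<cdot> ob x" if x: "x \<in> V" for x
    using Comp_assoc[OF u[OF x] f(1) Hd] Comp_assoc[OF obx[OF x] v'(1)[OF x] Hd] deq[OF x]
    by (simp add: f'_def w_def)
  have w_nat: "w (tgt e) \<cdot> sq_bot (ar e) = w (src e)" if e: "e \<in> E" for e
  proof -
    note t = tgt[OF e]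
    have "v' (tgt e) \<cdot> sq_bot (ar e) = v' (src e)"
      using Comp_assoc[OF ar'(6)[OF e] v[OF t] cod.F_Hom[OF a]] v_nat[OF e] by (simp add: v'_def)
    then show ?thesis
      using Comp_assoc[OF ar'(6)[OF e] v'(1)[OF t] Hd] by (simp add: w_def)
  qed
  have f'': "f' \<in> Arr C" "Dom C f' = OMap G i" "Cod C f' = OMap H n"
    using f'(1) by (auto simp: in_Hom_iff)
  let ?s = "Square f' (\<gamma> i) (\<eta> n) g" and ?m = "\<lambda>x. Square (ob x) (u x) (w x) f'"
  show thesis
  proof (rule that[of ?s ?m])
    show "?s \<in> stages" unfolding stages_def using i n f'(1) f'(2)[symmetric] by blast
    show "?m x \<in> Hom M (ob x) (sq_src ?s)" if "x \<in> V" for x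
      using \<sigma>'(1)[OF that] f'' u[OF that] w(1)[OF that] comm[OF that] by (simp add: square_in_Hom_iff)
    show "?s \<cdot>\<^bsub>M\<^esub> ?m x = \<sigma> x" if "x \<in> V" for x
      using \<gamma>u[OF that] w(2)[OF that] \<sigma>'(3,4)[OF that] by (intro square.expand) (simp add: sq_Comp)
    show "?m (tgt e) \<cdot>\<^bsub>M\<^esub> ar e = ?m (src e)" if "e \<in> E" for e
      using u_nat[OF that] w_nat[OF that] ar'(3)[OF that] by (intro square.expand) (simp add: sq_Comp)
  qed
qed

end


section \<open>Full subcategories of slices\<close>

text \<open>The full subcategory of a slice on the class \<open>X\<close> of its objects. An arrow of the base category
  does not determine between which elements of \<open>X\<close> it is regarded as an arrow, so both are
  recorded.\<close>

definition slice_category :: "('o, 'm) category \<Rightarrow> 'm set \<Rightarrow> ('m, 'm \<times> 'm \<times> 'm) category" where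
  "slice_category C X =
     \<lparr>Obj = X,
      Arr = {(x, m, y). x \<in> X \<and> y \<in> X \<and> m \<in> Hom C (Dom C x) (Dom C y) \<and> y \<cdot>\<^bsub>C\<^esub> m = x},
      Dom = fst, Cod = snd \<circ> snd,
      Ide = (\<lambda>x. (x, Ide C (Dom C x), x)),
      Comp = (\<lambda>t s. (fst s, fst (snd t) \<cdot>\<^bsub>C\<^esub> fst (snd s), snd (snd t)))\<rparr>"

definition slice_fctr :: "('o, 'm) category \<Rightarrow> ('m, 'm \<times> 'm \<times> 'm, 'o, 'm) fctr" where
  "slice_fctr C = \<lparr>OMap = Dom C, AMap = fst \<circ> snd\<rparr>"

lemma slice_simps [simp]:
  "Obj (slice_category C X) = X"
  "Ide (slice_category C X) x = (x, Ide C (Dom C x), x)"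
  "Comp (slice_category C X) t s = (fst s, fst (snd t) \<cdot>\<^bsub>C\<^esub> fst (snd s), snd (snd t))"
  "OMap (slice_fctr C) x = Dom C x" "AMap (slice_fctr C) t = fst (snd t)"
  by (simp_all add: slice_category_def slice_fctr_def)

lemma slice_Hom_iff:
  "t \<in> Hom (slice_category C X) x y \<longleftrightarrow>
     (\<exists>m. t = (x, m, y) \<and> x \<in> X \<and> y \<in> X \<and> m \<in> Hom C (Dom C x) (Dom C y) \<and> y \<cdot>\<^bsub>C\<^esub> m = x)"
  by (auto simp: slice_category_def in_Hom_iff)

context category
begin

lemma category_slice:
  assumes X: "\<And>x. x \<in> X \<Longrightarrow> x \<in> Hom C (Dom C x) g"
  shows "category (slice_category C X)"
proof
  let ?S = "slice_category C X"
  show "f \<in> Arr ?S \<Longrightarrow> Dom ?S f \<in> Obj ?S" "f \<in> Arr ?S \<Longrightarrow> Cod ?S f \<in> Obj ?S" for f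
    by (auto simp: slice_category_def)
  show "Ide ?S x \<in> Hom ?S x x" if "x \<in> Obj ?S" for x
    using that X[of x] Ide_in_Hom[OF Hom_Obj(1)[OF X[of x]]] Comp_Ide[OF X[of x]]
    by (simp add: slice_Hom_iff)
  show "t \<cdot>\<^bsub>?S\<^esub> s \<in> Hom ?S x z" if s: "s \<in> Hom ?S x y" and t: "t \<in> Hom ?S y z" for s t x y z
  proof -
    obtain m where m: "s = (x, m, y)" "x \<in> X" "y \<in> X" "m \<in> Hom C (Dom C x) (Dom C y)" "y \<cdot> m = x"
      using s by (auto simp: slice_Hom_iff)
    obtain n where n: "t = (y, n, z)" "z \<in> X" "n \<in> Hom C (Dom C y) (Dom C z)" "z \<cdot> n = y"
      using t by (auto simp: slice_Hom_iff)
    show ?thesis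
      using Comp_in_Hom[OF m(4) n(3)] Comp_assoc[OF m(4) n(3) X[OF n(2)]] m n
      by (simp add: slice_Hom_iff)
  qed
  show "s \<cdot>\<^bsub>?S\<^esub> Ide ?S x = s" "Ide ?S y \<cdot>\<^bsub>?S\<^esub> s = s" if s: "s \<in> Hom ?S x y" for s x y
    using s Comp_Ide Ide_Comp by (auto simp: slice_Hom_iff)
  show "u \<cdot>\<^bsub>?S\<^esub> t \<cdot>\<^bsub>?S\<^esub> s = u \<cdot>\<^bsub>?S\<^esub> (t \<cdot>\<^bsub>?S\<^esub> s)"
    if "s \<in> Hom ?S w x" "t \<in> Hom ?S x y" "u \<in> Hom ?S y z" for s t u w x y z
    using that Comp_assoc by (auto simp: slice_Hom_iff)
qed

lemma functor_slice:
  assumes X: "\<And>x. x \<in> X \<Longrightarrow> x \<in> Hom C (Dom C x) g"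
  shows "is_functor (slice_category C X) C (slice_fctr C)"
  by (rule is_functorI[OF category_slice[OF X] category_axioms])
     (auto simp: slice_Hom_iff intro: Hom_Obj(1)[OF X])

lemma cocone_slice:
  assumes X: "\<And>x. x \<in> X \<Longrightarrow> x \<in> Hom C (Dom C x) g" and g: "g \<in> Obj C"
  shows "is_cocone (slice_category C X) C (slice_fctr C) g id"
  by (rule is_coconeI[OF g]) (auto simp: slice_Hom_iff intro: X)

lemma small_slice:
  assumes U: "set_universe TYPE('u)" and homs: "has_small_homs TYPE('u) C"
    and X: "\<And>x. x \<in> X \<Longrightarrow> x \<in> Hom C (Dom C x) g" and small: "small TYPE('u) X"
  shows "small TYPE('u) (Arr (slice_category C X))"
proof -
  have "small TYPE('u) (SIGMA x:X. SIGMA y:X. Hom C (Dom C x) (Dom C y))"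
    using homs small Hom_Obj(1)[OF X] by (intro small_Sigma[OF U]) (auto simp: has_small_homs_def)
  moreover have "Arr (slice_category C X) \<subseteq>
      (\<lambda>(x, y, m). (x, m, y)) ` (SIGMA x:X. SIGMA y:X. Hom C (Dom C x) (Dom C y))"
    by (force simp: slice_category_def image_iff)
  ultimately show ?thesis using small_subset small_image by blast
qed

end

text \<open>A diagram in the renamed category is one in the original category after renaming back, and a
  cocone on the latter is renamed to a cocone on the former.\<close>

lemma filtered_rename:
  fixes \<kappa> :: "'u rel" and p :: "'i \<Rightarrow> 'u" and q :: "'j \<Rightarrow> 'u"
  assumes pq: "category_renaming J p q" and J: "filtered_category \<kappa> J"
    and small: "small TYPE('u) (Obj J)" "small TYPE('u) (Arr J)"
  shows "filtered \<kappa> (rename_category p q J)"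
proof -
  interpret R: category_renaming J p q by fact
  interpret filtered_category \<kappa> J by fact
  show ?thesis
    unfolding filtered_def small_category_def
  proof (intro conjI allI impI R.category_rename)
    show "small TYPE('u) (Obj R.J')" "small TYPE('u) (Arr R.J')"
      using small by (simp_all add: R.Obj_rename R.Arr_rename small_image)
    fix S :: "('u, 'u) category" and D
    assume "is_functor S R.J' D \<and> |Arr S| <o \<kappa>"
    then have D: "is_functor S R.J' D" and S: "|Arr S| <o \<kappa>" by auto
    let ?D = "fctr_comp (renaming_back p q J) D"
    have D': "is_functor S J ?D" using D R.functor_renaming_back by (rule is_functor_comp)
    then obtain x c where c: "is_cocone S J ?D x c" using diagram_cocone S by blast
    interpret S: category S using D by (rule is_functorD)
    have "is_cocone S R.J' D (p x) (q \<circ> c)"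
    proof (rule is_coconeI)
      show "p x \<in> Obj R.J'" using is_coconeD(1)[OF c] by (simp add: R.Obj_rename)
      show "(q \<circ> c) i \<in> Hom R.J' (OMap D i) (p x)" if i: "i \<in> Obj S" for i
      proof -
        have "p (OMap ?D i) = OMap D i"
          using is_functorD(3)[OF D i]
          by (simp add: fctr_comp_def renaming_back_def R.Obj_rename f_inv_into_f)
        then show ?thesis using R.in_Hom_rename[OF is_coconeD(2)[OF c i]] by simp
      qed
      show "(q \<circ> c) j \<cdot>\<^bsub>R.J'\<^esub> AMap D a = (q \<circ> c) i" if a: "a \<in> Hom S i j" for a i j
      proof -
        have j: "j \<in> Obj S" using a by (rule S.Hom_Obj)
        have "AMap D a \<in> Arr R.J'" using is_functorD(4)[OF D a] by (simp add: in_Hom_iff)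
        then have qa: "q (AMap ?D a) = AMap D a"
          by (simp add: fctr_comp_def renaming_back_def R.Arr_rename f_inv_into_f)
        have "q (c j) \<cdot>\<^bsub>R.J'\<^esub> q (AMap ?D a) = q (c j \<cdot>\<^bsub>J\<^esub> AMap ?D a)"
          using is_functorD(4)[OF D' a] is_coconeD(2)[OF c j]
          by (intro R.rename_simps) (simp_all add: in_Hom_iff)
        then show ?thesis using is_coconeD(3)[OF c a] qa by simp
      qed
    qed
    then show "\<exists>x c. is_cocone S R.J' D x c" by blast
  qed
qed


section \<open>Filtered colimits of a cofinal class of presentable morphisms\<close>

text \<open>The class \<open>P\<close> consists of morphisms with presentable ends and is cofinal among such morphisms over
  \<open>g\<close>. The initial object \<open>z\<close> serves to test the codomains: squares out of \<open>z \<rightarrow> k\<close> are arrows from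
  \<open>k\<close> to the codomain.\<close>

locale presented_arrow_over = presented_arrow \<kappa> C I G \<gamma> J H \<eta> g
  for \<kappa> :: "'u rel" and C :: "('o, 'm) category" (structure) and I G \<gamma> J H \<eta> g +
  fixes P :: "'m set" and z :: 'o
  assumes P: "p \<in> P \<Longrightarrow> p \<in> Arr C"
      "p \<in> P \<Longrightarrow> presentable \<kappa> C (Dom C p)" "p \<in> P \<Longrightarrow> presentable \<kappa> C (Cod C p)"
    and factor: "s \<in> Hom (arrow_category C) f g \<Longrightarrow> presentable \<kappa> C (Dom C f) \<Longrightarrow> presentable \<kappa> C (Cod C f) \<Longrightarrow>
      \<exists>p \<in> P. \<exists>m \<in> Hom (arrow_category C) f p. \<exists>x \<in> Hom (arrow_category C) p g.
        x \<cdot>\<^bsub>arrow_category C\<^esub> m = s"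
    and initial: "z \<in> Obj C" "y \<in> Obj C \<Longrightarrow> \<exists>!h. h \<in> Hom C z y"
begin

sublocale M: presentability_setting \<kappa> M by (rule arrow_setting)

text \<open>One factorization through \<open>P\<close> is chosen for each stage. The class \<open>P\<close> may be proper, but the set of
  the chosen squares is small.\<close>

definition refine :: "'m square \<Rightarrow> 'm square" where
  "refine s = (SOME x. sq_src x \<in> P \<and> x \<in> Hom M (sq_src x) g \<and>
     (\<exists>m \<in> Hom M (sq_src s) (sq_src x). x \<cdot>\<^bsub>M\<^esub> m = s))"

definition refined :: "'m square set" where "refined = refine ` stages"

lemma refine:
  assumes "s \<in> stages"
  shows "sq_src (refine s) \<in> P" "refine s \<in> Hom M (sq_src (refine s)) g"
    "\<exists>m \<in> Hom M (sq_src s) (sq_src (refine s)). refine s \<cdot>\<^bsub>M\<^esub> m = s"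
proof -
  obtain p m x where "p \<in> P" "m \<in> Hom M (sq_src s) p" "x \<in> Hom M p g" "x \<cdot>\<^bsub>M\<^esub> m = s"
    using factor[OF stage_presentable(1,3,4)] assms by blast
  moreover from this(3) have "sq_src x = p" by (rule square_HomD)
  ultimately have "\<exists>x. sq_src x \<in> P \<and> x \<in> Hom M (sq_src x) g \<and>
      (\<exists>m \<in> Hom M (sq_src s) (sq_src x). x \<cdot>\<^bsub>M\<^esub> m = s)" by blast
  from someI_ex[OF this, folded refine_def]
  show "sq_src (refine s) \<in> P" "refine s \<in> Hom M (sq_src (refine s)) g"
    "\<exists>m \<in> Hom M (sq_src s) (sq_src (refine s)). refine s \<cdot>\<^bsub>M\<^esub> m = s" by blast+
qed

lemma small_refined: "small TYPE('u) refined"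
  unfolding refined_def using small_stages by (rule small_image)

lemma refinedD:
  assumes "x \<in> refined"
  shows "sq_src x \<in> P" "x \<in> Hom M (Dom M x) g" "x \<in> Hom M (sq_src x) g"
  using assms refine by (auto simp: refined_def arrow_simps)

lemma graph_factors_through_refined:
  assumes V: "|V| <o \<kappa>" and E: "|E| <o \<kappa>"
    and src: "\<And>e. e \<in> E \<Longrightarrow> src e \<in> V" and tgt: "\<And>e. e \<in> E \<Longrightarrow> tgt e \<in> V"
    and pres: "\<And>v. v \<in> V \<Longrightarrow> presentable \<kappa> C (Dom C (ob v))"
      "\<And>v. v \<in> V \<Longrightarrow> presentable \<kappa> C (Cod C (ob v))"
    and ar: "\<And>e. e \<in> E \<Longrightarrow> ar e \<in> Hom M (ob (src e)) (ob (tgt e))"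
    and \<sigma>: "\<And>v. v \<in> V \<Longrightarrow> \<sigma> v \<in> Hom M (ob v) g"
    and nat: "\<And>e. e \<in> E \<Longrightarrow> \<sigma> (tgt e) \<cdot>\<^bsub>M\<^esub> ar e = \<sigma> (src e)"
  obtains x m where "x \<in> refined" "\<And>v. v \<in> V \<Longrightarrow> m v \<in> Hom M (ob v) (sq_src x)"
    "\<And>v. v \<in> V \<Longrightarrow> x \<cdot>\<^bsub>M\<^esub> m v = \<sigma> v" "\<And>e. e \<in> E \<Longrightarrow> m (tgt e) \<cdot>\<^bsub>M\<^esub> ar e = m (src e)"
proof (rule graph_factors_through_stages[OF V E src tgt pres ar \<sigma> nat])
  fix s m assume s: "s \<in> stages" and m: "\<And>v. v \<in> V \<Longrightarrow> m v \<in> Hom M (ob v) (sq_src s)"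
    and sm: "\<And>v. v \<in> V \<Longrightarrow> s \<cdot>\<^bsub>M\<^esub> m v = \<sigma> v" and m_nat: "\<And>e. e \<in> E \<Longrightarrow> m (tgt e) \<cdot>\<^bsub>M\<^esub> ar e = m (src e)"
  obtain n where n: "n \<in> Hom M (sq_src s) (sq_src (refine s))" and rn: "refine s \<cdot>\<^bsub>M\<^esub> n = s"
    using refine(3)[OF s] by blast
  show thesis
  proof (rule that[of "refine s" "\<lambda>v. n \<cdot>\<^bsub>M\<^esub> m v"])
    show "refine s \<in> refined" using s by (simp add: refined_def)
    show "n \<cdot>\<^bsub>M\<^esub> m v \<in> Hom M (ob v) (sq_src (refine s))" if "v \<in> V" for v
      using M.Comp_in_Hom[OF m[OF that] n] .
    show "refine s \<cdot>\<^bsub>M\<^esub> (n \<cdot>\<^bsub>M\<^esub> m v) = \<sigma> v" if "v \<in> V" for v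
      using M.Comp_assoc[OF m[OF that] n refine(2)[OF s]] rn sm[OF that] by simp
    show "n \<cdot>\<^bsub>M\<^esub> m (tgt e) \<cdot>\<^bsub>M\<^esub> ar e = n \<cdot>\<^bsub>M\<^esub> m (src e)" if "e \<in> E" for e
      using M.Comp_assoc[OF ar[OF that] m[OF tgt[OF that]] n] m_nat[OF that] by simp
  qed
qed

abbreviation "S \<equiv> slice_category M refined"

lemma slice_category_refined: "category S"
  by (rule M.category_slice[OF refinedD(2)])

lemma slice_functor_refined: "is_functor S M (slice_fctr M)"
  by (rule M.functor_slice[OF refinedD(2)])

lemma g_Obj: "g \<in> Obj M" using g by (simp add: arrow_simps)

text \<open>The chosen set is filtered as it stands: a diagram in the slice is in particular a graph of
  presentable morphisms over \<open>g\<close>, so it has a cocone to a chosen square, and fullness makes this a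
  cocone in the slice.\<close>

lemma filtered_slice: "filtered_category \<kappa> S"
  unfolding filtered_category_def filtered_category_axioms_def
proof (intro conjI allI impI cardinal slice_category_refined)
  fix T :: "('u, 'u) category" and D assume D: "is_functor T S D" and T: "|Arr T| <o \<kappa>"
  interpret T: category T using D by (rule is_functorD)
  have Obj: "|Obj T| <o \<kappa>"
  proof -
    have "Obj T \<subseteq> Dom T ` Arr T" using T.Ide_in_Hom by (force simp: in_Hom_iff image_iff)
    then show ?thesis using card_less_subset[OF card_less_image[OF T]] by blast
  qed
  have DO: "OMap D v \<in> refined" if "v \<in> Obj T" for v using is_functorD(3)[OF D that] by simp
  have DA: "AMap D a = (OMap D v, fst (snd (AMap D a)), OMap D w)"
      "fst (snd (AMap D a)) \<in> Hom M (sq_src (OMap D v)) (sq_src (OMap D w))"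
      "OMap D w \<cdot>\<^bsub>M\<^esub> fst (snd (AMap D a)) = OMap D v" if "a \<in> Hom T v w" for a v w
    using is_functorD(4)[OF D that] by (auto simp: slice_Hom_iff arrow_simps)
  have a: "a \<in> Hom T (Dom T a) (Cod T a)" if "a \<in> Arr T" for a using HomI[OF that] .
  obtain x m where x: "x \<in> refined" and m: "\<And>v. v \<in> Obj T \<Longrightarrow> m v \<in> Hom M (sq_src (OMap D v)) (sq_src x)"
    and xm: "\<And>v. v \<in> Obj T \<Longrightarrow> x \<cdot>\<^bsub>M\<^esub> m v = OMap D v"
    and m_nat: "\<And>e. e \<in> Arr T \<Longrightarrow> m (Cod T e) \<cdot>\<^bsub>M\<^esub> fst (snd (AMap D e)) = m (Dom T e)"
    by (rule graph_factors_through_refined[OF Obj T, where src = "Dom T" and tgt = "Cod T"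
          and ob = "\<lambda>v. sq_src (OMap D v)" and ar = "\<lambda>a. fst (snd (AMap D a))" and \<sigma> = "OMap D"])
       (use T.Dom_in_Obj T.Cod_in_Obj P(2,3)[OF refinedD(1)[OF DO]] DA(2,3)[OF a] refinedD(3)[OF DO]
        in blast)+
  have "is_cocone T S D x (\<lambda>v. (OMap D v, m v, x))"
  proof (rule is_coconeI)
    show "x \<in> Obj S" using x by simp
    show "(OMap D v, m v, x) \<in> Hom S (OMap D v) x" if "v \<in> Obj T" for v
      using x DO[OF that] m[OF that] xm[OF that] by (simp add: slice_Hom_iff arrow_simps)
    show "(OMap D w, m w, x) \<cdot>\<^bsub>S\<^esub> AMap D a = (OMap D v, m v, x)" if "a \<in> Hom T v w" for a v w
      using DA(1)[OF that] m_nat[of a] that by (simp add: in_Hom_iff) (metis fst_conv)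
  qed
  then show "\<exists>x c. is_cocone T S D x c" by blast
qed

text \<open>This treats domains and codomains at once. The hypothesis \<open>bij\<close> says that the squares out of \<open>q\<close>
  are determined by their component \<open>pr\<close>, an arbitrary arrow from \<open>k\<close> to the end \<open>en\<close> of their
  target; that is, \<open>q\<close> is the value at \<open>k\<close> of a left adjoint of \<open>en\<close>. Arrows from \<open>k\<close> are thereby
  turned into squares over \<open>g\<close>, to which the factorization of graphs applies: a single vertex shows
  that they factor, a parallel pair shows that they are identified.\<close>

lemma slice_detects:
  fixes k q pr en and Fct :: "('m square, 'm square \<times> 'm square \<times> 'm square, 'o, 'm) fctr"
  assumes q: "presentable \<kappa> C (Dom C q)" "presentable \<kappa> C (Cod C q)"
    and bij: "\<And>p. p \<in> Arr C \<Longrightarrow> bij_betw pr (Hom M q p) (Hom C k (en p))"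
    and pr_Comp: "\<And>s t. pr (t \<cdot>\<^bsub>M\<^esub> s) = pr t \<cdot> pr s"
    and Fct: "\<And>x. OMap Fct x = en (sq_src x)" "\<And>t. AMap Fct t = pr (fst (snd t))"
  shows "hom_detects S C Fct (en g) (pr \<circ> id) k"
proof (rule hom_detectsI)
  have inf: "Cinfinite \<kappa>" using cardinal by (rule small_regular_cardinalD)
  have U: "|UNIV :: bool set| <o \<kappa>" "|{} :: bool set| <o \<kappa>"
    by (rule card_less_finite[OF inf], simp)+
  fix f assume f: "f \<in> Hom C k (en g)"
  then obtain s where s: "s \<in> Hom M q g" and f_def: "f = pr s"
    using bij[OF g] by (auto simp: bij_betw_def)
  show "\<exists>x \<in> Obj S. \<exists>f' \<in> Hom C k (OMap Fct x). (pr \<circ> id) x \<cdot> f' = f"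
  proof (rule graph_factors_through_refined[OF U, where src = id and tgt = id and ob = "\<lambda>_. q"
        and ar = undefined and \<sigma> = "\<lambda>_. s"])
    fix x m assume x: "x \<in> refined" and m: "\<And>v. v \<in> (UNIV :: bool set) \<Longrightarrow> m v \<in> Hom M q (sq_src x)"
      and xm: "\<And>v. v \<in> (UNIV :: bool set) \<Longrightarrow> x \<cdot>\<^bsub>M\<^esub> m v = s"
    have "pr (m True) \<in> Hom C k (OMap Fct x)"
      using bij[OF P(1)[OF refinedD(1)[OF x]]] m[of True] by (auto simp: Fct bij_betw_def)
    moreover have "pr x \<cdot> pr (m True) = f" using pr_Comp[of x "m True"] xm[of True] f_def by simp
    ultimately show ?thesis using x by auto
  qed (use q s in simp_all)
next
  have inf: "Cinfinite \<kappa>" using cardinal by (rule small_regular_cardinalD)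
  have U: "|UNIV :: bool set| <o \<kappa>" by (rule card_less_finite[OF inf]) simp
  fix x f f' assume "x \<in> Obj S" and f: "f \<in> Hom C k (OMap Fct x)" "f' \<in> Hom C k (OMap Fct x)"
    and eq: "(pr \<circ> id) x \<cdot> f = (pr \<circ> id) x \<cdot> f'"
  then have x: "x \<in> refined" by simp
  note x' = refinedD(3)[OF x] and Px = refinedD(1)[OF x]
  obtain s s' where s: "s \<in> Hom M q (sq_src x)" "f = pr s" and s': "s' \<in> Hom M q (sq_src x)" "f' = pr s'"
    using bij_betw_imp_surj_on[OF bij[OF P(1)[OF Px]]] f unfolding Fct by blast
  have xs: "x \<cdot>\<^bsub>M\<^esub> s \<in> Hom M q g" "x \<cdot>\<^bsub>M\<^esub> s' \<in> Hom M q g"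
    using M.Comp_in_Hom[OF s(1) x'] M.Comp_in_Hom[OF s'(1) x'] .
  have "pr (x \<cdot>\<^bsub>M\<^esub> s) = pr (x \<cdot>\<^bsub>M\<^esub> s')" using eq s(2) s'(2) pr_Comp by simp
  then have xss': "x \<cdot>\<^bsub>M\<^esub> s = x \<cdot>\<^bsub>M\<^esub> s'"
    using bij[OF g] xs by (auto simp: bij_betw_def inj_on_eq_iff)
  \<comment> \<open>The two squares from \<open>q\<close> form a parallel pair of morphisms over \<open>g\<close>.\<close>
  show "\<exists>y. \<exists>a \<in> Hom S x y. AMap Fct a \<cdot> f = AMap Fct a \<cdot> f'"
  proof (rule graph_factors_through_refined[OF U U, where src = "\<lambda>_. True" and tgt = "\<lambda>_. False"
        and ob = "\<lambda>b. if b then q else sq_src x" and ar = "\<lambda>e. if e then s else s'"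
        and \<sigma> = "\<lambda>b. if b then x \<cdot>\<^bsub>M\<^esub> s else x"])
    fix y m assume y: "y \<in> refined"
      and m: "\<And>b. b \<in> (UNIV :: bool set) \<Longrightarrow> m b \<in> Hom M (if b then q else sq_src x) (sq_src y)"
      and ym: "\<And>b. b \<in> (UNIV :: bool set) \<Longrightarrow> y \<cdot>\<^bsub>M\<^esub> m b = (if b then x \<cdot>\<^bsub>M\<^esub> s else x)"
      and nat: "\<And>e. e \<in> (UNIV :: bool set) \<Longrightarrow> m False \<cdot>\<^bsub>M\<^esub> (if e then s else s') = m True"
    have "(x, m False, y) \<in> Hom S x y"
      using x y m[of False] ym[of False] by (simp add: slice_Hom_iff arrow_simps)
    moreover have "pr (m False) \<cdot> f = pr (m False) \<cdot> f'"
      using nat[of True] nat[of False] pr_Comp s(2) s'(2) by (metis (full_types) UNIV_I)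
    ultimately show ?thesis by (intro exI[of _ y] bexI[of _ "(x, m False, y)"]) (simp_all add: Fct)
  qed (use q s s' x' xs xss' P(2,3)[OF Px] in auto)
qed

text \<open>Identities are the values of the left adjoint of the domain functor.\<close>

lemma bij_top:
  assumes k: "k \<in> Obj C" and p: "p \<in> Arr C"
  shows "bij_betw sq_top (Hom M (Ide C k) p) (Hom C k (Dom C p))"
proof -
  have Ik: "Ide C k \<in> Arr C" "Dom C (Ide C k) = k" "Cod C (Ide C k) = k"
    using Ide_in_Hom[OF k] by (auto simp: in_Hom_iff)
  show ?thesis
  proof (rule bij_betw_byWitness[where f' = "\<lambda>u. Square (Ide C k) u (p \<cdot> u) p"])
    show "\<forall>s \<in> Hom M (Ide C k) p. Square (Ide C k) (sq_top s) (p \<cdot> sq_top s) p = s"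
    proof
      fix s assume s: "s \<in> Hom M (Ide C k) p"
      note s' = square_HomD[OF s]
      have "sq_bot s \<cdot> Ide C k = sq_bot s" using Comp_Ide[of "sq_bot s" k] s'(6) Ik by simp
      then show "Square (Ide C k) (sq_top s) (p \<cdot> sq_top s) p = s"
        using s' by (intro square.expand) simp
    qed
    show "(\<lambda>u. Square (Ide C k) u (p \<cdot> u) p) ` Hom C k (Dom C p) \<subseteq> Hom M (Ide C k) p"
    proof (rule image_subsetI)
      fix u assume u: "u \<in> Hom C k (Dom C p)"
      have pu: "p \<cdot> u \<in> Hom C k (Cod C p)" using Comp_in_Hom[OF u HomI[OF p]] .
      show "Square (Ide C k) u (p \<cdot> u) p \<in> Hom M (Ide C k) p"
        using u pu Ik p Comp_Ide[OF pu] by (simp add: square_in_Hom_iff)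
    qed
    show "sq_top ` Hom M (Ide C k) p \<subseteq> Hom C k (Dom C p)"
      using square_HomD(5)[of _ C "Ide C k" p] Ik by auto
  qed simp
qed

text \<open>Morphisms out of the initial object are the values of the left adjoint of the codomain
  functor.\<close>

lemma bij_bot:
  assumes h: "h \<in> Hom C z k" and p: "p \<in> Arr C"
  shows "bij_betw sq_bot (Hom M h p) (Hom C k (Cod C p))"
proof -
  have h': "h \<in> Arr C" "Dom C h = z" "Cod C h = k" using h by (auto simp: in_Hom_iff)
  obtain u where u: "u \<in> Hom C z (Dom C p)" using initial(2)[OF Dom_in_Obj[OF p]] by blast
  have uniq: "a = b" if "a \<in> Hom C z y" "b \<in> Hom C z y" for a b y
    using initial(2)[OF Hom_Obj(2)[OF that(1)]] that by blast
  show ?thesis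
  proof (rule bij_betw_byWitness[where f' = "\<lambda>v. Square h u v p"])
    show "\<forall>s \<in> Hom M h p. Square h u (sq_bot s) p = s"
    proof
      fix s assume s: "s \<in> Hom M h p"
      note s' = square_HomD[OF s]
      have "sq_top s = u" using uniq[of "sq_top s"] s'(5) h' u by simp
      then show "Square h u (sq_bot s) p = s" using s' by (intro square.expand) simp
    qed
    show "(\<lambda>v. Square h u v p) ` Hom C k (Cod C p) \<subseteq> Hom M h p"
    proof (rule image_subsetI)
      fix v assume v: "v \<in> Hom C k (Cod C p)"
      have "p \<cdot> u = v \<cdot> h" using uniq[OF Comp_in_Hom[OF u HomI[OF p]] Comp_in_Hom[OF h v]] .
      then show "Square h u v p \<in> Hom M h p"
        using u v h' p by (simp add: square_in_Hom_iff)
    qed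
    show "sq_bot ` Hom M h p \<subseteq> Hom C k (Cod C p)"
      using square_HomD(6)[of _ C h p] h' by auto
  qed simp
qed

text \<open>Colimits of morphisms are pointwise, so it is enough to recognize the domain and the codomain of
  \<open>g\<close> as colimits. They are colimits of presentable objects by assumption, and presentable objects
  detect the slice diagram.\<close>

lemma colimit_slice: "is_colimit S M (slice_fctr M) g id"
proof -
  have cocone: "is_cocone S M (slice_fctr M) g id" by (rule M.cocone_slice[OF refinedD(2) g_Obj])
  note U = slice_functor_refined
  interpret S: filtered_category \<kappa> S by (rule filtered_slice)
  note comps = functor_dom_cod[OF U] and ccomps = cocone_dom_cod[OF cocone]
  interpret D: filtered_cocone \<kappa> S C "dom_fctr C (slice_fctr M)" "Dom C g" "sq_top \<circ> id"
    using filtered_slice cocone_of_functor.intro[OF comps(1) ccomps(1)] by (rule filtered_cocone.intro)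
  interpret E: filtered_cocone \<kappa> S C "cod_fctr C (slice_fctr M)" "Cod C g" "sq_bot \<circ> id"
    using filtered_slice cocone_of_functor.intro[OF comps(2) ccomps(2)] by (rule filtered_cocone.intro)
  have dom: "hom_detects S C (dom_fctr C (slice_fctr M)) (Dom C g) (sq_top \<circ> id) k"
    if k: "presentable \<kappa> C k" for k
  proof (rule slice_detects[where q = "Ide C k" and en = "Dom C"])
    have kO: "k \<in> Obj C" using k presentable_iff by blast
    show "presentable \<kappa> C (Dom C (Ide C k))" "presentable \<kappa> C (Cod C (Ide C k))"
      using k Ide_in_Hom[OF kO] by (auto simp: in_Hom_iff)
    show "bij_betw sq_top (Hom M (Ide C k) p) (Hom C k (Dom C p))" if "p \<in> Arr C" for p
      using bij_top[OF kO that] .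
  qed (simp_all add: sq_Comp arrow_simps)
  have cod: "hom_detects S C (cod_fctr C (slice_fctr M)) (Cod C g) (sq_bot \<circ> id) k"
    if k: "presentable \<kappa> C k" for k
  proof -
    have kO: "k \<in> Obj C" using k presentable_iff by blast
    obtain h where h: "h \<in> Hom C z k" using initial(2)[OF kO] by blast
    show ?thesis
    proof (rule slice_detects[where q = h and en = "Cod C"])
      show "presentable \<kappa> C (Dom C h)" "presentable \<kappa> C (Cod C h)"
        using k h presentable_initial[OF initial] by (auto simp: in_Hom_iff)
      show "bij_betw sq_bot (Hom M h p) (Hom C k (Cod C p))" if "p \<in> Arr C" for p
        using bij_bot[OF h that] .
    qed (simp_all add: sq_Comp arrow_simps)
  qed
  have ends: "presentable \<kappa> C (Dom C (sq_src x))" "presentable \<kappa> C (Cod C (sq_src x))"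
    if "x \<in> refined" for x using P(2,3)[OF refinedD(1)[OF that]] .
  have "is_colimit S C (dom_fctr C (slice_fctr M)) (Dom C g) (sq_top \<circ> id)"
  proof (rule D.colimit_recognition[OF I(2,3) dom[OF I(4)]])
    fix x assume "x \<in> Obj S"
    then have x: "x \<in> refined" by simp
    show "hom_detects S C (dom_fctr C (slice_fctr M)) (Dom C g) (sq_top \<circ> id)
        (OMap (dom_fctr C (slice_fctr M)) x)"
      using dom[OF ends(1)[OF x]] by (simp add: arrow_simps)
    show "\<exists>i \<in> Obj I. \<exists>f \<in> Hom C (OMap (dom_fctr C (slice_fctr M)) x) (OMap G i).
        \<gamma> i \<cdot> f = (sq_top \<circ> id) x"
      using hom_detectsD(1)[OF presentable_detects[OF ends(1)[OF x] I(1-3)]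
          square_HomD(5)[OF refinedD(3)[OF x]]] by (simp add: arrow_simps)
  qed
  moreover have "is_colimit S C (cod_fctr C (slice_fctr M)) (Cod C g) (sq_bot \<circ> id)"
  proof (rule E.colimit_recognition[OF J(2,3) cod[OF J(4)]])
    fix x assume "x \<in> Obj S"
    then have x: "x \<in> refined" by simp
    show "hom_detects S C (cod_fctr C (slice_fctr M)) (Cod C g) (sq_bot \<circ> id)
        (OMap (cod_fctr C (slice_fctr M)) x)"
      using cod[OF ends(2)[OF x]] by (simp add: arrow_simps)
    show "\<exists>j \<in> Obj J. \<exists>f \<in> Hom C (OMap (cod_fctr C (slice_fctr M)) x) (OMap H j).
        \<eta> j \<cdot> f = (sq_bot \<circ> id) x"
      using hom_detectsD(1)[OF presentable_detects[OF ends(2)[OF x] J(1-3)]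
          square_HomD(6)[OF refinedD(3)[OF x]]] by (simp add: arrow_simps)
  qed
  ultimately show ?thesis using colimit_of_pointwise[OF U cocone] by blast
qed

lemma filtered_colimit_of_refining_class:
  obtains T :: "('u, 'u) category" and D c where "filtered \<kappa> T" "is_functor T M D"
    "\<And>i. i \<in> Obj T \<Longrightarrow> OMap D i \<in> P" "is_colimit T M D g c"
proof -
  have small: "small TYPE('u) (Obj S)" "small TYPE('u) (Arr S)"
  proof -
    show "small TYPE('u) (Obj S)" using small_refined by simp
    show "small TYPE('u) (Arr S)"
      by (rule M.small_slice[OF universe M.small_homs refinedD(2) small_refined])
  qed
  obtain p :: "_ \<Rightarrow> 'u" and q :: "_ \<Rightarrow> 'u" where pq: "category_renaming S p q"
    using obtain_small_renaming[OF slice_category_refined] small[unfolded small_def, THEN ordLess_imp_ordLeq]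
    by blast
  interpret R: category_renaming S p q by (rule pq)
  show thesis
  proof (rule that)
    show "filtered \<kappa> R.J'" using filtered_rename[OF pq filtered_slice small] .
    show "is_functor R.J' M (fctr_comp (slice_fctr M) (renaming_back p q S))"
      using R.functor_renaming_back slice_functor_refined by (rule is_functor_comp)
    show "is_colimit R.J' M (fctr_comp (slice_fctr M) (renaming_back p q S)) g (id \<circ> inv_into (Obj S) p)"
      using R.colimit_against_renaming[OF colimit_slice] .
    fix i assume "i \<in> Obj R.J'"
    then have "inv_into (Obj S) p i \<in> refined"
      by (simp add: R.Obj_rename inv_into_into)
    then show "OMap (fctr_comp (slice_fctr M) (renaming_back p q S)) i \<in> P"
      using refinedD(1) by (simp add: fctr_comp_def renaming_back_def arrow_simps)
  qed
qed

end


section \<open>Lifting properties\<close>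

lemma liftsD:
  assumes "lifts C f g" "u \<in> Hom C (Dom C f) (Dom C g)" "v \<in> Hom C (Cod C f) (Cod C g)"
    "g \<cdot>\<^bsub>C\<^esub> u = v \<cdot>\<^bsub>C\<^esub> f"
  obtains d where "d \<in> Hom C (Cod C f) (Dom C g)" "d \<cdot>\<^bsub>C\<^esub> f = u" "g \<cdot>\<^bsub>C\<^esub> d = v"
  using assms unfolding lifts_def by blast

lemma liftsI:
  assumes "\<And>u v. u \<in> Hom C (Dom C f) (Dom C g) \<Longrightarrow> v \<in> Hom C (Cod C f) (Cod C g) \<Longrightarrow>
    g \<cdot>\<^bsub>C\<^esub> u = v \<cdot>\<^bsub>C\<^esub> f \<Longrightarrow>
    \<exists>d \<in> Hom C (Cod C f) (Dom C g). d \<cdot>\<^bsub>C\<^esub> f = u \<and> g \<cdot>\<^bsub>C\<^esub> d = v"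
  shows "lifts C f g"
  using assms unfolding lifts_def by blast

lemma order_category_simps:
  "Obj (order_category r) = Field r"
  "(i, j) \<in> r \<Longrightarrow> (i, j) \<in> Hom (order_category r) i j"
  "a \<in> Hom (order_category r) i j \<longleftrightarrow> a = (i, j) \<and> (i, j) \<in> r"
  "Ide (order_category r) i = (i, i)"
  "(j', k) \<cdot>\<^bsub>order_category r\<^esub> (i, j) = (i, k)"
  by (auto simp: order_category_def in_Hom_iff)

lemma category_order:
  assumes "Refl r" "trans r"
  shows "category (order_category r)"
proof
  show "f \<in> Arr (order_category r) \<Longrightarrow> Dom (order_category r) f \<in> Obj (order_category r)"
    "f \<in> Arr (order_category r) \<Longrightarrow> Cod (order_category r) f \<in> Obj (order_category r)" for f
    by (cases f; auto simp: order_category_def intro: FieldI1 FieldI2)+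
  show "f \<in> Hom (order_category r) x y \<Longrightarrow> g \<in> Hom (order_category r) y z \<Longrightarrow>
      g \<cdot>\<^bsub>order_category r\<^esub> f \<in> Hom (order_category r) x z" for f g x y z
    using transD[OF assms(2)] by (auto simp: order_category_simps)
qed (use assms(1) in \<open>auto simp: order_category_simps refl_on_def\<close>)

lemma Field_Restr_Refl: "Refl r \<Longrightarrow> A \<subseteq> Field r \<Longrightarrow> Field (Restr r A) = A"
  by (auto simp: Field_def refl_on_def)

text \<open>Smoothness of a transfinite chain speaks of colimits over initial segments; for uniqueness of maps
  out of such a colimit, the restriction of the chain to the segment has to be a functor.\<close>

lemma functor_Restr:
  assumes F: "is_functor (order_category r) C F" and r: "Refl r" "trans r" and A: "A \<subseteq> Field r"
  shows "is_functor (order_category (Restr r A)) C F"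
proof (rule is_functorI)
  have Field: "Field (Restr r A) = A" using Field_Restr_Refl[OF r(1) A] .
  show "category (order_category (Restr r A))"
    using r by (intro category_order)
      (auto simp: Field refl_on_def trans_Restr dest: subsetD[OF A])
  show "category C" using F by (rule is_functorD)
  show "OMap F i \<in> Obj C" "AMap F (Ide (order_category (Restr r A)) i) = Ide C (OMap F i)"
    if "i \<in> Obj (order_category (Restr r A))" for i
    using that is_functorD(3,5)[OF F, of i] A by (auto simp: order_category_simps Field)
  show "AMap F a \<in> Hom C (OMap F i) (OMap F j)"
    if "a \<in> Hom (order_category (Restr r A)) i j" for a i j
    using that is_functorD(4)[OF F, of a i j] by (simp add: order_category_simps)
  show "AMap F (b \<cdot>\<^bsub>order_category (Restr r A)\<^esub> a) = AMap F b \<cdot>\<^bsub>C\<^esub> AMap F a"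
    if "a \<in> Hom (order_category (Restr r A)) i j" "b \<in> Hom (order_category (Restr r A)) j k" for a b i j k
    using that is_functorD(6)[OF F, of a i j b k] by (auto simp: order_category_simps)
qed

context category
begin

text \<open>A diagonal for the composite is built along the chain: at a successor by a lift of the current
  diagonal, at a limit by the universal property of the colimit. In both cases all earlier
  diagonals are restrictions of the new one, which is what the recursion keeps.\<close>

lemma lifts_transfinite_composition:
  assumes r: "Well_order r" and F: "is_functor (order_category r) C F"
    and succ: "\<And>i j. is_successor r i j \<Longrightarrow> lifts C (AMap F (i, j)) g"
    and lim: "\<And>j. is_limit_element r j \<Longrightarrow>
      is_colimit (order_category (Restr r (underS r j))) C F (OMap F j) (\<lambda>i. AMap F (i, j))"
    and bt: "b \<in> Field r" "t \<in> Field r" "\<And>i. i \<in> Field r \<Longrightarrow> (b, i) \<in> r \<and> (i, t) \<in> r"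
    and g: "g \<in> Arr C"
  shows "lifts C (AMap F (b, t)) g"
proof (rule liftsI)
  have refl: "Refl r" and trans: "trans r" and antisym: "antisym r" and wf: "wf (r - Id)"
    using r by (auto simp: order_on_defs)
  have F_Hom: "AMap F (i, j) \<in> Hom C (OMap F i) (OMap F j)" if "(i, j) \<in> r" for i j
    using is_functorD(4)[OF F order_category_simps(2)[OF that]] .
  have F_Comp: "AMap F (i, k) = AMap F (j, k) \<cdot> AMap F (i, j)" if "(i, j) \<in> r" "(j, k) \<in> r" for i j k
    using is_functorD(6)[OF F order_category_simps(2)[OF that(1)] order_category_simps(2)[OF that(2)]]
    by (simp add: order_category_simps)
  have F_Ide: "AMap F (i, i) = Ide C (OMap F i)" if "i \<in> Field r" for i
    using is_functorD(5)[OF F, of i] that by (simp add: order_category_simps)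
  have g': "g \<in> Hom C (Dom C g) (Cod C g)" using g by (rule HomI)
  have to_t: "(i, t) \<in> r" if "i \<in> Field r" for i using bt(3) that by blast
  have ends: "Dom C (AMap F (i, j)) = OMap F i" "Cod C (AMap F (i, j)) = OMap F j" if "(i, j) \<in> r" for i j
    using F_Hom[OF that] by (auto simp: in_Hom_iff)
  fix u v assume "u \<in> Hom C (Dom C (AMap F (b, t))) (Dom C g)"
    and "v \<in> Hom C (Cod C (AMap F (b, t))) (Cod C g)" and comm: "g \<cdot> u = v \<cdot> AMap F (b, t)"
  then have u: "u \<in> Hom C (OMap F b) (Dom C g)" and v: "v \<in> Hom C (OMap F t) (Cod C g)"
    using ends[OF to_t[OF bt(1)]] by auto
  \<comment> \<open>In \<open>P f x d\<close>, the arrow \<open>d\<close> is an admissible diagonal at \<open>x\<close>, given diagonals \<open>f\<close> below \<open>x\<close>.\<close>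
  define P where "P f x d \<longleftrightarrow> (x \<in> Field r \<longrightarrow> d \<in> Hom C (OMap F x) (Dom C g) \<and>
      g \<cdot> d = v \<cdot> AMap F (x, t) \<and> (x = b \<longrightarrow> d = u) \<and> (\<forall>i \<in> underS r x. d \<cdot> AMap F (i, x) = f i))"
    for f x d
  have "\<exists>f. \<forall>x. P f x (f x)"
  proof (rule dependent_wf_choice[OF wf])
    show "P f x d = P f' x d" if "\<And>z. (z, x) \<in> r - Id \<Longrightarrow> f z = f' z" for f f' x d
      using that by (auto simp: P_def underS_def)
  next
    fix x f assume IH: "\<And>y. (y, x) \<in> r - Id \<Longrightarrow> P f y (f y)"
    show "\<exists>d. P f x d"
    proof (cases "x \<in> Field r")
      case x: True
      have under: "P f i (f i)" "i \<in> Field r" "(i, x) \<in> r" if "i \<in> underS r x" for i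
        using that IH by (auto simp: underS_def intro: FieldI1)
      have f: "f i \<in> Hom C (OMap F i) (Dom C g)" "g \<cdot> f i = v \<cdot> AMap F (i, t)" if "i \<in> underS r x" for i
        using under[OF that] by (auto simp: P_def)
      have coh: "f j \<cdot> AMap F (i, j) = f i" if "i \<in> underS r x" "j \<in> underS r x" "(i, j) \<in> r" for i j
      proof (cases "i = j")
        case True
        then show ?thesis using F_Ide[OF under(2)[OF that(1)]] Comp_Ide[OF f(1)[OF that(1)]] by simp
      next
        case False
        then show ?thesis using under(1,2)[OF that(2)] that(3) by (auto simp: P_def underS_def)
      qed
      have vx: "v \<cdot> AMap F (x, t) \<in> Hom C (OMap F x) (Cod C g)"
        using Comp_in_Hom[OF F_Hom[OF to_t[OF x]] v] .
      have vi: "v \<cdot> AMap F (x, t) \<cdot> AMap F (i, x) = v \<cdot> AMap F (i, t)" if "(i, x) \<in> r" for i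
        using Comp_assoc[OF F_Hom[OF that] F_Hom[OF to_t[OF x]] v] F_Comp[OF that to_t[OF x]] by simp
      consider "x = b" | i where "x \<noteq> b" "is_successor r i x" | "x \<noteq> b" "is_limit_element r x"
      proof -
        have "b \<in> underS r x" if "x \<noteq> b" using that bt(3)[OF x] by (auto simp: underS_def)
        then show thesis using that x by (auto simp: is_limit_element_def)
      qed
      then show ?thesis
      proof cases
        case 1
        have "underS r b = {}" using bt(3) antisym by (auto simp: underS_def dest: antisymD intro: FieldI1)
        then have "P f x u" using 1 u comm by (auto simp: P_def)
        then show ?thesis by blast
      next
        case (2 i)
        then have i: "underS r x = under r i" "i \<in> Field r" by (auto simp: is_successor_def)
        then have ix: "i \<in> underS r x" using refl by (auto simp: under_def refl_on_def)
        note ixr = under(3)[OF ix]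
        obtain d where d: "d \<in> Hom C (OMap F x) (Dom C g)" "d \<cdot> AMap F (i, x) = f i"
          "g \<cdot> d = v \<cdot> AMap F (x, t)"
          using liftsD[OF succ[OF 2(2)], of "f i" "v \<cdot> AMap F (x, t)"]
            f[OF ix] vx vi[OF ixr] by (auto simp: ends[OF ixr])
        have "d \<cdot> AMap F (j, x) = f j" if j: "j \<in> underS r x" for j
        proof -
          have ji: "(j, i) \<in> r" using j i by (auto simp: under_def)
          show ?thesis
            using Comp_assoc[OF F_Hom[OF ji] F_Hom[OF ixr] d(1)] F_Comp[OF ji ixr] d(2) coh[OF j ix ji]
            by simp
        qed
        then have "P f x d" using d 2(1) by (auto simp: P_def)
        then show ?thesis by blast
      next
        case 3
        let ?r = "Restr r (underS r x)"
        have sub: "underS r x \<subseteq> Field r" using under(2) by blast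
        have Field: "Field ?r = underS r x" using Field_Restr_Refl[OF refl sub] .
        note col = lim[OF 3(2)] and FR = functor_Restr[OF F refl trans sub]
        have "is_cocone (order_category ?r) C F (Dom C g) f"
          using f(1) coh Hom_Obj(1)[OF g']
          by (intro is_coconeI) (auto simp: order_category_simps Field)
        then obtain d where d: "d \<in> Hom C (OMap F x) (Dom C g)"
          and df: "\<And>i. i \<in> underS r x \<Longrightarrow> d \<cdot> AMap F (i, x) = f i"
          using is_colimitD(2)[OF col, of "Dom C g" f] by (auto simp: order_category_simps Field)
        have "g \<cdot> d = v \<cdot> AMap F (x, t)"
        proof (rule colimit_eqI[OF FR col Comp_in_Hom[OF d g'] vx])
          fix i assume "i \<in> Obj (order_category ?r)"
          then have i: "i \<in> underS r x" by (simp add: order_category_simps Field)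
          show "g \<cdot> d \<cdot> AMap F (i, x) = v \<cdot> AMap F (x, t) \<cdot> AMap F (i, x)"
            using Comp_assoc[OF F_Hom[OF under(3)[OF i]] d g'] df[OF i] f(2)[OF i] vi[OF under(3)[OF i]]
            by simp
        qed
        then have "P f x d" using d df 3(1) by (auto simp: P_def)
        then show ?thesis by blast
      qed
    qed (simp add: P_def)
  qed
  then obtain f where f: "\<And>x. P f x (f x)" by blast
  have ft: "f t \<in> Hom C (OMap F t) (Dom C g)" "g \<cdot> f t = v \<cdot> AMap F (t, t)"
    and fb: "f b = u"
    using f[of t] f[of b] bt(1,2) by (auto simp: P_def)
  have "f t \<cdot> AMap F (b, t) = u"
  proof (cases "b = t")
    case True
    then show ?thesis using F_Ide[OF bt(1)] Comp_Ide[OF ft(1)] fb by simp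
  next
    case False
    then have "b \<in> underS r t" using to_t[OF bt(1)] by (auto simp: underS_def)
    then show ?thesis using f[of t] bt(2) fb by (auto simp: P_def)
  qed
  moreover have "g \<cdot> f t = v" using ft(2) F_Ide[OF bt(2)] Comp_Ide[OF v] by simp
  ultimately show "\<exists>d \<in> Hom C (Cod C (AMap F (b, t))) (Dom C g). d \<cdot> AMap F (b, t) = u \<and> g \<cdot> d = v"
    using ft(1) ends[OF to_t[OF bt(1)]] by auto
qed

lemma lifts_iso:
  assumes f: "f \<in> isos C" and g: "g \<in> Arr C"
  shows "lifts C f g"
proof (rule liftsI)
  obtain k where k: "k \<in> Hom C (Cod C f) (Dom C f)" and kf: "k \<cdot> f = Ide C (Dom C f)"
    and fk: "f \<cdot> k = Ide C (Cod C f)" and "f \<in> Arr C"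
    using f unfolding isos_def by blast
  then have f': "f \<in> Hom C (Dom C f) (Cod C f)" by (intro HomI)
  fix u v assume u: "u \<in> Hom C (Dom C f) (Dom C g)" and v: "v \<in> Hom C (Cod C f) (Cod C g)"
    and eq: "g \<cdot> u = v \<cdot> f"
  show "\<exists>d \<in> Hom C (Cod C f) (Dom C g). d \<cdot> f = u \<and> g \<cdot> d = v"
    using Comp_in_Hom[OF k u] Comp_assoc[OF f' k u] Comp_assoc[OF k u HomI[OF g]] Comp_assoc[OF k f' v]
      kf fk eq Comp_Ide[OF u] Comp_Ide[OF v]
    by (intro bexI[of _ "u \<cdot> k"]) auto
qed

lemma lifts_pushout:
  assumes po: "is_pushout C f u f' v" and f: "lifts C f g" and g: "g \<in> Arr C"
  shows "lifts C f' g"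
proof (rule liftsI)
  have arr: "f \<in> Arr C" "u \<in> Arr C" "f' \<in> Arr C" "v \<in> Arr C"
    and ends: "Dom C f = Dom C u" "Cod C u = Dom C f'" "Cod C f = Dom C v" "Cod C v = Cod C f'"
    and sq: "v \<cdot> f = f' \<cdot> u"
    and univ: "\<And>z a b. a \<in> Hom C (Cod C f) z \<Longrightarrow> b \<in> Hom C (Cod C u) z \<Longrightarrow> a \<cdot> f = b \<cdot> u \<Longrightarrow>
      \<exists>!h. h \<in> Hom C (Cod C f') z \<and> h \<cdot> v = a \<and> h \<cdot> f' = b"
    using po unfolding is_pushout_def by blast+
  have f_Hom: "f \<in> Hom C (Dom C f) (Cod C f)" and u_Hom: "u \<in> Hom C (Dom C f) (Dom C f')"
    and f'_Hom: "f' \<in> Hom C (Dom C f') (Cod C f')" and v_Hom: "v \<in> Hom C (Cod C f) (Cod C f')"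
    and g_Hom: "g \<in> Hom C (Dom C g) (Cod C g)"
    using arr ends g by (auto simp: in_Hom_iff)
  fix a b assume a: "a \<in> Hom C (Dom C f') (Dom C g)" and b: "b \<in> Hom C (Cod C f') (Cod C g)"
    and eq: "g \<cdot> a = b \<cdot> f'"
  have "g \<cdot> (a \<cdot> u) = b \<cdot> v \<cdot> f"
    using Comp_assoc[OF u_Hom a g_Hom] Comp_assoc[OF u_Hom f'_Hom b] Comp_assoc[OF f_Hom v_Hom b] eq sq
    by simp
  then obtain d where d: "d \<in> Hom C (Cod C f) (Dom C g)" "d \<cdot> f = a \<cdot> u" "g \<cdot> d = b \<cdot> v"
    using liftsD[OF f Comp_in_Hom[OF u_Hom a] Comp_in_Hom[OF v_Hom b]] by blast
  obtain h where h: "h \<in> Hom C (Cod C f') (Dom C g)" "h \<cdot> v = d" "h \<cdot> f' = a"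
    using univ[OF d(1) _ d(2)] a ends(2) by auto
  have "\<exists>!k. k \<in> Hom C (Cod C f') (Cod C g) \<and> k \<cdot> v = b \<cdot> v \<and> k \<cdot> f' = b \<cdot> f'"
    using Comp_in_Hom[OF v_Hom b] Comp_in_Hom[OF f'_Hom b] ends(2)
      Comp_assoc[OF f_Hom v_Hom b] Comp_assoc[OF u_Hom f'_Hom b] sq
    by (intro univ) simp_all
  moreover have "g \<cdot> h \<in> Hom C (Cod C f') (Cod C g)" "g \<cdot> h \<cdot> v = b \<cdot> v" "g \<cdot> h \<cdot> f' = b \<cdot> f'"
    using Comp_in_Hom[OF h(1) g_Hom] Comp_assoc[OF v_Hom h(1) g_Hom] Comp_assoc[OF f'_Hom h(1) g_Hom]
      h d(3) eq by auto
  ultimately have "g \<cdot> h = b" using b by blast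
  then show "\<exists>d \<in> Hom C (Cod C f') (Dom C g). d \<cdot> f' = a \<and> g \<cdot> d = b" using h by blast
qed

lemma lifts_retract:
  assumes ret: "is_retract (arrow_category C) f h" and h: "lifts C h g" and g: "g \<in> Arr C"
  shows "lifts C f g"
proof (rule liftsI)
  obtain s p where s: "s \<in> Hom (arrow_category C) f h" and p: "p \<in> Hom (arrow_category C) h f"
    and ps: "p \<cdot>\<^bsub>arrow_category C\<^esub> s = Ide (arrow_category C) f"
    using ret unfolding is_retract_def by blast
  note s' = square_HomD[OF s] and p' = square_HomD[OF p]
  have f_Hom: "f \<in> Hom C (Dom C f) (Cod C f)" and h_Hom: "h \<in> Hom C (Dom C h) (Cod C h)"
    and g_Hom: "g \<in> Hom C (Dom C g) (Cod C g)"
    using HomI[OF s'(1)] HomI[OF s'(2)] HomI[OF g] .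
  have top: "sq_top p \<cdot> sq_top s = Ide C (Dom C f)" and bot: "sq_bot p \<cdot> sq_bot s = Ide C (Cod C f)"
    using arg_cong[OF ps, of sq_top] arg_cong[OF ps, of sq_bot] by (simp_all add: sq_Comp arrow_simps)
  fix u v assume u: "u \<in> Hom C (Dom C f) (Dom C g)" and v: "v \<in> Hom C (Cod C f) (Cod C g)"
    and eq: "g \<cdot> u = v \<cdot> f"
  have "g \<cdot> (u \<cdot> sq_top p) = v \<cdot> sq_bot p \<cdot> h"
    using Comp_assoc[OF p'(5) u g_Hom] Comp_assoc[OF p'(5) f_Hom v] Comp_assoc[OF h_Hom p'(6) v]
      eq p'(7) by simp
  then obtain d where d: "d \<in> Hom C (Cod C h) (Dom C g)" "d \<cdot> h = u \<cdot> sq_top p" "g \<cdot> d = v \<cdot> sq_bot p"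
    using liftsD[OF h Comp_in_Hom[OF p'(5) u] Comp_in_Hom[OF p'(6) v]] by blast
  have "d \<cdot> sq_bot s \<cdot> f = u \<cdot> (sq_top p \<cdot> sq_top s)"
    using Comp_assoc[OF f_Hom s'(6) d(1)] Comp_assoc[OF s'(5) h_Hom d(1)] Comp_assoc[OF s'(5) p'(5) u]
      s'(7) d(2) by simp
  moreover have "g \<cdot> (d \<cdot> sq_bot s) = v \<cdot> (sq_bot p \<cdot> sq_bot s)"
    using Comp_assoc[OF s'(6) d(1) g_Hom] Comp_assoc[OF s'(6) p'(6) v] d(3) by simp
  ultimately show "\<exists>d \<in> Hom C (Cod C f) (Dom C g). d \<cdot> f = u \<and> g \<cdot> d = v"
    using Comp_in_Hom[OF s'(6) d(1)] top bot Comp_Ide[OF u] Comp_Ide[OF v] by auto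
qed

text \<open>The left lifting property against \<open>N\<close> is one of the closed classes whose intersection is the
  cofibrant closure.\<close>

lemma cof_subset_box_left:
  fixes U :: "'u itself"
  assumes N: "N \<subseteq> Arr C" and S: "S \<subseteq> box_left C N"
  shows "cof U C S \<subseteq> box_left C N"
  unfolding cof_def
proof (rule Inter_lower, intro CollectI conjI allI impI ballI)
  show "box_left C N \<subseteq> Arr C" by (auto simp: box_left_def)
  show "isos C \<subseteq> box_left C N"
  proof
    fix f assume f: "f \<in> isos C"
    then have "f \<in> Arr C" by (simp add: isos_def)
    then show "f \<in> box_left C N" using lifts_iso[OF f] N by (auto simp: box_left_def)
  qed
  show "h \<in> box_left C N" if "transfinite_composition U C (box_left C N) h" for h
    using that[unfolded transfinite_composition_def]
  proof (elim exE conjE)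
    fix r :: "'u rel" and F b t
    assume r: "Well_order r" and F: "is_functor (order_category r) C F"
      and succ: "\<forall>i j. is_successor r i j \<longrightarrow> AMap F (i, j) \<in> box_left C N"
      and lim: "\<forall>j. is_limit_element r j \<longrightarrow>
        is_colimit (order_category (Restr r (underS r j))) C F (OMap F j) (\<lambda>i. AMap F (i, j))"
      and bt: "b \<in> Field r" "t \<in> Field r" "\<forall>i \<in> Field r. (b, i) \<in> r \<and> (i, t) \<in> r"
      and h: "h = AMap F (b, t)"
    have "(b, t) \<in> r" using bt by blast
    then have "h \<in> Arr C"
      using is_functorD(4)[OF F order_category_simps(2)] h by (auto simp: in_Hom_iff)
    moreover have "lifts C h g" if g: "g \<in> N" for g
      unfolding h
    proof (rule lifts_transfinite_composition[OF r F _ _ bt(1,2)])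
      show "lifts C (AMap F (i, j)) g" if "is_successor r i j" for i j
        using succ that g by (auto simp: box_left_def)
    qed (use lim bt(3) g N in auto)
    ultimately show ?thesis by (simp add: box_left_def)
  qed
  show "f' \<in> box_left C N" if f: "f \<in> S" and po: "is_pushout C f u f' v" for f u f' v
    using lifts_pushout[OF po] f S N po by (auto simp: box_left_def is_pushout_def)
  show "f \<in> box_left C N" if "h \<in> box_left C N \<and> is_retract (arrow_category C) f h" for f h
    using lifts_retract[of f h] that N by (auto simp: box_left_def is_retract_def arrow_simps)
qed

text \<open>A morphism is a pushout of itself along an identity.\<close>

lemma subset_cof:
  assumes "S \<subseteq> Arr C"
  shows "S \<subseteq> cof U C S"
proof
  fix f assume f: "f \<in> S"
  then have fA: "f \<in> Arr C" using assms by blast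
  have f': "f \<in> Hom C (Dom C f) (Cod C f)" using fA by (rule HomI)
  note I = Ide_in_Hom[OF Dom_in_Obj[OF fA]] Ide_in_Hom[OF Cod_in_Obj[OF fA]]
  have I': "Ide C (Dom C f) \<in> Arr C" "Dom C (Ide C (Dom C f)) = Dom C f" "Cod C (Ide C (Dom C f)) = Dom C f"
    "Ide C (Cod C f) \<in> Arr C" "Dom C (Ide C (Cod C f)) = Cod C f" "Cod C (Ide C (Cod C f)) = Cod C f"
    using I by (auto simp: in_Hom_iff)
  have "is_pushout C f (Ide C (Dom C f)) f (Ide C (Cod C f))"
    unfolding is_pushout_def
  proof (intro conjI allI ballI impI)
    show "Ide C (Cod C f) \<cdot> f = f \<cdot> Ide C (Dom C f)" using Ide_Comp[OF f'] Comp_Ide[OF f'] by simp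
    fix z a b assume "a \<in> Hom C (Cod C f) z" and "b \<in> Hom C (Cod C (Ide C (Dom C f))) z"
      and "a \<cdot> f = b \<cdot> Ide C (Dom C f)"
    then have a: "a \<in> Hom C (Cod C f) z" and b: "b \<in> Hom C (Dom C f) z" "a \<cdot> f = b"
      using I' Comp_Ide by auto
    show "\<exists>!h. h \<in> Hom C (Cod C f) z \<and> h \<cdot> Ide C (Cod C f) = a \<and> h \<cdot> f = b"
    proof (rule ex1I[of _ a])
      show "a \<in> Hom C (Cod C f) z \<and> a \<cdot> Ide C (Cod C f) = a \<and> a \<cdot> f = b"
        using a b Comp_Ide[OF a] by simp
      show "h = a" if "h \<in> Hom C (Cod C f) z \<and> h \<cdot> Ide C (Cod C f) = a \<and> h \<cdot> f = b" for h
        using that Comp_Ide[of h "Cod C f" z] by simp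
    qed
  qed (use fA I' in auto)
  then show "f \<in> cof U C S" using f unfolding cof_def by blast
qed

lemma box_right_cof:
  assumes S: "S \<subseteq> Arr C"
  shows "box_right C (cof U C S) = box_right C S"
proof
  show "box_right C (cof U C S) \<subseteq> box_right C S"
    using subset_cof[OF S] by (auto simp: box_right_def)
  have "cof U C S \<subseteq> box_left C (box_right C S)"
    using S by (intro cof_subset_box_left) (auto simp: box_left_def box_right_def)
  then show "box_right C S \<subseteq> box_right C (cof U C S)"
    by (auto simp: box_left_def box_right_def)
qed

end

text \<open>A lifting problem against a filtered colimit of morphisms is a square into it. Its source is a
  presentable morphism, so the square factors through a stage, where the problem has a solution.\<close>

lemma (in presentability_setting) box_right_filtered_closed:
  assumes fc: "has_filtered_colimits \<kappa> C" and S: "S \<subseteq> Arr C"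
    and pres: "\<And>f. f \<in> S \<Longrightarrow> presentable \<kappa> C (Dom C f)" "\<And>f. f \<in> S \<Longrightarrow> presentable \<kappa> C (Cod C f)"
    and J: "filtered \<kappa> J" and F: "is_functor J (arrow_category C) F"
    and col: "is_colimit J (arrow_category C) F g c"
    and FS: "\<And>i. i \<in> Obj J \<Longrightarrow> OMap F i \<in> box_right C S"
  shows "g \<in> box_right C S"
  unfolding box_right_def
proof (intro CollectI conjI ballI)
  let ?M = "arrow_category C"
  interpret M: presentability_setting \<kappa> ?M by (rule arrow_setting)
  show g: "g \<in> Arr C" using is_coconeD(1)[OF is_colimitD(1)[OF col]] by (simp add: arrow_simps)
  fix f assume f: "f \<in> S"
  then have fA: "f \<in> Arr C" using S by blast
  have f_Hom: "f \<in> Hom C (Dom C f) (Cod C f)" using fA by (rule HomI)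
  have det: "hom_detects J ?M F g c f"
    using M.presentable_detects[OF presentable_arrow[OF fc fA pres[OF f]] J F col] .
  show "lifts C f g"
  proof (rule liftsI)
    fix u v assume u: "u \<in> Hom C (Dom C f) (Dom C g)" and v: "v \<in> Hom C (Cod C f) (Cod C g)"
      and eq: "g \<cdot> u = v \<cdot> f"
    have "Square f u v g \<in> Hom ?M f g"
      using fA g u v eq by (simp add: square_in_Hom_iff)
    then obtain i s where i: "i \<in> Obj J" and s: "s \<in> Hom ?M f (OMap F i)"
      and cs: "c i \<cdot>\<^bsub>?M\<^esub> s = Square f u v g"
      using hom_detectsD(1)[OF det] by blast
    note s' = square_HomD[OF s] and ci = square_HomD[OF is_coconeD(2)[OF is_colimitD(1)[OF col] i]]
    have us: "sq_top (c i) \<cdot> sq_top s = u" and vs: "sq_bot (c i) \<cdot> sq_bot s = v"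
      using arg_cong[OF cs, of sq_top] arg_cong[OF cs, of sq_bot] by (simp_all add: sq_Comp)
    have "lifts C f (OMap F i)" using FS[OF i] f by (simp add: box_right_def)
    then obtain d where d: "d \<in> Hom C (Cod C f) (Dom C (OMap F i))" "d \<cdot> f = sq_top s"
      "OMap F i \<cdot> d = sq_bot s"
      by (rule liftsD[OF _ s'(5,6,7)])
    have "g \<cdot> (sq_top (c i) \<cdot> d) = v"
      using Comp_assoc[OF d(1) ci(5) HomI[OF g]] Comp_assoc[OF d(1) HomI[OF ci(1)] ci(6)] ci(7) d(3) vs
      by simp
    moreover have "sq_top (c i) \<cdot> d \<cdot> f = u"
      using Comp_assoc[OF f_Hom d(1) ci(5)] d(2) us by simp
    ultimately show "\<exists>d \<in> Hom C (Cod C f) (Dom C g). d \<cdot> f = u \<and> g \<cdot> d = v"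
      using Comp_in_Hom[OF d(1) ci(5)] by blast
  qed
qed


section \<open>Full subcategories\<close>

lemma full_simps [simp]:
  "Obj (full_subcategory C X) = X"
  "Dom (full_subcategory C X) = Dom C" "Cod (full_subcategory C X) = Cod C"
  "Ide (full_subcategory C X) = Ide C" "Comp (full_subcategory C X) = Comp C"
  by (simp_all add: full_subcategory_def)

lemma full_Hom: "x \<in> X \<Longrightarrow> y \<in> X \<Longrightarrow> Hom (full_subcategory C X) x y = Hom C x y"
  by (auto simp: full_subcategory_def Hom_def)

lemma full_HomD:
  assumes "f \<in> Hom (full_subcategory C X) x y"
  shows "f \<in> Hom C x y" "x \<in> X" "y \<in> X"
  using assms by (auto simp: full_subcategory_def Hom_def)

locale full_subcat = category C for C :: "('o, 'm) category" +
  fixes X :: "'o set"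
  assumes X: "X \<subseteq> Obj C"
begin

abbreviation "D \<equiv> full_subcategory C X"

lemma category_full: "category D"
proof
  show "f \<in> Arr D \<Longrightarrow> Dom D f \<in> Obj D" "f \<in> Arr D \<Longrightarrow> Cod D f \<in> Obj D" for f
    by (auto simp: full_subcategory_def)
  show "x \<in> Obj D \<Longrightarrow> Ide D x \<in> Hom D x x" for x
    using Ide_in_Hom X by (auto simp: full_Hom)
  show "f \<in> Hom D x y \<Longrightarrow> g \<in> Hom D y z \<Longrightarrow> g \<cdot>\<^bsub>D\<^esub> f \<in> Hom D x z" for f g x y z
    using Comp_in_Hom full_HomD full_Hom by (metis full_simps(5))
  show "f \<in> Hom D x y \<Longrightarrow> f \<cdot>\<^bsub>D\<^esub> Ide D x = f" "f \<in> Hom D x y \<Longrightarrow> Ide D y \<cdot>\<^bsub>D\<^esub> f = f" for f x y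
    using Comp_Ide[OF full_HomD(1)] Ide_Comp[OF full_HomD(1)] by simp_all
  show "f \<in> Hom D w x \<Longrightarrow> g \<in> Hom D x y \<Longrightarrow> h \<in> Hom D y z \<Longrightarrow>
      h \<cdot>\<^bsub>D\<^esub> g \<cdot>\<^bsub>D\<^esub> f = h \<cdot>\<^bsub>D\<^esub> (g \<cdot>\<^bsub>D\<^esub> f)" for f g h w x y z
    using Comp_assoc[OF full_HomD(1) full_HomD(1) full_HomD(1)] by simp
qed

lemma functor_full_iff: "is_functor J D F \<longleftrightarrow> is_functor J C F \<and> (\<forall>i \<in> Obj J. OMap F i \<in> X)"
proof
  assume F: "is_functor J D F"
  have "is_functor J C F"
    by (rule is_functorI[OF is_functorD(1)[OF F] category_axioms])
       (use is_functorD(3)[OF F] X full_HomD(1)[OF is_functorD(4)[OF F]] is_functorD(5,6)[OF F] in auto)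
  then show "is_functor J C F \<and> (\<forall>i \<in> Obj J. OMap F i \<in> X)" using is_functorD(3)[OF F] by simp
next
  assume F: "is_functor J C F \<and> (\<forall>i \<in> Obj J. OMap F i \<in> X)"
  then have F': "is_functor J C F" and FX: "\<And>i. i \<in> Obj J \<Longrightarrow> OMap F i \<in> X" by auto
  interpret J: category J using F' by (rule is_functorD)
  show "is_functor J D F"
  proof (rule is_functorI[OF J.category_axioms category_full])
    show "AMap F a \<in> Hom D (OMap F i) (OMap F j)" if "a \<in> Hom J i j" for a i j
      using is_functorD(4)[OF F' that] FX[OF J.Hom_Obj(1)[OF that]] FX[OF J.Hom_Obj(2)[OF that]]
      by (simp add: full_Hom)
  qed (simp_all add: FX is_functorD(5,6)[OF F'])
qed

lemma cocone_full_iff: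
  assumes "is_functor J D F"
  shows "is_cocone J D F x c \<longleftrightarrow> x \<in> X \<and> is_cocone J C F x c"
  using assms X unfolding functor_full_iff is_cocone_def by (auto simp: full_Hom)

lemma colimit_full:
  assumes F: "is_functor J D F" and x: "x \<in> X" and c: "is_colimit J C F x c"
  shows "is_colimit J D F x c"
proof (rule is_colimitI)
  show "is_cocone J D F x c" using cocone_full_iff[OF F] x is_colimitD(1)[OF c] by blast
  fix y d assume "is_cocone J D F y d"
  then have y: "y \<in> X" "is_cocone J C F y d" using cocone_full_iff[OF F] by auto
  then show "\<exists>h \<in> Hom D x y. \<forall>i \<in> Obj J. h \<cdot>\<^bsub>D\<^esub> c i = d i"
    using is_colimitD(2)[OF c y(2)] x by (simp add: full_Hom)
next
  fix y h h' assume h: "h \<in> Hom D x y" "h' \<in> Hom D x y"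
    and eq: "\<forall>i \<in> Obj J. h \<cdot>\<^bsub>D\<^esub> c i = h' \<cdot>\<^bsub>D\<^esub> c i"
  have "is_functor J C F" using F functor_full_iff by blast
  from colimit_eqI[OF this c full_HomD(1)[OF h(1)] full_HomD(1)[OF h(2)]] eq show "h = h'" by simp
qed

text \<open>The given colimit in the subcategory need not be one in the ambient category \<^emph>\<open>a priori\<close>. It
  is isomorphic to the ambient colimit once the latter lies in the subcategory.\<close>

lemma colimit_of_full:
  assumes F: "is_functor J D F" and c: "is_colimit J D F x c"
    and d: "is_colimit J C F y d" and y: "y \<in> X"
  shows "is_colimit J C F x c"
proof -
  have F': "is_functor J C F" using F functor_full_iff by blast
  have x: "x \<in> X" "is_cocone J C F x c" using cocone_full_iff[OF F] is_colimitD(1)[OF c] by auto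
  obtain p q where p: "p \<in> Hom D y x" and q: "q \<in> Hom D x y"
    and qp: "q \<cdot>\<^bsub>D\<^esub> p = Ide D y" and pq: "p \<cdot>\<^bsub>D\<^esub> q = Ide D x"
    and pd: "\<And>i. i \<in> Obj J \<Longrightarrow> p \<cdot>\<^bsub>D\<^esub> d i = c i"
    by (rule colimits_isomorphic[OF F colimit_full[OF F y d] c]) blast
  show ?thesis
    using colimit_iso_transport[OF F' d x(2) full_HomD(1)[OF p] _ full_HomD(1)[OF q]] pd qp pq by simp
qed

end

lemma (in presentability_setting) full_setting:
  assumes "X \<subseteq> Obj C"
  shows "presentability_setting \<kappa> (full_subcategory C X)"
proof -
  interpret full_subcat C X using assms by unfold_locales
  have "has_small_homs TYPE('u) (full_subcategory C X)"
    using small_homs X unfolding has_small_homs_def by (auto simp: full_Hom)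
  then show ?thesis
    using category_full cardinal universe two_arrows
    by (simp add: presentability_setting_def presentability_setting_axioms_def)
qed

locale closed_full_subcat = presentability_setting \<kappa> C
  for \<kappa> :: "'u rel" and C :: "('o, 'm) category" +
  fixes X :: "'o set"
  assumes X: "X \<subseteq> Obj C" and colimits: "has_filtered_colimits \<kappa> C"
    and closed: "filtered \<kappa> J \<Longrightarrow> is_functor J C F \<Longrightarrow> (\<And>i. i \<in> Obj J \<Longrightarrow> OMap F i \<in> X) \<Longrightarrow>
      is_colimit J C F x c \<Longrightarrow> x \<in> X"
begin

sublocale full_subcat C X using X by unfold_locales

sublocale full: presentability_setting \<kappa> D using full_setting[OF X] .

lemma filtered_colimit_in_X:
  assumes J: "filtered \<kappa> J" and F: "is_functor J D F"
  obtains x c where "is_colimit J C F x c" "x \<in> X"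
proof -
  have F': "is_functor J C F" "\<And>i. i \<in> Obj J \<Longrightarrow> OMap F i \<in> X" using F[unfolded functor_full_iff] by auto
  obtain x c where c: "is_colimit J C F x c"
    using colimits J F'(1) unfolding has_filtered_colimits_def by blast
  show thesis using that[OF c closed[OF J F' c]] .
qed

lemma filtered_colimits_full: "has_filtered_colimits \<kappa> D"
  unfolding has_filtered_colimits_def
proof (intro allI impI, elim conjE)
  fix J F assume J: "filtered \<kappa> J" and F: "is_functor J D F"
  obtain x c where "is_colimit J C F x c" "x \<in> X" using filtered_colimit_in_X[OF J F] by blast
  then show "\<exists>x c. is_colimit J D F x c" using colimit_full[OF F] by blast
qed

text \<open>Filtered colimits in the subcategory are filtered colimits in the ambient category.\<close>

lemma presentable_full:
  assumes k: "k \<in> X" "presentable \<kappa> C k"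
  shows "presentable \<kappa> D k"
proof (rule full.presentableI)
  show "k \<in> Obj D" using k by simp
  fix J F x c assume J: "filtered \<kappa> J" and F: "is_functor J D F" and c: "is_colimit J D F x c"
  have F': "is_functor J C F" and FX: "\<And>i. i \<in> Obj J \<Longrightarrow> OMap F i \<in> X" using F[unfolded functor_full_iff] by auto
  have x: "x \<in> X" using is_coconeD(1)[OF is_colimitD(1)[OF c]] by simp
  obtain y d where d: "is_colimit J C F y d" "y \<in> X" using filtered_colimit_in_X[OF J F] by blast
  have "hom_detects J C F x c k"
    using presentable_detects[OF k(2) J F' colimit_of_full[OF F c d]] .
  then show "hom_detects J D F x c k"
    using k(1) x FX by (simp add: hom_detects_def full_Hom)
qed

text \<open>The objects of \<open>P\<close> are presentable in both categories. A presentable object of the subcategory is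
  a filtered colimit of objects of \<open>P\<close>; its identity factors through a stage, so it is a retract of
  an object of \<open>P\<close>, and presentability in the ambient category passes to retracts.\<close>

lemma accessibly_embedded_by_dense_class:
  assumes P: "\<And>p. p \<in> P \<Longrightarrow> p \<in> X" "\<And>p. p \<in> P \<Longrightarrow> presentable \<kappa> C p"
    and dense: "\<And>x. x \<in> X \<Longrightarrow> \<exists>J F c. filtered \<kappa> J \<and> is_functor J C F \<and>
      (\<forall>i \<in> Obj J. OMap F i \<in> P) \<and> is_colimit J C F x c"
  shows "class_accessible \<kappa> D" "strongly_accessibly_embedded \<kappa> X C"
proof -
  have dense': "\<exists>J F c. filtered \<kappa> J \<and> is_functor J D F \<and>
      (\<forall>i \<in> Obj J. OMap F i \<in> P) \<and> is_colimit J D F x c" if x: "x \<in> X" for x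
  proof -
    obtain J F c where J: "filtered \<kappa> J" "is_functor J C F" "\<forall>i \<in> Obj J. OMap F i \<in> P"
      "is_colimit J C F x c" using dense[OF x] by blast
    then have F: "is_functor J D F" using functor_full_iff P(1) by blast
    then show ?thesis using J colimit_full[OF F x] by blast
  qed
  have "\<forall>x \<in> Obj D. \<exists>J F c. filtered \<kappa> J \<and> is_functor J D F \<and>
      (\<forall>i \<in> Obj J. OMap F i \<in> P) \<and> is_colimit J D F x c" using dense' by simp
  moreover have "\<forall>k \<in> P. presentable \<kappa> D k" using presentable_full P by blast
  ultimately show "class_accessible \<kappa> D"
    unfolding class_accessible_def
    using category_full full.small_homs filtered_colimits_full by blast
  show "strongly_accessibly_embedded \<kappa> X C"
    unfolding strongly_accessibly_embedded_def
  proof (intro conjI allI impI X)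
    show "x \<in> X" if "filtered \<kappa> J \<and> is_functor J C F \<and> (\<forall>i \<in> Obj J. OMap F i \<in> X) \<and> is_colimit J C F x c"
      for J F x c
      using closed that by blast
    fix k assume k: "presentable \<kappa> D k"
    then have kX: "k \<in> X" using full.presentable_iff by simp
    obtain J F c where J: "filtered \<kappa> J" and F: "is_functor J D F"
      and FP: "\<forall>i \<in> Obj J. OMap F i \<in> P" and c: "is_colimit J D F k c" using dense'[OF kX] by blast
    \<comment> \<open>The identity of \<open>k\<close> factors through a stage.\<close>
    have kO: "k \<in> Obj D" using kX by simp
    obtain i s where i: "i \<in> Obj J" and s: "s \<in> Hom D k (OMap F i)" and cs: "c i \<cdot>\<^bsub>D\<^esub> s = Ide D k"
      using hom_detectsD(1)[OF full.presentable_detects[OF k J F c] full.Ide_in_Hom[OF kO]] by blast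
    have "is_retract C k (OMap F i)"
      unfolding is_retract_def
      using full_HomD(1)[OF s] full_HomD(1)[OF is_coconeD(2)[OF is_colimitD(1)[OF c] i]] cs Hom_Obj
      by (intro conjI bexI[of _ s] bexI[of _ "c i"]) auto
    then show "presentable \<kappa> C k" using presentable_retract P(2) FP i by blast
  qed
qed

end


section \<open>Accessibility of the right class of a weak factorization system\<close>

lemma initial_object_exists:
  fixes C :: "('o, 'm) category"
  assumes "category C" "cocomplete_category TYPE('u) C" and U: "set_universe TYPE('u)"
  obtains z where "z \<in> Obj C" "\<And>y. y \<in> Obj C \<Longrightarrow> \<exists>!h. h \<in> Hom C z y"
proof -
  define J :: "('u, 'u) category" where
    "J = \<lparr>Obj = {}, Arr = {}, Dom = undefined, Cod = undefined, Ide = undefined, Comp = undefined\<rparr>"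
  have empty: "Obj J = {}" "Arr J = {}" by (simp_all add: J_def)
  have J: "category J" by standard (simp_all add: empty Hom_def)
  have "small_category TYPE('u) J" using J by (simp add: small_category_def empty small_finite[OF U])
  moreover have "is_functor J C undefined"
    by (rule is_functorI[OF J assms(1)]) (simp_all add: empty Hom_def)
  ultimately obtain z c where z: "is_colimit J C undefined z c"
    using assms(2) unfolding cocomplete_category_def by blast
  show thesis
  proof (rule that)
    show "z \<in> Obj C" using is_coconeD(1)[OF is_colimitD(1)[OF z]] .
    fix y assume "y \<in> Obj C"
    then have "is_cocone J C undefined y undefined" by (simp add: is_cocone_def empty)
    from is_colimitD(3)[OF z this] show "\<exists>!h. h \<in> Hom C z y" by (simp add: empty)
  qed
qed

text \<open>A lift of \<open>l\<close> against \<open>g\<close> turns a square from \<open>r \<cdot> l\<close> to \<open>g\<close> into a square from \<open>r\<close> to \<open>g\<close>.\<close>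

lemma (in category) weak_factorization_over:
  assumes lr: "weak_factorization C L R f l r" and L: "L \<subseteq> Arr C" and R: "R \<subseteq> Arr C"
    and lift: "lifts C l g" and s: "s \<in> Hom (arrow_category C) f g"
  obtains m x where "m \<in> Hom (arrow_category C) f r" "x \<in> Hom (arrow_category C) r g"
    "x \<cdot>\<^bsub>arrow_category C\<^esub> m = s" "Dom C r = Cod C l" "Cod C r = Cod C f"
proof -
  let ?M = "arrow_category C"
  have l: "l \<in> Hom C (Dom C l) (Cod C l)" and r: "r \<in> Hom C (Cod C l) (Cod C r)"
    and f: "f = r \<cdot> l" and rA: "r \<in> Arr C"
    using lr L R by (auto simp: weak_factorization_def in_Hom_iff)
  note s' = square_HomD[OF s]
  have f': "Dom C f = Dom C l" "Cod C f = Cod C r"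
    using Comp_in_Hom[OF l r] by (auto simp: f in_Hom_iff)
  have g: "g \<in> Hom C (Dom C g) (Cod C g)" using HomI[OF s'(2)] .
  have v: "sq_bot s \<in> Hom C (Cod C r) (Cod C g)" using s'(6) f' by simp
  have "g \<cdot> sq_top s = sq_bot s \<cdot> r \<cdot> l"
    using Comp_assoc[OF l r v] s'(7) f by simp
  then obtain d where d: "d \<in> Hom C (Cod C l) (Dom C g)" "d \<cdot> l = sq_top s"
    "g \<cdot> d = sq_bot s \<cdot> r"
    using liftsD[OF lift, of "sq_top s" "sq_bot s \<cdot> r"] s'(5) f' Comp_in_Hom[OF r v] by auto
  have I: "Ide C (Cod C r) \<in> Hom C (Cod C r) (Cod C r)" using Ide_in_Hom[OF Hom_Obj(2)[OF r]] .
  have rD: "Dom C r = Cod C l" using r by (simp add: in_Hom_iff)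
  show thesis
  proof (rule that)
    show "Square f l (Ide C (Cod C r)) r \<in> Hom ?M f r"
      using s'(1) rA l f' rD I Ide_Comp[of f "Dom C f" "Cod C r"] HomI[OF s'(1)] f
      by (simp add: square_in_Hom_iff)
    show "Square r d (sq_bot s) g \<in> Hom ?M r g"
      using s'(2) rA d v rD by (simp add: square_in_Hom_iff)
    show "Square r d (sq_bot s) g \<cdot>\<^bsub>?M\<^esub> Square f l (Ide C (Cod C r)) r = s"
      using d(2) s'(3,4) Comp_Ide[OF v] by (intro square.expand) (simp add: sq_Comp)
    show "Dom C r = Cod C l" "Cod C r = Cod C f" using rD f' by simp_all
  qed
qed

theorem theorem4p9:
  fixes \<kappa> :: "'u rel" and K :: "('u, 'u) category" and L R :: "'u set"
  assumes "set_universe TYPE('u)"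
    and "small_regular_cardinal \<kappa>"
    and "class_locally_presentable \<kappa> K"
    and "weak_factorization_system K L R"
    and "cofibrantly_class_generated \<kappa> K L R"
  shows "class_accessible \<kappa> (full_subcategory (arrow_category K) R) \<and>
         strongly_accessibly_embedded \<kappa> R (arrow_category K)"
proof -
  let ?M = "arrow_category K"
  have K: "category K" "has_small_homs TYPE('u) K" and fc: "has_filtered_colimits \<kappa> K"
    and cocomplete: "cocomplete_category TYPE('u) K"
    and acc: "\<And>x. x \<in> Obj K \<Longrightarrow> \<exists>J F c. filtered \<kappa> J \<and> is_functor J K F \<and>
      (\<forall>i \<in> Obj J. presentable \<kappa> K (OMap F i)) \<and> is_colimit J K F x c"
  proof -
    have "class_accessible \<kappa> K" and "cocomplete_category TYPE('u) K"
      using assms(3) by (simp_all add: class_locally_presentable_def)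
    then show "category K" "has_small_homs TYPE('u) K" "has_filtered_colimits \<kappa> K"
      "cocomplete_category TYPE('u) K" by (simp_all add: class_accessible_def)
    obtain A where A: "\<forall>k \<in> A. presentable \<kappa> K k"
      and dense: "\<forall>x \<in> Obj K. \<exists>J F c. filtered \<kappa> J \<and> is_functor J K F \<and>
           (\<forall>i \<in> Obj J. OMap F i \<in> A) \<and> is_colimit J K F x c"
      using \<open>class_accessible \<kappa> K\<close> unfolding class_accessible_def by blast
    fix x assume "x \<in> Obj K"
    with dense A show "\<exists>J F c. filtered \<kappa> J \<and> is_functor J K F \<and>
      (\<forall>i \<in> Obj J. presentable \<kappa> K (OMap F i)) \<and> is_colimit J K F x c" by meson
  qed
  have LR: "L \<subseteq> Arr K" "R \<subseteq> Arr K" "R = box_right K L"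
    using assms(4) unfolding weak_factorization_system_def by blast+
  obtain S where S: "S \<subseteq> Arr K" "L = cof TYPE('u) K S"
    and S_pres: "\<And>f. f \<in> S \<Longrightarrow> presentable \<kappa> K (Dom K f)" "\<And>f. f \<in> S \<Longrightarrow> presentable \<kappa> K (Cod K f)"
    using assms(5) unfolding cofibrantly_class_generated_def cone_coreflective_def by blast
  have fact: "\<exists>f g. weak_factorization K L R h f g \<and> presentable \<kappa> K (Cod K f)"
    if "h \<in> Arr K" "presentable \<kappa> K (Dom K h)" "presentable \<kappa> K (Cod K h)" for h
    using assms(5) that unfolding cofibrantly_class_generated_def by blast
  have "\<exists>t t' :: 'u. t \<noteq> t'"
  proof (rule ccontr)
    assume "\<not> ?thesis"
    then have "(UNIV :: 'u set) = {undefined}" by auto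
    then show False using set_universeD(1)[OF assms(1)] by (metis finite.emptyI finite.insertI)
  qed
  then interpret K: presentability_setting \<kappa> K
    using K assms(1,2) by (simp add: presentability_setting_def presentability_setting_axioms_def)
  interpret M: presentability_setting \<kappa> ?M by (rule K.arrow_setting)
  have R: "R = box_right K S" using LR(3) S(2) K.box_right_cof[OF S(1)] by simp
  interpret M: closed_full_subcat \<kappa> ?M R
  proof unfold_locales
    show "R \<subseteq> Obj ?M" using LR(2) by (simp add: arrow_simps)
    show "has_filtered_colimits \<kappa> ?M" using K.filtered_colimits_arrow[OF fc] .
    show "x \<in> R" if "filtered \<kappa> J" "is_functor J ?M F"
      "\<And>i. i \<in> Obj J \<Longrightarrow> OMap F i \<in> R" "is_colimit J ?M F x c" for J F x c
      using K.box_right_filtered_closed[OF fc S(1) S_pres that(1,2,4)] that(3) unfolding R by blast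
  qed
  obtain z where z: "z \<in> Obj K" "\<And>y. y \<in> Obj K \<Longrightarrow> \<exists>!h. h \<in> Hom K z y"
    using initial_object_exists[OF K(1) cocomplete assms(1)] by blast
  define P where "P = {p \<in> R. presentable \<kappa> K (Dom K p) \<and> presentable \<kappa> K (Cod K p)}"
  have P: "p \<in> R" "p \<in> Arr K" "presentable \<kappa> K (Dom K p)" "presentable \<kappa> K (Cod K p)" if "p \<in> P" for p
    using that LR(2) by (auto simp: P_def)
  have dense: "\<exists>J F c. filtered \<kappa> J \<and> is_functor J ?M F \<and>
      (\<forall>i \<in> Obj J. OMap F i \<in> P) \<and> is_colimit J ?M F g c" if g: "g \<in> R" for g
  proof -
    have gA: "g \<in> Arr K" using g LR(2) by blast
    obtain I G \<gamma> where I: "filtered \<kappa> I" "is_functor I K G" "is_colimit I K G (Dom K g) \<gamma>"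
      "\<And>i. i \<in> Obj I \<Longrightarrow> presentable \<kappa> K (OMap G i)"
      using acc[OF K.Dom_in_Obj[OF gA]] by blast
    obtain J H \<eta> where J: "filtered \<kappa> J" "is_functor J K H" "is_colimit J K H (Cod K g) \<eta>"
      "\<And>j. j \<in> Obj J \<Longrightarrow> presentable \<kappa> K (OMap H j)"
      using acc[OF K.Cod_in_Obj[OF gA]] by blast
    interpret presented_arrow_over \<kappa> K I G \<gamma> J H \<eta> g P z
    proof (unfold_locales)
      fix s f assume s: "s \<in> Hom ?M f g"
        and f: "presentable \<kappa> K (Dom K f)" "presentable \<kappa> K (Cod K f)"
      obtain l r where lr: "weak_factorization K L R f l r" and l: "presentable \<kappa> K (Cod K l)"
        using fact[OF square_HomD(1)[OF s] f] by blast
      have "l \<in> L" "r \<in> R" using lr by (auto simp: weak_factorization_def)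
      then have lift: "lifts K l g" using g LR(3) by (simp add: box_right_def)
      obtain m x where m: "m \<in> Hom ?M f r" "x \<in> Hom ?M r g"
        "x \<cdot>\<^bsub>?M\<^esub> m = s" and r: "Dom K r = Cod K l" "Cod K r = Cod K f"
        by (rule K.weak_factorization_over[OF lr LR(1,2) lift s])
      have "r \<in> P" using \<open>r \<in> R\<close> r l f by (simp add: P_def)
      then show "\<exists>p \<in> P. \<exists>m \<in> Hom ?M f p. \<exists>x \<in> Hom ?M p g.
        x \<cdot>\<^bsub>?M\<^esub> m = s" using m by blast
    qed (rule gA I J P(2-4) z; assumption)+
    show ?thesis using filtered_colimit_of_refining_class by metis
  qed
  have "\<And>p. p \<in> P \<Longrightarrow> presentable \<kappa> ?M p"
    using K.presentable_arrow[OF fc P(2-4)] by blast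
  from M.accessibly_embedded_by_dense_class[OF P(1) this dense]
  show ?thesis by blast
qed

end
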